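(* Let $k$ be a field and let $A$ be a Frobenius $k$-algebra with semisimple Nakayama automorphism. Then the Hochschild cohomology ring $HH^*(A)$ of $A$ is a Batalin-Vilkovisky algebra.
   Context: All tensor products are over $k$ unless indicated otherwise. Frobenius algebras: a finite dimensional (associative unital) $k$-algebra $A$ is Frobenius if it carries a non-degenerate bilinear form $\langle-,-\rangle:A\times A\to k$ with $\langle ab,c\rangle=\langle a,bc\rangle$ for all $a,b,c$. The Nakayama automorphism $\mathfrak{N}:A\to A$ (associated to this form) is the algebra automorphism determined by $\langle a,b\rangle=\langle b,\mathfrak{N}(a)\rangle$ for all $a,b\in A$. It is called semisimple if, as a $k$-linear endomorphism of $A$, it is diagonalisable over the algebraic closure $\overline{k}$ of $k$. Hochschild cohomology: put $\overline{A}=A/(k\cdot 1_A)$, $C^r(A,A)=\mathrm{Hom}_k(\overline{A}^{\otimes r},A)$ for $r\ge 0$ (so $C^0(A,A)=A$), with differential $b^r:C^r(A,A)\to C^{r+1}(A,A)$, $b^r(f)(\overline{a_1}\otimes\cdots\otimes\overline{a_{r+1}})=(-1)^{r+1}a_1f(\overline{a_2}\otimes\cdots\otimes\overline{a_{r+1}})+\sum_{i=1}^r(-1)^{r+1-i}f(\overline{a_1}\otimes\cdots\otimes\overline{a_ia_{i+1}}\otimes\cdots\otimes\overline{a_{r+1}})+f(\overline{a_1}\otimes\cdots\otimes\overline{a_r})a_{r+1}$. Its cohomology is $HH^*(A)=HH^*(A,A)$. The cup product is induced by $(\alpha\cup\beta)(\overline{a_1}\otimes\cdots\otimes\overline{a_{p+q}})=(-1)^{pq}\alpha(\overline{a_1}\otimes\cdots\otimes\overline{a_p})\beta(\overline{a_{p+1}}\otimes\cdots\otimes\overline{a_{p+q}})$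 for $\alpha\in C^p$, $\beta\in C^q$. The Lie bracket of degree $-1$ is induced, for $\alpha\in C^n$, $\beta\in C^m$, by $[\alpha,\beta]=\alpha\,\overline{\circ}\,\beta-(-1)^{(n-1)(m-1)}\beta\,\overline{\circ}\,\alpha$, where $\alpha\,\overline{\circ}\,\beta=\sum_{i=1}^n(-1)^{(m-1)(i-1)}\alpha\,\overline{\circ}_i\,\beta$ and $\alpha\,\overline{\circ}_i\,\beta\in C^{n+m-1}$ inserts $\beta$ (applied to the $i$-th through $(i+m-1)$-st arguments; the element $\beta\in A$ itself if $m=0$) into the $i$-th slot of $\alpha$; $\alpha\,\overline{\circ}\,\beta=0$ if $n=0$. With these operations $(HH^*(A),\cup,[\ ,\ ])$ is a Gerstenhaber algebra: $\cup$ is graded commutative associative unital, $[\ ,\ ]$ is a graded Lie bracket on $HH^*(A)[-1]$, and $[\alpha,\beta\cup\gamma]=[\alpha,\beta]\cup\gamma+(-1)^{(|\alpha|-1)|\beta|}\beta\cup[\alpha,\gamma]$. Batalin-Vilkovisky algebras: a Gerstenhaber algebra $(\mathcal{H}^*,\cup,[\ ,\ ])$ is a Batalin-Vilkovisky (BV) algebra if it has a linear operator $\Delta:\mathcal{H}^*\to\mathcal{H}^{*-1}$ of degree $-1$ with $\Delta\circ\Delta=0$, $\Delta(1)=0$ and $[\alpha,\beta]=(-1)^{|\alpha|+1}\big(\Delta(\alpha\cup\beta)-\Delta(\alpha)\cup\beta-(-1)^{|\alpha|}\alpha\cup\Delta(\beta)\big)$ for all homogeneous $\alpha,\beta$. The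 assertion that $HH^*(A)$ is a BV algebra refers to the Gerstenhaber structure above. *)

theory Defs
  imports
    "HOL-Library.Function_Algebras"
    "HOL-Algebra.Algebraic_Closure_Type"
    "Jordan_Normal_Form.VS_Connect"
begin

section \<open>Algebras over a field\<close>

text \<open>The sort \<open>{ring, monoid_mult}\<close> describes associative unital rings and, unlike
  \<open>ring_1\<close>, does not exclude the zero ring.\<close>

locale k_algebra = vector_space scale
  for scale :: "'k::field \<Rightarrow> 'a::{ring, monoid_mult} \<Rightarrow> 'a" (infixr \<open>*s\<close> 75) +
  assumes scale_mult_left: "(c *s a) * b = c *s (a * b)"
    and scale_mult_right: "a * (c *s b) = c *s (a * b)"

locale frobenius_algebra = k_algebra scale
  for scale :: "'k::field \<Rightarrow> 'a::{ring, monoid_mult} \<Rightarrow> 'a" (infixr \<open>*s\<close> 75) +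
  fixes form :: "'a \<Rightarrow> 'a \<Rightarrow> 'k"
  assumes finite_dim: "\<exists>S. finite S \<and> span S = UNIV"
    and form_linear_left: "Vector_Spaces.linear scale (*) (\<lambda>a. form a b)"
    and form_linear_right: "Vector_Spaces.linear scale (*) (form a)"
    and form_assoc: "form (a * b) c = form a (b * c)"
    and form_nondegenerate_left: "(\<And>b. form a b = 0) \<Longrightarrow> a = 0"
    and form_nondegenerate_right: "(\<And>a. form a b = 0) \<Longrightarrow> b = 0"

text \<open>For a Frobenius form the map described here exists and is unique, and it is a
  k-algebra automorphism, as the lemmas below show.\<close>

definition nakayama :: "('a \<Rightarrow> 'a \<Rightarrow> 'k) \<Rightarrow> 'a \<Rightarrow> 'a" where
  "nakayama form = (THE N. \<forall>a b. form a b = form b (N a))"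

context frobenius_algebra
begin

lemma ex_nakayama: "\<exists>c. \<forall>b. form a b = form b c"
proof -
  obtain S where S: "finite S" "span S = UNIV"
    using finite_dim by blast
  obtain B where B: "B \<subseteq> S" "independent B" "S \<subseteq> span B"
    using maximal_independent_subset[of S] by blast
  have spanB: "span B = UNIV"
    using span_minimal[OF B(3) subspace_span] S(2) by blast
  have fB: "finite B" using B(1) S(1) finite_subset by blast
  interpret fd: finite_dimensional_vector_space scale B
    by unfold_locales (use fB B spanB in auto)
  define L where "L = (\<lambda>c. \<Sum>b\<in>B. form b c *s b)"
  have add: "form b (x + y) = form b x + form b y" for b x y
    using form_linear_right[of b] by (simp add: Vector_Spaces.linear_iff)
  have scl: "form b (r *s x) = r * form b x" for b r x
    using form_linear_right[of b] by (simp add: Vector_Spaces.linear_iff)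
  have vs: "vector_space scale" by unfold_locales
  have linL: "Vector_Spaces.linear scale scale L"
    unfolding Vector_Spaces.linear_iff L_def
    using vs by (simp add: add scl scale_left_distrib sum.distrib scale_sum_right)
  have coeff: "f b = g b" if "(\<Sum>b\<in>B. f b *s b) = (\<Sum>b\<in>B. g b *s b)" "b \<in> B" for f g b
  proof -
    have "(\<Sum>b\<in>B. (f b - g b) *s b) = 0"
      using that(1) by (simp add: scale_left_diff_distrib sum_subtractf)
    then have "f b - g b = 0"
      using independentD[OF B(2) fB order.refl, of "\<lambda>b. f b - g b"] that(2) by blast
    then show ?thesis by simp
  qed
  have ext: "f = g" if "Vector_Spaces.linear scale (*) f" "Vector_Spaces.linear scale (*) g"
    "\<And>b. b \<in> B \<Longrightarrow> f b = g b" for f g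
  proof
    fix x
    interpret p: vector_space_pair scale "(*) :: 'k \<Rightarrow> 'k \<Rightarrow> 'k"
      using that(1) by (simp add: vector_space_pair_def Vector_Spaces.linear_def)
    show "f x = g x"
      by (rule p.linear_eq_on_span[OF that(1,2), of B]) (simp_all add: that(3) spanB)
  qed
  have "inj L"
  proof (rule injI)
    fix c d assume eq: "L c = L d"
    have "(\<lambda>b. form b c) = (\<lambda>b. form b d)"
      by (rule ext[OF form_linear_left form_linear_left]) (use coeff eq in \<open>auto simp: L_def\<close>)
    then have "form b (c - d) = 0" for b
      using add[of b "c - d" d] by (simp add: fun_eq_iff)
    then show "c = d"
      using form_nondegenerate_right[of "c - d"] by simp
  qed
  then have "surj L"
    using fd.linear_inj_imp_surj[OF linL] by simp
  then obtain c where c: "(\<Sum>b\<in>B. form a b *s b) = L c"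
    by (metis surjD)
  have "form a = (\<lambda>b. form b c)"
    by (rule ext[OF form_linear_right form_linear_left]) (use coeff c in \<open>auto simp: L_def\<close>)
  then show ?thesis by metis
qed

lemma form_right_eqI:
  assumes "\<And>b. form b c = form b d"
  shows "c = d"
proof -
  have "form b (c - d) = 0" for b
  proof -
    have "form b (c - d + d) = form b (c - d) + form b d"
      using form_linear_right[of b] unfolding Vector_Spaces.linear_iff by blast
    then show ?thesis by (simp add: assms)
  qed
  then show ?thesis using form_nondegenerate_right[of "c - d"] by simp
qed

lemma ex1_nakayama: "\<exists>!N. \<forall>a b. form a b = form b (N a)"
proof -
  obtain N where N: "\<forall>a b. form a b = form b (N a)"
    using ex_nakayama by metis
  moreover have "M = N" if "\<forall>a b. form a b = form b (M a)" for M
  proof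
    fix a show "M a = N a"
      by (rule form_right_eqI) (use N that in metis)
  qed
  ultimately show ?thesis by blast
qed

lemma form_nakayama: "form a b = form b (nakayama form a)"
  using theI'[OF ex1_nakayama] unfolding nakayama_def by blast

lemma nakayama_linear: "Vector_Spaces.linear scale scale (nakayama form)"
proof -
  have vs: "vector_space scale" by unfold_locales
  have addl: "form (x + y) b = form x b + form y b" and scll: "form (r *s x) b = r * form x b" for b r x y
    using form_linear_left[of b] by (simp_all add: Vector_Spaces.linear_iff)
  have addr: "form b (x + y) = form b x + form b y" and sclr: "form b (r *s x) = r * form b x" for b r x y
    using form_linear_right[of b] by (simp_all add: Vector_Spaces.linear_iff)
  show ?thesis
    unfolding Vector_Spaces.linear_iff
    by (intro conjI allI vs form_right_eqI)
      (simp_all only: addl scll addr sclr form_nakayama[symmetric])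
qed

lemma nakayama_mult: "nakayama form (a * b) = nakayama form a * nakayama form b"
proof (rule form_right_eqI)
  fix c
  have "form c (nakayama form (a * b)) = form a (b * c)"
    by (simp only: form_nakayama[symmetric] form_assoc)
  also have "\<dots> = form b (c * nakayama form a)"
    by (subst form_nakayama) (simp only: form_assoc)
  also have "\<dots> = form c (nakayama form a * nakayama form b)"
    by (subst form_nakayama) (simp only: form_assoc)
  finally show "form c (nakayama form (a * b)) = form c (nakayama form a * nakayama form b)" .
qed

lemma nakayama_one: "nakayama form 1 = 1"
proof (rule form_right_eqI)
  fix c
  have "form c (nakayama form 1) = form 1 (c * 1)"
    by (simp only: form_nakayama[symmetric] mult_1_right)
  also have "\<dots> = form c 1"
    by (simp only: form_assoc[symmetric] mult_1_left)
  finally show "form c (nakayama form 1) = form c 1" .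
qed

lemma nakayama_bij: "bij (nakayama form)"
proof -
  obtain S where S: "finite S" "span S = UNIV"
    using finite_dim by blast
  obtain B where B: "B \<subseteq> S" "independent B" "S \<subseteq> span B"
    using maximal_independent_subset[of S] by blast
  have spanB: "span B = UNIV"
    using span_minimal[OF B(3) subspace_span] S(2) by blast
  interpret fd: finite_dimensional_vector_space scale B
    by unfold_locales (use B spanB S(1) finite_subset in auto)
  have "inj (nakayama form)"
  proof (rule injI)
    fix a b assume eq: "nakayama form a = nakayama form b"
    have "form (a - b + b) c = form (a - b) c + form b c" for c
      using form_linear_left[of c] unfolding Vector_Spaces.linear_iff by blast
    moreover have "form a c = form b c" for c
      using eq form_nakayama by metis
    ultimately have "form (a - b) c = 0" for c by simp
    then show "a = b" using form_nondegenerate_left[of "a - b"] by simp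
  qed
  then show ?thesis
    using fd.linear_inj_imp_surj[OF nakayama_linear] by (simp add: bij_def)
qed

end

definition endo_matrix ::
  "('k::field \<Rightarrow> 'a::ab_group_add \<Rightarrow> 'a) \<Rightarrow> 'a list \<Rightarrow> ('a \<Rightarrow> 'a) \<Rightarrow> 'k mat" where
  "endo_matrix scale bs T =
     mat (length bs) (length bs)
       (\<lambda>(i, j). Modules.module.representation scale (set bs) (T (bs ! j)) (bs ! i))"

text \<open>An endomorphism \<open>T\<close> is diagonalisable over the algebraic closure if the extension of its
  matrix with respect to a \<open>k\<close>-basis is similar, over the algebraic closure, to a diagonal
  matrix.  This does not depend on the basis.\<close>

definition semisimple_endo ::
  "('k::field \<Rightarrow> 'a::ab_group_add \<Rightarrow> 'a) \<Rightarrow> ('a \<Rightarrow> 'a) \<Rightarrow> bool" where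
  "semisimple_endo scale T \<longleftrightarrow>
     Vector_Spaces.linear scale scale T \<and>
     (\<exists>bs. distinct bs \<and> \<not> Modules.module.dependent scale (set bs) \<and> Modules.module.span scale (set bs) = UNIV \<and>
       (\<exists>D :: 'k alg_closure mat. diagonal_mat D \<and>
          similar_mat (map_mat to_ac (endo_matrix scale bs T)) D))"


section \<open>Hochschild cohomology\<close>

text \<open>Degrees are integers; the complex vanishes in negative degrees.  A cochain of degree
  \<open>n\<close>, that is, a linear map on the \<open>n\<close>-th tensor power of \<open>A / k1\<close>, is represented by the
  corresponding multilinear map on \<open>A\<close>, which vanishes as soon as one argument is in \<open>k1\<close>.
  The arguments form a list of length \<open>n\<close>; on lists of any other length the function is
  \<open>0\<close> by convention, so a cochain of negative degree is \<open>0\<close>.\<close>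

context
  fixes scale :: "'k::field \<Rightarrow> 'a::{ring, monoid_mult} \<Rightarrow> 'a" (infixr \<open>*s\<close> 75)
begin

definition cochains :: "int \<Rightarrow> ('a list \<Rightarrow> 'a) set" where
  "cochains n = {f.
     (\<forall>xs. int (length xs) \<noteq> n \<longrightarrow> f xs = 0) \<and>
     (\<forall>xs ys. Vector_Spaces.linear scale scale (\<lambda>a. f (xs @ a # ys))) \<and>
     (\<forall>xs c ys. f (xs @ (c *s 1) # ys) = 0)}"

definition scale_cochain :: "'k \<Rightarrow> ('a list \<Rightarrow> 'a) \<Rightarrow> 'a list \<Rightarrow> 'a" where
  "scale_cochain c f = (\<lambda>xs. c *s f xs)"

text \<open>List positions count from \<open>0\<close>: the argument \<open>a\<^sub>i\<close> is \<open>xs ! (i - 1)\<close>.\<close>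

definition hochschild_b :: "int \<Rightarrow> ('a list \<Rightarrow> 'a) \<Rightarrow> 'a list \<Rightarrow> 'a" where
  "hochschild_b r f = (\<lambda>xs. if int (length xs) = r + 1 then
       (-1) powi (r + 1) *s (hd xs * f (tl xs))
       + (\<Sum>i = 1..nat r. (-1) powi (r + 1 - int i) *s
            f (take (i - 1) xs @ (xs ! (i - 1) * xs ! i) # drop (i + 1) xs))
       + f (butlast xs) * last xs
     else 0)"

definition cup_cochain ::
  "int \<Rightarrow> int \<Rightarrow> ('a list \<Rightarrow> 'a) \<Rightarrow> ('a list \<Rightarrow> 'a) \<Rightarrow> 'a list \<Rightarrow> 'a" where
  "cup_cochain p q \<alpha> \<beta> = (\<lambda>xs. if int (length xs) = p + q then
       (-1) powi (p * q) *s (\<alpha> (take (nat p) xs) * \<beta> (drop (nat p) xs))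
     else 0)"

definition one_cochain :: "'a list \<Rightarrow> 'a" where
  "one_cochain = (\<lambda>xs. if xs = [] then 1 else 0)"

definition insert_cochain ::
  "int \<Rightarrow> int \<Rightarrow> nat \<Rightarrow> ('a list \<Rightarrow> 'a) \<Rightarrow> ('a list \<Rightarrow> 'a) \<Rightarrow> 'a list \<Rightarrow> 'a" where
  "insert_cochain n m i \<alpha> \<beta> = (\<lambda>xs. if int (length xs) = n + m - 1 then
       \<alpha> (take (i - 1) xs @ \<beta> (take (nat m) (drop (i - 1) xs)) # drop (i - 1 + nat m) xs)
     else 0)"

definition circ_cochain ::
  "int \<Rightarrow> int \<Rightarrow> ('a list \<Rightarrow> 'a) \<Rightarrow> ('a list \<Rightarrow> 'a) \<Rightarrow> 'a list \<Rightarrow> 'a" where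
  "circ_cochain n m \<alpha> \<beta> =
     (\<Sum>i = 1..nat n. scale_cochain ((-1) powi ((m - 1) * (int i - 1))) (insert_cochain n m i \<alpha> \<beta>))"

definition bracket_cochain ::
  "int \<Rightarrow> int \<Rightarrow> ('a list \<Rightarrow> 'a) \<Rightarrow> ('a list \<Rightarrow> 'a) \<Rightarrow> 'a list \<Rightarrow> 'a" where
  "bracket_cochain n m \<alpha> \<beta> =
     circ_cochain n m \<alpha> \<beta> - scale_cochain ((-1) powi ((n - 1) * (m - 1))) (circ_cochain m n \<beta> \<alpha>)"

definition cocycles :: "int \<Rightarrow> ('a list \<Rightarrow> 'a) set" where
  "cocycles n = {f \<in> cochains n. hochschild_b n f = 0}"

definition coboundaries :: "int \<Rightarrow> ('a list \<Rightarrow> 'a) set" where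
  "coboundaries n = hochschild_b (n - 1) ` cochains (n - 1)"

definition cohomologous :: "int \<Rightarrow> (('a list \<Rightarrow> 'a) \<times> ('a list \<Rightarrow> 'a)) set" where
  "cohomologous n = {(f, g). f \<in> cocycles n \<and> g \<in> cocycles n \<and> f - g \<in> coboundaries n}"

definition HH_class :: "int \<Rightarrow> ('a list \<Rightarrow> 'a) \<Rightarrow> ('a list \<Rightarrow> 'a) set" where
  "HH_class n f = cohomologous n `` {f}"

text \<open>\<open>HH n\<close> is a \<open>k\<close>-module in the sense of HOL-Algebra.  That record type extends the ring
  record, whose multiplicative fields play no role and are left unspecified.  Operations on
  cohomology classes are induced from representatives: the union over all representatives is
  a single class precisely when the result does not depend on them.\<close>

definition HH :: "int \<Rightarrow> ('k, ('a list \<Rightarrow> 'a) set) module" where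
  "HH n = \<lparr>carrier = cocycles n // cohomologous n,
     monoid.mult = undefined, one = undefined,
     zero = HH_class n 0,
     add = (\<lambda>U V. \<Union>f\<in>U. \<Union>g\<in>V. HH_class n (f + g)),
     module.smult = (\<lambda>c U. \<Union>f\<in>U. HH_class n (scale_cochain c f))\<rparr>"

definition HH_cup ::
  "int \<Rightarrow> int \<Rightarrow> ('a list \<Rightarrow> 'a) set \<Rightarrow> ('a list \<Rightarrow> 'a) set \<Rightarrow> ('a list \<Rightarrow> 'a) set" where
  "HH_cup p q U V = (\<Union>\<alpha>\<in>U. \<Union>\<beta>\<in>V. HH_class (p + q) (cup_cochain p q \<alpha> \<beta>))"

definition HH_one :: "('a list \<Rightarrow> 'a) set" where
  "HH_one = HH_class 0 one_cochain"

definition HH_bracket ::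
  "int \<Rightarrow> int \<Rightarrow> ('a list \<Rightarrow> 'a) set \<Rightarrow> ('a list \<Rightarrow> 'a) set \<Rightarrow> ('a list \<Rightarrow> 'a) set" where
  "HH_bracket p q U V = (\<Union>\<alpha>\<in>U. \<Union>\<beta>\<in>V. HH_class (p + q - 1) (bracket_cochain p q \<alpha> \<beta>))"

end


section \<open>Gerstenhaber and Batalin-Vilkovisky algebras\<close>

text \<open>A graded vector space is a family \<open>H\<close> of vector spaces indexed by the integers.  Operations
  take the degrees of their arguments as additional parameters.\<close>

locale gerstenhaber_algebra =
  fixes H :: "int \<Rightarrow> ('k::field, 'h) module"
    and cup :: "int \<Rightarrow> int \<Rightarrow> 'h \<Rightarrow> 'h \<Rightarrow> 'h"
    and unit :: 'h
    and bracket :: "int \<Rightarrow> int \<Rightarrow> 'h \<Rightarrow> 'h \<Rightarrow> 'h"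
  assumes vectorspace: "vectorspace class_ring (H n)"
    and cup_linear_left: "y \<in> carrier (H q) \<Longrightarrow>
      linear_map class_ring (H p) (H (p + q)) (\<lambda>x. cup p q x y)"
    and cup_linear_right: "x \<in> carrier (H p) \<Longrightarrow>
      linear_map class_ring (H q) (H (p + q)) (cup p q x)"
    and cup_assoc: "\<lbrakk>x \<in> carrier (H p); y \<in> carrier (H q); z \<in> carrier (H r)\<rbrakk> \<Longrightarrow>
      cup (p + q) r (cup p q x y) z = cup p (q + r) x (cup q r y z)"
    and unit_closed: "unit \<in> carrier (H 0)"
    and cup_unit_left: "x \<in> carrier (H p) \<Longrightarrow> cup 0 p unit x = x"
    and cup_unit_right: "x \<in> carrier (H p) \<Longrightarrow> cup p 0 x unit = x"
    and cup_commute: "\<lbrakk>x \<in> carrier (H p); y \<in> carrier (H q)\<rbrakk> \<Longrightarrow>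
      cup p q x y = (-1) powi (p * q) \<odot>\<^bsub>H (p + q)\<^esub> cup q p y x"
    and bracket_linear_left: "y \<in> carrier (H q) \<Longrightarrow>
      linear_map class_ring (H p) (H (p + q - 1)) (\<lambda>x. bracket p q x y)"
    and bracket_linear_right: "x \<in> carrier (H p) \<Longrightarrow>
      linear_map class_ring (H q) (H (p + q - 1)) (bracket p q x)"
    and bracket_antisym: "\<lbrakk>x \<in> carrier (H p); y \<in> carrier (H q)\<rbrakk> \<Longrightarrow>
      bracket p q x y = \<ominus>\<^bsub>H (p + q - 1)\<^esub>
        ((-1) powi ((p - 1) * (q - 1)) \<odot>\<^bsub>H (p + q - 1)\<^esub> bracket q p y x)"
    and bracket_jacobi: "\<lbrakk>x \<in> carrier (H p); y \<in> carrier (H q); z \<in> carrier (H r)\<rbrakk> \<Longrightarrow>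
      bracket p (q + r - 1) x (bracket q r y z) =
        bracket (p + q - 1) r (bracket p q x y) z \<oplus>\<^bsub>H (p + q + r - 2)\<^esub>
        (-1) powi ((p - 1) * (q - 1)) \<odot>\<^bsub>H (p + q + r - 2)\<^esub>
          bracket q (p + r - 1) y (bracket p r x z)"
    and bracket_cup: "\<lbrakk>x \<in> carrier (H p); y \<in> carrier (H q); z \<in> carrier (H r)\<rbrakk> \<Longrightarrow>
      bracket p (q + r) x (cup q r y z) =
        cup (p + q - 1) r (bracket p q x y) z \<oplus>\<^bsub>H (p + q + r - 1)\<^esub>
        (-1) powi ((p - 1) * q) \<odot>\<^bsub>H (p + q + r - 1)\<^esub>
          cup q (p + r - 1) y (bracket p r x z)"

locale bv_operator = gerstenhaber_algebra H cup unit bracket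
  for H :: "int \<Rightarrow> ('k::field, 'h) module"
    and cup :: "int \<Rightarrow> int \<Rightarrow> 'h \<Rightarrow> 'h \<Rightarrow> 'h"
    and unit :: 'h
    and bracket :: "int \<Rightarrow> int \<Rightarrow> 'h \<Rightarrow> 'h \<Rightarrow> 'h" +
  fixes \<Delta> :: "int \<Rightarrow> 'h \<Rightarrow> 'h"
  assumes Delta_linear: "linear_map class_ring (H n) (H (n - 1)) (\<Delta> n)"
    and Delta_square: "x \<in> carrier (H n) \<Longrightarrow> \<Delta> (n - 1) (\<Delta> n x) = \<zero>\<^bsub>H (n - 2)\<^esub>"
    and Delta_unit: "\<Delta> 0 unit = \<zero>\<^bsub>H (-1)\<^esub>"
    and bracket_Delta: "\<lbrakk>x \<in> carrier (H p); y \<in> carrier (H q)\<rbrakk> \<Longrightarrow>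
      bracket p q x y = (-1) powi (p + 1) \<odot>\<^bsub>H (p + q - 1)\<^esub>
        (\<Delta> (p + q) (cup p q x y)
          \<ominus>\<^bsub>H (p + q - 1)\<^esub> cup (p - 1) q (\<Delta> p x) y
          \<ominus>\<^bsub>H (p + q - 1)\<^esub> (-1) powi p \<odot>\<^bsub>H (p + q - 1)\<^esub> cup p (q - 1) x (\<Delta> q y))"

definition bv_algebra ::
  "(int \<Rightarrow> ('k::field, 'h) module) \<Rightarrow> (int \<Rightarrow> int \<Rightarrow> 'h \<Rightarrow> 'h \<Rightarrow> 'h) \<Rightarrow> 'h \<Rightarrow>
   (int \<Rightarrow> int \<Rightarrow> 'h \<Rightarrow> 'h \<Rightarrow> 'h) \<Rightarrow> bool" where
  "bv_algebra H cup unit bracket \<longleftrightarrow> (\<exists>\<Delta>. bv_operator H cup unit bracket \<Delta>)"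

end

theory Submission
  imports Defs
begin

text \<open>
  For a cochain \<open>f\<close> of degree \<open>n\<close> let \<open>\<Delta> f\<close> be the cochain of degree \<open>n - 1\<close> with
  \<open>\<langle>\<Delta> f(a\<^sub>1, \<dots>, a\<^sub>n\<^sub>-\<^sub>1), a\<^sub>n\<rangle> = \<Sum>\<^sub>i \<plusminus> \<langle>f(a\<^sub>i, \<dots>, a\<^sub>n, N a\<^sub>1, \<dots>, N a\<^sub>i\<^sub>-\<^sub>1), 1\<rangle>\<close>,
  where \<open>N\<close> is the Nakayama automorphism.  Normalization gives \<open>\<Delta> \<Delta> = 0\<close>, and
  \<open>b \<Delta> f + \<Delta> b f = f - N\<^sup>-\<^sup>1 f(N -, \<dots>, N -)\<close>.  So \<open>N\<close> acts trivially on cohomology; if \<open>N\<close> is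
  semisimple, its fixed space in the cochains is a direct summand, hence the \<open>N\<close>-invariant cochains
  compute the cohomology, and on them \<open>\<Delta>\<close> commutes with \<open>b\<close> up to sign.  The sum defining
  \<open>\<Delta> (f \<cdot> g)\<close> splits according to the factor that contains \<open>a\<^sub>n\<close>; a Cartan type
  homotopy compares the two parts with \<open>f \<circ> g\<close> and \<open>\<Delta> f \<cdot> g\<close>, and with \<open>g \<circ> f\<close> and
  \<open>\<Delta> g \<cdot> f\<close>, respectively.  The operator of the BV structure is \<open>-\<Delta>\<close>.
\<close>

section \<open>Signed sums over decompositions of a word\<close>

text \<open>The identity \<open>form (a * b) z = form b (z * N a)\<close> dictates the shape of
  \<open>Delta\<close>: a letter leaving the front of a word may return at its end carrying
  \<open>N\<close>. Under the form, the two outer terms of the differential therefore join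
  consecutive rotations and telescope, but the two ends of the telescope differ by \<open>N\<close>.
  So \<open>Delta\<close> maps cocycles to cocycles only when they are invariant, and a well-defined
  map on classes requires invariant primitives as well as invariant representatives. The eigenspaces
  of \<open>N\<close> need not be defined over the ground field. What does descend from the closure
  is a statement without eigenvalues: if \<open>(T - 1)^2\<close> kills a multilinear form, so does
  \<open>T - 1\<close>. In finite dimension this writes every cochain as a fixed one plus one in the
  image of \<open>T - 1\<close>. The Gerstenhaber axioms are proved as well, from the pre-Lie
  identity and from braces. Since all these identities are sums with signs, they are stated for
  factorizations of words: degrees enter only where signs are compared.\<close>

definition sg :: "int \<Rightarrow> 'b::ab_group_add \<Rightarrow> 'b" where
  "sg n x = (if even n then x else - x)"

lemma sg_0 [simp]: "sg 0 x = x" and sg_zero [simp]: "sg n 0 = 0"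
  by (simp_all add: sg_def)

lemma sg_sg [simp]: "sg m (sg n x) = sg (m + n) x"
  by (simp add: sg_def)

lemma sg_add: "sg n (x + y) = sg n x + sg n y"
  and sg_diff: "sg n (x - y) = sg n x - sg n y"
  and uminus_eq_sg: "- x = sg 1 x"
  by (simp_all add: sg_def)

lemma sg_cong: "even (m - n) \<Longrightarrow> x = y \<Longrightarrow> sg m x = sg n y"
  by (auto simp: sg_def)

lemma additive_zero:
  fixes h :: "'b::ab_group_add \<Rightarrow> 'c::ab_group_add"
  assumes "\<And>x y. h (x + y) = h x + h y"
  shows "h 0 = 0"
  using assms[of 0 0] by simp

lemma additive_uminus:
  fixes h :: "'b::ab_group_add \<Rightarrow> 'c::ab_group_add"
  assumes "\<And>x y. h (x + y) = h x + h y"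
  shows "h (- x) = - h x"
  using assms[of x "- x"] additive_zero[of h, OF assms] by (simp add: eq_neg_iff_add_eq_0 add.commute)

lemma additive_sg:
  fixes h :: "'b::ab_group_add \<Rightarrow> 'c::ab_group_add"
  assumes "\<And>x y. h (x + y) = h x + h y"
  shows "h (sg n x) = sg n (h x)"
  using additive_uminus[of h, OF assms] by (simp add: sg_def)

lemma additive_diff:
  fixes h :: "'b::ab_group_add \<Rightarrow> 'c::ab_group_add"
  assumes "\<And>x y. h (x + y) = h x + h y"
  shows "h (x - y) = h x - h y"
  using assms[of x "- y"] additive_uminus[of h, OF assms] by simp

abbreviation len :: "'x list \<Rightarrow> int" where
  "len xs \<equiv> int (length xs)"

text \<open>Sums run over factorizations of a word instead of positions in it. Reindexing becomes
  associativity of append, and signs can be computed from the lengths of the pieces.\<close>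

fun split2 :: "('x list \<Rightarrow> 'x list \<Rightarrow> 'b::ab_group_add) \<Rightarrow> 'x list \<Rightarrow> 'b" where
  "split2 F [] = F [] []"
| "split2 F (x # xs) = F [] (x # xs) + split2 (\<lambda>u v. F (x # u) v) xs"

definition split3 :: "('x list \<Rightarrow> 'x list \<Rightarrow> 'x list \<Rightarrow> 'b::ab_group_add) \<Rightarrow> 'x list \<Rightarrow> 'b" where
  "split3 F = split2 (\<lambda>u r. split2 (\<lambda>v w. F u v w) r)"

text \<open>\<open>on_hd\<close>, \<open>on_last\<close> and \<open>adj2\<close> model the three
  kinds of terms of a Hochschild differential: multiplication by the first letter, by the last
  letter, and of two neighbours. Words that are too short contribute 0.\<close>

fun on_hd :: "('x \<Rightarrow> 'x list \<Rightarrow> 'b::ab_group_add) \<Rightarrow> 'x list \<Rightarrow> 'b" where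
  "on_hd F [] = 0"
| "on_hd F (x # xs) = F x xs"

definition on_last :: "('x list \<Rightarrow> 'x \<Rightarrow> 'b::ab_group_add) \<Rightarrow> 'x list \<Rightarrow> 'b" where
  "on_last F xs = (if xs = [] then 0 else F (butlast xs) (last xs))"

lemma on_last_simps [simp]: "on_last F [] = 0" "on_last F (xs @ [x]) = F xs x" "on_last F [x] = F [] x"
  by (simp_all add: on_last_def)

lemma on_last_Cons: "on_last F (x # xs) = (if xs = [] then F [] x else on_last (\<lambda>u a. F (x # u) a) xs)"
  by (simp add: on_last_def)

fun adj2 :: "('x list \<Rightarrow> 'x \<Rightarrow> 'x \<Rightarrow> 'x list \<Rightarrow> 'b::ab_group_add) \<Rightarrow> 'x list \<Rightarrow> 'b" where
  "adj2 F [] = 0"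
| "adj2 F (x # xs) = on_hd (\<lambda>y ys. F [] x y ys) xs + adj2 (\<lambda>u a b z. F (x # u) a b z) xs"

section \<open>Congruence and additivity of sums over factorizations\<close>

lemma split2_cong: "(\<And>u v. u @ v = xs \<Longrightarrow> F u v = G u v) \<Longrightarrow> split2 F xs = split2 G xs"
proof (induction xs arbitrary: F G)
  case (Cons x xs)
  have "split2 (\<lambda>u v. F (x # u) v) xs = split2 (\<lambda>u v. G (x # u) v) xs"
    by (rule Cons.IH) (use Cons.prems in simp)
  then show ?case using Cons.prems[of "[]"] by simp
qed simp

lemma split3_cong: "(\<And>u v w. u @ v @ w = xs \<Longrightarrow> F u v w = G u v w) \<Longrightarrow> split3 F xs = split3 G xs"
  unfolding split3_def by (rule split2_cong, rule split2_cong) auto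

lemma on_hd_cong: "(\<And>a z. a # z = xs \<Longrightarrow> F a z = G a z) \<Longrightarrow> on_hd F xs = on_hd G xs"
  by (cases xs) auto

lemma on_last_cong: "(\<And>z a. z @ [a] = xs \<Longrightarrow> F z a = G z a) \<Longrightarrow> on_last F xs = on_last G xs"
  by (cases xs rule: rev_cases) auto

lemma adj2_cong: "(\<And>u a b z. u @ a # b # z = xs \<Longrightarrow> F u a b z = G u a b z) \<Longrightarrow> adj2 F xs = adj2 G xs"
proof (induction xs arbitrary: F G)
  case (Cons x xs)
  have "on_hd (\<lambda>y ys. F [] x y ys) xs = on_hd (\<lambda>y ys. G [] x y ys) xs"
    by (rule on_hd_cong) (use Cons.prems in auto)
  moreover have "adj2 (\<lambda>u a b z. F (x # u) a b z) xs = adj2 (\<lambda>u a b z. G (x # u) a b z) xs"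
    by (rule Cons.IH) (use Cons.prems in auto)
  ultimately show ?case by simp
qed simp

lemma split2_additive:
  fixes h :: "'b::ab_group_add \<Rightarrow> 'c::ab_group_add"
  assumes "\<And>x y. h (x + y) = h x + h y"
  shows "h (split2 F xs) = split2 (\<lambda>u v. h (F u v)) xs"
  by (induction xs arbitrary: F) (simp_all add: assms)

lemma split3_additive:
  fixes h :: "'b::ab_group_add \<Rightarrow> 'c::ab_group_add"
  assumes "\<And>x y. h (x + y) = h x + h y"
  shows "h (split3 F xs) = split3 (\<lambda>u v w. h (F u v w)) xs"
  by (simp add: split3_def split2_additive[of h, OF assms])

lemma on_hd_additive:
  fixes h :: "'b::ab_group_add \<Rightarrow> 'c::ab_group_add"
  assumes "\<And>x y. h (x + y) = h x + h y"
  shows "h (on_hd F xs) = on_hd (\<lambda>u v. h (F u v)) xs"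
  by (cases xs) (simp_all add: additive_zero[of h, OF assms])

lemma on_last_additive:
  fixes h :: "'b::ab_group_add \<Rightarrow> 'c::ab_group_add"
  assumes "\<And>x y. h (x + y) = h x + h y"
  shows "h (on_last F xs) = on_last (\<lambda>u v. h (F u v)) xs"
  by (simp add: on_last_def additive_zero[of h, OF assms])

lemma adj2_additive:
  fixes h :: "'b::ab_group_add \<Rightarrow> 'c::ab_group_add"
  assumes "\<And>x y. h (x + y) = h x + h y"
  shows "h (adj2 F xs) = adj2 (\<lambda>u a b z. h (F u a b z)) xs"
  by (induction xs arbitrary: F)
    (simp_all add: assms additive_zero[of h, OF assms] on_hd_additive[of h, OF assms])

lemmas sums_additive = split2_additive split3_additive on_hd_additive on_last_additive adj2_additive

lemma split2_add: "split2 (\<lambda>u v. F u v + G u v) xs = split2 F xs + split2 G xs"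
  by (induction xs arbitrary: F G) (simp_all add: ac_simps)

lemma split3_add: "split3 (\<lambda>u v w. F u v w + G u v w) xs = split3 F xs + split3 G xs"
  by (simp add: split3_def split2_add)

lemma on_hd_add: "on_hd (\<lambda>u v. F u v + G u v) xs = on_hd F xs + on_hd G xs"
  by (cases xs) simp_all

lemma on_last_add: "on_last (\<lambda>u v. F u v + G u v) xs = on_last F xs + on_last G xs"
  by (simp add: on_last_def)

lemma add_interchange: "(a + b) + (c + d) = (a + c) + (b + d :: 'a::ab_group_add)"
  by (simp add: algebra_simps)

lemma adj2_add: "adj2 (\<lambda>u a b z. F u a b z + G u a b z) xs = adj2 F xs + adj2 G xs"
proof (induction xs arbitrary: F G)
  case (Cons x xs)
  show ?case
    unfolding adj2.simps(2) on_hd_add Cons[of "\<lambda>u. F (x # u)" "\<lambda>u. G (x # u)"]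
    by (rule add_interchange)
qed simp

lemmas sums_add = split2_add split3_add on_hd_add on_last_add adj2_add

lemma sums_sg:
  "split2 (\<lambda>u v. sg n (F2 u v)) xs = sg n (split2 F2 xs)"
  "split3 (\<lambda>u v w. sg n (F3 u v w)) xs = sg n (split3 F3 xs)"
  "on_hd (\<lambda>u v. sg n (Fh u v)) xs = sg n (on_hd Fh xs)"
  "on_last (\<lambda>u v. sg n (Fl u v)) xs = sg n (on_last Fl xs)"
  "adj2 (\<lambda>u a b z. sg n (Fa u a b z)) xs = sg n (adj2 Fa xs)"
  by (simp_all add: sums_additive[of "sg n", OF sg_add])

lemmas push_sg = sums_sg[symmetric] sg_sg

lemma sums_uminus:
  "split2 (\<lambda>u v. - F2 u v) xs = - split2 F2 xs"
  "split3 (\<lambda>u v w. - F3 u v w) xs = - split3 F3 xs"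
  "on_hd (\<lambda>u v. - Fh u v) xs = - on_hd Fh xs"
  "on_last (\<lambda>u v. - Fl u v) xs = - on_last Fl xs"
  "adj2 (\<lambda>u a b z. - Fa u a b z) xs = - adj2 Fa xs"
  by (simp_all add: sums_additive[of uminus])

lemma split2_diff: "split2 (\<lambda>u v. F u v - G u v) xs = split2 F xs - split2 G xs"
  using split2_add[of F "\<lambda>u v. - G u v" xs] by (simp add: sums_uminus)

lemma split3_diff: "split3 (\<lambda>u v w. F u v w - G u v w) xs = split3 F xs - split3 G xs"
  using split3_add[of F "\<lambda>u v w. - G u v w" xs] by (simp add: sums_uminus)

lemma on_hd_diff: "on_hd (\<lambda>u v. F u v - G u v) xs = on_hd F xs - on_hd G xs"
  by (cases xs) simp_all

lemma on_last_diff: "on_last (\<lambda>u v. F u v - G u v) xs = on_last F xs - on_last G xs"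
  by (simp add: on_last_def)

lemma adj2_diff: "adj2 (\<lambda>u a b z. F u a b z - G u a b z) xs = adj2 F xs - adj2 G xs"
  using adj2_add[of F "\<lambda>u a b z. - G u a b z" xs] by (simp add: sums_uminus)

lemmas sums_diff = split2_diff split3_diff on_hd_diff on_last_diff adj2_diff

lemma sums_zero [simp]:
  "split2 (\<lambda>u v. 0) xs = 0" "split3 (\<lambda>u v w. 0) xs = 0" "on_hd (\<lambda>u v. 0) xs = 0"
  "on_last (\<lambda>u v. 0) xs = 0" "adj2 (\<lambda>u a b z. 0) xs = 0"
  by (simp_all add: sums_additive[of "\<lambda>_. 0", symmetric])

section \<open>Reindexing: coassociativity of cutting, marked letters, letters that cross a
  cut\<close>

lemma split2_assoc:
  "split2 (\<lambda>r w. split2 (\<lambda>u v. F u v w) r) xs = split2 (\<lambda>u r. split2 (\<lambda>v w. F u v w) r) xs"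
  by (induction xs arbitrary: F) (simp_all add: split2_add ac_simps)

lemma split2_swap:
  "split2 (\<lambda>u v. split2 (\<lambda>s t. F u v s t) ys) xs = split2 (\<lambda>s t. split2 (\<lambda>u v. F u v s t) xs) ys"
  by (induction xs arbitrary: F) (simp_all add: split2_add)

text \<open>The marked letter lies on one side of the cut. In the applications it is an inserted
  value, a product \<open>a * b\<close> of neighbours, or the argument \<open>z\<close> that is
  paired by the form.\<close>

lemma split2_middle:
  "split2 F (us @ c # ws) = split2 (\<lambda>u v. F u (v @ c # ws)) us + split2 (\<lambda>u v. F (us @ c # u) v) ws"
  by (induction us arbitrary: F) (simp_all add: ac_simps)

lemma split3_middle:
  "split3 F (us @ c # ws) = split3 (\<lambda>x y z. F x y (z @ c # ws)) us
     + split2 (\<lambda>x y. split2 (\<lambda>z w. F x (y @ c # z) w) ws) us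
     + split3 (\<lambda>x y z. F (us @ c # x) y z) ws"
  by (simp add: split3_def split2_middle split2_add)

lemma on_hd_append: "on_hd F (us @ c # ws) = on_hd (\<lambda>a z. F a (z @ c # ws)) us + (if us = [] then F c ws else 0)"
  by (cases us) simp_all

lemma on_last_append: "on_last F (us @ c # ws) = (if ws = [] then F us c else 0) + on_last (\<lambda>z a. F (us @ c # z) a) ws"
  by (cases ws rule: rev_cases) (simp_all add: on_last_def butlast_append)

lemma adj2_middle:
  "adj2 F (us @ c # ws) = adj2 (\<lambda>x a b z. F x a b (z @ c # ws)) us + on_last (\<lambda>x a. F x a c ws) us
     + on_hd (\<lambda>b z. F us c b z) ws + adj2 (\<lambda>x a b z. F (us @ c # x) a b z) ws"
proof (induction us arbitrary: F)
  case (Cons y us)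
  show ?case
    unfolding append_Cons adj2.simps(2) Cons[of "\<lambda>u. F (y # u)"] on_hd_append on_last_Cons
    by (cases "us = []") (simp_all add: algebra_simps)
qed simp

lemma adj2_split2_left:
  "split2 (\<lambda>u v. adj2 (\<lambda>x a b z. F x a b z v) u) xs = adj2 (\<lambda>x a b r. split2 (\<lambda>z v. F x a b z v) r) xs"
proof (induction xs arbitrary: F)
  case (Cons y xs)
  have "split2 (\<lambda>u v. on_hd (\<lambda>b z. F [] y b z v) u) xs = on_hd (\<lambda>b r. split2 (\<lambda>z v. F [] y b z v) r) xs"
    by (cases xs) simp_all
  then show ?case
    by (simp add: split2_add Cons)
qed simp

lemma adj2_split2_right:
  "split2 (\<lambda>u v. adj2 (\<lambda>x a b z. F u x a b z) v) xs = adj2 (\<lambda>l a b z. split2 (\<lambda>u x. F u x a b z) l) xs"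
  by (induction xs arbitrary: F) (simp_all add: adj2_add on_hd_add ac_simps)

text \<open>The last letter before a cut is the first letter after another cut. The matching of
  boundary terms in \<open>contr_ins\<close>, \<open>hb_conv\<close> and the telescope
  \<open>rot_lmul_rmul\<close> rests on this shift.\<close>

lemma split2_on_last_left:
  "split2 (\<lambda>u v. on_last (\<lambda>x a. F x a v) u) xs = split2 (\<lambda>x v. on_hd (\<lambda>a v. F x a v) v) xs"
proof (induction xs arbitrary: F)
  case (Cons y xs)
  have "split2 (\<lambda>u v. on_last (\<lambda>x a. F x a v) (y # u)) xs
      = F [] y xs + split2 (\<lambda>u v. on_last (\<lambda>x a. F (y # x) a v) u) xs"
    by (cases xs) (simp_all add: on_last_Cons)
  then show ?case using Cons[of "\<lambda>u. F (y # u)"] by simp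
qed simp

lemma split2_on_hd_left:
  "split2 (\<lambda>u v. on_hd (\<lambda>a z. F a z v) u) xs = on_hd (\<lambda>a r. split2 (\<lambda>z v. F a z v) r) xs"
  by (cases xs) simp_all

lemma split2_on_last_right:
  "split2 (\<lambda>u v. on_last (\<lambda>z a. F u z a) v) xs = on_last (\<lambda>r a. split2 (\<lambda>u z. F u z a) r) xs"
proof (induction xs arbitrary: F)
  case (Cons y xs)
  show ?case
    by (cases "xs = []") (simp_all add: Cons on_last_Cons on_last_add)
qed simp

lemma split2_unit_left: "split2 (\<lambda>u v. if u = [] then F v else 0) xs = F xs"
  by (cases xs) simp_all

lemma split2_unit_right: "split2 (\<lambda>u v. if v = [] then F u else 0) xs = F xs"
  by (induction xs arbitrary: F) simp_all

lemma split3_adj2_left: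
  "split3 (\<lambda>u v w. adj2 (\<lambda>x a b z. F x a b z v w) u) xs = adj2 (\<lambda>x a b r. split3 (\<lambda>z v w. F x a b z v w) r) xs"
proof -
  have "split2 (\<lambda>v w. adj2 (\<lambda>x a b z. F x a b z v w) u) r = adj2 (\<lambda>x a b z. split2 (F x a b z) r) u" for u r
    by (induction r arbitrary: F) (simp_all add: adj2_add)
  then show ?thesis by (simp add: split3_def adj2_split2_left)
qed

lemma split3_adj2_right:
  "split3 (\<lambda>u v w. adj2 (\<lambda>x a b z. G u v x a b z) w) xs = adj2 (\<lambda>l a b z. split3 (\<lambda>u v x. G u v x a b z) l) xs"
  unfolding split3_def adj2_split2_right ..

lemma split3_adj2_mid:
  "split3 (\<lambda>u v w. adj2 (\<lambda>x a b z. H u x a b z w) v) xs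
     = adj2 (\<lambda>l a b r. split2 (\<lambda>u x. split2 (\<lambda>z w. H u x a b z w) r) l) xs"
  unfolding split3_def adj2_split2_left adj2_split2_right ..

lemma split3_on_last_left:
  "split3 (\<lambda>u v w. on_last (\<lambda>x a. F x a v w) u) xs = split3 (\<lambda>x v w. on_hd (\<lambda>a v. F x a v w) v) xs"
proof -
  have "split2 (\<lambda>v w. on_last (\<lambda>x a. F x a v w) u) r = on_last (\<lambda>x a. split2 (F x a) r) u" for u r
    by (induction r arbitrary: F) (simp_all add: on_last_add)
  then show ?thesis by (simp add: split3_def split2_on_last_left split2_on_hd_left)
qed

lemma split3_on_hd_right:
  "split3 (\<lambda>u v w. on_hd (\<lambda>a z. G u v a z) w) xs = split3 (\<lambda>u v w. on_last (\<lambda>v a. G u v a w) v) xs"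
  unfolding split3_def split2_on_last_left ..

lemma split3_split2_right:
  "split3 (\<lambda>u v w. split2 (\<lambda>x y. F u v x y) w) xs = split2 (\<lambda>r y. split3 (\<lambda>u v x. F u v x y) r) xs"
  by (simp only: split3_def split2_assoc)

lemma split3_split2_left:
  "split3 (\<lambda>u v w. split2 (\<lambda>x y. F x y v w) u) xs = split2 (\<lambda>x r. split3 (\<lambda>y v w. F x y v w) r) xs"
proof -
  have "split2 (\<lambda>v w. split2 (\<lambda>x y. F x y v w) u) r = split2 (\<lambda>x y. split2 (F x y) r) u" for u r
    by (rule split2_swap)
  then show ?thesis by (simp only: split3_def split2_assoc)
qed

lemma split3_split3_left:
  "split3 (\<lambda>u v w. split3 (\<lambda>x y z. F x y z v w) u) xs = split3 (\<lambda>x y r. split3 (\<lambda>z v w. F x y z v w) r) xs"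
  unfolding split3_def[of "\<lambda>x y z. F x y z v w" for v w]
  unfolding split3_split2_left
  unfolding split3_def[of "\<lambda>x y r. split3 (\<lambda>z v w. F x y z v w) r"]
  by (rule refl)

lemma split3_split22_mid:
  "split3 (\<lambda>u v w. split2 (\<lambda>x y. split2 (\<lambda>z t. F x y v z t) w) u) xs
    = split3 (\<lambda>x r t. split3 (\<lambda>y v z. F x y v z t) r) xs"
  unfolding split3_split2_left split3_split2_right
  by (simp only: split3_def)

lemma split3_on_hd_left:
  "split3 (\<lambda>u v w. on_hd (\<lambda>b z. F b z v w) u) xs = on_hd (\<lambda>b r. split3 (\<lambda>z v w. F b z v w) r) xs"
  by (cases xs) (simp_all add: split3_def)

lemma split3_on_last_right:
  "split3 (\<lambda>u v w. on_last (\<lambda>z a. F u v z a) w) xs = on_last (\<lambda>r a. split3 (\<lambda>u v z. F u v z a) r) xs"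
  by (simp only: split3_def split2_on_last_right)

lemma split2_if: "split2 (\<lambda>v w. if P then F v w else 0) xs = (if P then split2 F xs else 0)"
  by simp

lemma split3_unit_left: "split3 (\<lambda>u v w. if u = [] then F v w else 0) xs = split2 F xs"
  by (simp only: split3_def split2_if split2_unit_left)

lemma split3_unit_right: "split3 (\<lambda>u v w. if w = [] then F u v else 0) xs = split2 F xs"
  by (simp only: split3_def split2_unit_right)

lemma split2_adj2_swap:
  "split2 (\<lambda>v w. adj2 (\<lambda>x a b z. F v w x a b z) us) xs = adj2 (\<lambda>x a b z. split2 (\<lambda>v w. F v w x a b z) xs) us"
  by (induction xs arbitrary: F) (simp_all add: adj2_add)

lemma split3_adj2_swap:
  "split3 (\<lambda>u v w. adj2 (\<lambda>x a b z. F u v w x a b z) us) xs = adj2 (\<lambda>x a b z. split3 (\<lambda>u v w. F u v w x a b z) xs) us"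
  by (simp only: split3_def split2_adj2_swap)

lemma split3_on_last_swap:
  "split3 (\<lambda>u v w. on_last (\<lambda>x a. F u v w x a) us) xs = on_last (\<lambda>x a. split3 (\<lambda>u v w. F u v w x a) xs) us"
  by (simp add: on_last_def)

lemma split3_on_hd_swap:
  "split3 (\<lambda>u v w. on_hd (\<lambda>a x. F u v w a x) us) xs = on_hd (\<lambda>a x. split3 (\<lambda>u v w. F u v w a x) xs) us"
  by (cases us) simp_all

lemma adj2_map: "adj2 F (map g xs) = adj2 (\<lambda>x a b z. F (map g x) (g a) (g b) (map g z)) xs"
proof (induction xs arbitrary: F)
  case (Cons x xs)
  show ?case
    using Cons[of "\<lambda>u. F (g x # u)"] by (cases xs) simp_all
qed simp

lemma on_hd_map: "on_hd F (map g xs) = on_hd (\<lambda>a z. F (g a) (map g z)) xs"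
  by (cases xs) simp_all

lemma on_last_map: "on_last F (map g xs) = on_last (\<lambda>z a. F (map g z) (g a)) xs"
  by (cases xs rule: rev_cases) simp_all

lemma split2_map: "split2 F (map g xs) = split2 (\<lambda>u v. F (map g u) (map g v)) xs"
  by (induction xs arbitrary: F) simp_all

lemma split2_sg_unit_right:
  "split2 (\<lambda>u v. sg (c u v) (if v = [] then F u else 0)) xs = sg (c xs []) (F xs)"
proof -
  have "split2 (\<lambda>u v. sg (c u v) (if v = [] then F u else 0)) xs = split2 (\<lambda>u v. if v = [] then sg (c u []) (F u) else 0) xs"
    by (intro split2_cong) simp
  then show ?thesis unfolding split2_unit_right .
qed

lemma split2_on_hd_swap:
  "split2 (\<lambda>u v. on_hd (\<lambda>a x. F u v a x) us) xs = on_hd (\<lambda>a x. split2 (\<lambda>u v. F u v a x) xs) us"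
  by (cases us) simp_all

lemma split2_on_last_swap:
  "split2 (\<lambda>u v. on_last (\<lambda>x a. F u v x a) us) xs = on_last (\<lambda>x a. split2 (\<lambda>u v. F u v x a) xs) us"
  by (simp add: on_last_def)

section \<open>Comparison with sums over positions\<close>

lemma split2_sum: "split2 F xs = (\<Sum>i\<le>length xs. F (take i xs) (drop i xs))"
proof (induction xs arbitrary: F)
  case (Cons x xs)
  show ?case
    by (simp only: split2.simps Cons length_Cons sum.atMost_Suc_shift take_0 drop_0 take_Suc_Cons drop_Suc_Cons)
qed simp

text \<open>Homogeneity singles out one cut. This connects the degree-free sums with definitions
  written with \<open>take\<close> and \<open>drop\<close>.\<close>

lemma split2_single:
  assumes "\<And>u v. u @ v = xs \<Longrightarrow> length u \<noteq> p \<Longrightarrow> F u v = 0"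
  shows "split2 F xs = (if p \<le> length xs then F (take p xs) (drop p xs) else 0)"
proof -
  have "split2 F xs = (\<Sum>i\<le>length xs. if i = p then F (take p xs) (drop p xs) else 0)"
    unfolding split2_sum using assms by (intro sum.cong) auto
  then show ?thesis by simp
qed

lemma adj2_sum: "adj2 F xs = (\<Sum>i<length xs - 1. F (take i xs) (xs ! i) (xs ! (i + 1)) (drop (i + 2) xs))"
proof (induction xs arbitrary: F)
  case (Cons x xs)
  show ?case
  proof (cases xs)
    case (Cons y ys)
    have "adj2 F (x # xs) = F [] x y ys + adj2 (\<lambda>u. F (x # u)) xs"
      by (simp add: Cons)
    also have "\<dots> = (\<Sum>i<Suc (length ys). F (take i (x # xs)) ((x # xs) ! i) ((x # xs) ! (i + 1)) (drop (i + 2) (x # xs)))"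
      unfolding Cons.IH by (subst sum.lessThan_Suc_shift) (simp add: Cons)
    finally show ?thesis by (simp add: Cons)
  qed simp
qed simp

lemma sg_mult_left: "sg n x * y = sg n (x * y :: 'a::ring)"
  and sg_mult_right: "x * sg n y = sg n (x * y :: 'a::ring)"
  by (simp_all add: sg_def)

lemma sums_mult:
  fixes y :: "'a::ring"
  shows "split2 F2 xs * y = split2 (\<lambda>u v. F2 u v * y) xs"
    "y * split2 F2 xs = split2 (\<lambda>u v. y * F2 u v) xs"
    "split3 F3 xs * y = split3 (\<lambda>u v w. F3 u v w * y) xs"
    "y * split3 F3 xs = split3 (\<lambda>u v w. y * F3 u v w) xs"
  by (simp_all add: sums_additive[of "\<lambda>x. x * y"] sums_additive[of "\<lambda>x. y * x"] algebra_simps)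

section \<open>Insertion and the Hochschild differential\<close>

definition madd :: "('x::ab_group_add list \<Rightarrow> 'b::ab_group_add) \<Rightarrow> bool" where
  "madd f \<longleftrightarrow> (\<forall>us a b ws. f (us @ (a + b) # ws) = f (us @ a # ws) + f (us @ b # ws))"

definition homog :: "int \<Rightarrow> ('x list \<Rightarrow> 'b::zero) \<Rightarrow> bool" where
  "homog m g \<longleftrightarrow> (\<forall>xs. len xs \<noteq> m \<longrightarrow> g xs = 0)"

definition padd :: "('x list \<Rightarrow> 'a::ab_group_add \<Rightarrow> 'x list \<Rightarrow> 'b::ab_group_add) \<Rightarrow> bool" where
  "padd \<Psi> \<longleftrightarrow> (\<forall>us a b ws. \<Psi> us (a + b) ws = \<Psi> us a ws + \<Psi> us b ws)"

lemma paddD: "padd \<Psi> \<Longrightarrow> \<Psi> us (a + b) ws = \<Psi> us a ws + \<Psi> us b ws"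
  by (simp add: padd_def)

lemma maddD: "madd f \<Longrightarrow> f (us @ (a + b) # ws) = f (us @ a # ws) + f (us @ b # ws)"
  by (simp add: madd_def)

lemma padd_madd: "madd f \<Longrightarrow> padd (\<lambda>us c ws. f (us @ c # ws))"
  by (simp add: madd_def padd_def)

lemma madd_zero: "madd f \<Longrightarrow> f (us @ 0 # ws) = 0"
  using additive_zero[of "\<lambda>a. f (us @ a # ws)"] by (simp add: madd_def)

lemma padd_zero: "padd f \<Longrightarrow> f us 0 ws = 0"
  using additive_zero[of "\<lambda>a. f us a ws"] by (simp add: padd_def)

lemma padd_sg: "padd f \<Longrightarrow> f us (sg n a) ws = sg n (f us a ws)"
  using additive_sg[of "\<lambda>a. f us a ws"] by (simp add: padd_def)

lemma padd_diff: "padd f \<Longrightarrow> f us (a - b) ws = f us a ws - f us b ws"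
  using additive_diff[of "\<lambda>a. f us a ws"] by (simp add: padd_def)

lemma padd_sums:
  assumes "padd \<Psi>"
  shows "\<Psi> us (split2 F xs) ws = split2 (\<lambda>u v. \<Psi> us (F u v) ws) xs"
    "\<Psi> us (split3 F3 xs) ws = split3 (\<lambda>u v w. \<Psi> us (F3 u v w) ws) xs"
    "\<Psi> us (on_hd Fh xs) ws = on_hd (\<lambda>u v. \<Psi> us (Fh u v) ws) xs"
    "\<Psi> us (on_last Fl xs) ws = on_last (\<lambda>u v. \<Psi> us (Fl u v) ws) xs"
    "\<Psi> us (adj2 Fa xs) ws = adj2 (\<lambda>u a b z. \<Psi> us (Fa u a b z) ws) xs"
  using assms by (intro sums_additive[of "\<lambda>c. \<Psi> us c ws"]; simp add: padd_def)+

text \<open>If \<open>v\<close> has the wrong length, both sides vanish. Hence sign exponents may be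
  compared after \<open>len v\<close> has been replaced by the degree of \<open>g\<close>.\<close>

lemma homog_sg_cong:
  assumes "homog m g" "padd \<Psi>" "len v = m \<Longrightarrow> even (k - n)"
  shows "sg k (\<Psi> us (g v) ws) = sg n (\<Psi> us (g v) ws)"
proof (cases "len v = m")
  case True
  then show ?thesis using assms(3) by (intro sg_cong) auto
next
  case False
  then show ?thesis using assms by (simp add: homog_def padd_zero)
qed

text \<open>The cup product without its sign. Summing over all cuts keeps degrees out of the
  definition; for homogeneous factors at most one cut contributes.\<close>

definition conv :: "('x list \<Rightarrow> 'a) \<Rightarrow> ('x list \<Rightarrow> 'a) \<Rightarrow> 'x list \<Rightarrow> 'a::{ring, monoid_mult}" where
  "conv f g = split2 (\<lambda>u v. f u * g v)"

text \<open>For \<open>g\<close> of degree \<open>m\<close> the parameter \<open>d\<close> is \<open>m - 1\<close>.  All signs are read off from lengths of words,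
  so that no degree bookkeeping is needed for the other argument.\<close>

definition ins :: "int \<Rightarrow> ('x list \<Rightarrow> 'a) \<Rightarrow> ('x list \<Rightarrow> 'a \<Rightarrow> 'x list \<Rightarrow> 'b::ab_group_add) \<Rightarrow> 'x list \<Rightarrow> 'b" where
  "ins d g \<Psi> = split3 (\<lambda>u v w. sg (d * len u) (\<Psi> u (g v) w))"

definition circ :: "int \<Rightarrow> ('a list \<Rightarrow> 'b) \<Rightarrow> ('a list \<Rightarrow> 'a) \<Rightarrow> 'a list \<Rightarrow> 'b::ab_group_add" where
  "circ d f g = ins d g (\<lambda>u c w. f (u @ c # w))"

definition contr :: "('a::{ring, monoid_mult} list \<Rightarrow> 'b::ab_group_add) \<Rightarrow> 'a list \<Rightarrow> 'b" where
  "contr \<Phi> = adj2 (\<lambda>x a b z. sg (len x) (\<Phi> (x @ (a * b) # z)))"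

text \<open>\<open>contr\<close> for words with a marked letter \<open>c\<close>.\<close>

definition pcontr :: "('a::{ring, monoid_mult} list \<Rightarrow> 'a \<Rightarrow> 'a list \<Rightarrow> 'b::ab_group_add) \<Rightarrow> 'a list \<Rightarrow> 'a \<Rightarrow> 'a list \<Rightarrow> 'b" where
  "pcontr \<Psi> us c ws = adj2 (\<lambda>x a b z. sg (len x) (\<Psi> (x @ (a * b) # z) c ws)) us
     + on_last (\<lambda>x a. sg (len x) (\<Psi> x (a * c) ws)) us
     + on_hd (\<lambda>b z. sg (len us) (\<Psi> us (c * b) z)) ws
     + adj2 (\<lambda>x a b z. sg (len us + 1 + len x) (\<Psi> us c (x @ (a * b) # z))) ws"

text \<open>The product of the \<open>i\<close>-th and the next letter has sign
  \<open>(-1)^(r+1-i)\<close> in the Hochschild differential, while \<open>contr\<close> uses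
  \<open>(-1)^(len x)\<close> with \<open>len x = i - 1\<close>. This accounts for the minus sign in
  front of \<open>contr\<close>.\<close>

definition hb :: "int \<Rightarrow> ('a::{ring, monoid_mult} list \<Rightarrow> 'a) \<Rightarrow> 'a list \<Rightarrow> 'a" where
  "hb r f xs = on_last (\<lambda>x a. f x * a) xs + sg (r + 1) (on_hd (\<lambda>a x. a * f x) xs - contr f xs)"

lemma contr_middle: "contr f (us @ c # ws) = pcontr (\<lambda>us c ws. f (us @ c # ws)) us c ws"
  by (simp add: contr_def pcontr_def adj2_middle ac_simps)

text \<open>A contracted pair lies in \<open>w\<close> (\<open>A1\<close>), inside the inserted
  block (\<open>A2\<close>) or in \<open>u\<close> (\<open>A3\<close>). On the right,
  \<open>pcontr\<close> contributes \<open>B1\<close> and \<open>B4\<close>, which match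
  \<open>A3\<close> and \<open>A1\<close>, and also \<open>B2\<close>, \<open>B3\<close>, where the
  inserted value is multiplied by a neighbour. The latter are the outer terms \<open>C2\<close>,
  \<open>C1\<close> of the differential of \<open>g\<close> on a block longer by one letter, and its
  inner terms \<open>C3\<close> account for \<open>A2\<close>.\<close>

lemma contr_ins:
  assumes \<Psi>: "padd \<Psi>" and g: "homog m g"
  shows "contr (ins (m - 1) g \<Psi>) xs = sg (m - 1) (ins (m - 1) g (pcontr \<Psi>) xs) - sg (m - 1) (ins m (hb m g) \<Psi> xs)"
proof -
  define d where "d = m - 1"
  define A1 where "A1 = adj2 (\<lambda>l a b z. split3 (\<lambda>u v w. sg (len l + d * len u) (\<Psi> u (g v) (w @ (a * b) # z))) l) xs"
  define A2 where "A2 = adj2 (\<lambda>l a b r. split2 (\<lambda>u x. split2 (\<lambda>z w. sg (len l + d * len u) (\<Psi> u (g (x @ (a * b) # z)) w)) r) l) xs"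
  define A3 where "A3 = adj2 (\<lambda>x a b r. split3 (\<lambda>z v w. sg (len x + d * len (x @ (a * b) # z)) (\<Psi> (x @ (a * b) # z) (g v) w)) r) xs"
  define B1 where "B1 = split3 (\<lambda>u v w. sg (d * len u) (adj2 (\<lambda>x a b z. sg (len x) (\<Psi> (x @ (a * b) # z) (g v) w)) u)) xs"
  define B2 where "B2 = split3 (\<lambda>u v w. sg (d * len u) (on_last (\<lambda>x a. sg (len x) (\<Psi> x (a * g v) w)) u)) xs"
  define B3 where "B3 = split3 (\<lambda>u v w. sg (d * len u) (on_hd (\<lambda>b z. sg (len u) (\<Psi> u (g v * b) z)) w)) xs"
  define B4 where "B4 = split3 (\<lambda>u v w. sg (d * len u) (adj2 (\<lambda>x a b z. sg (len u + 1 + len x) (\<Psi> u (g v) (x @ (a * b) # z))) w)) xs"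
  define C1 where "C1 = split3 (\<lambda>u v w. sg (m * len u) (on_last (\<lambda>x a. \<Psi> u (g x * a) w) v)) xs"
  define C2 where "C2 = split3 (\<lambda>u v w. sg (m * len u + (m + 1)) (on_hd (\<lambda>a x. \<Psi> u (a * g x) w) v)) xs"
  define C3 where "C3 = split3 (\<lambda>u v w. sg (m * len u + (m + 1)) (adj2 (\<lambda>x a b z. sg (len x) (\<Psi> u (g (x @ (a * b) # z)) w)) v)) xs"
  have L: "contr (ins d g \<Psi>) xs = A1 + A2 + A3"
    by (simp only: contr_def ins_def split3_middle sg_add push_sg adj2_add A1_def A2_def A3_def)
  have R: "ins d g (pcontr \<Psi>) xs = B1 + B2 + B3 + B4"
    by (simp only: pcontr_def ins_def sg_add split3_add B1_def B2_def B3_def B4_def)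
  have C: "ins m (hb m g) \<Psi> xs = C1 + C2 - C3"
    unfolding ins_def hb_def paddD[OF \<Psi>] padd_diff[OF \<Psi>] padd_sg[OF \<Psi>] padd_sums[OF \<Psi>] contr_def
      sg_add sg_diff sg_sg sums_add sums_diff C1_def C2_def C3_def
    by simp
  have "B1 = split3 (\<lambda>u v w. adj2 (\<lambda>x a b z. sg (d * (len x + 2 + len z) + len x) (\<Psi> (x @ (a * b) # z) (g v) w)) u) xs"
    unfolding B1_def push_sg
    by (intro split3_cong adj2_cong sg_cong) auto
  then have AB1: "A3 = sg d B1"
    unfolding split3_adj2_left A3_def
    by (simp only: push_sg) (intro adj2_cong split3_cong sg_cong; simp add: algebra_simps)
  have AB4: "A1 = sg d B4"
    unfolding B4_def push_sg split3_adj2_right A1_def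
    by (intro adj2_cong split3_cong homog_sg_cong[OF g \<Psi>]) (auto simp: d_def)
  \<comment> \<open>The last letter of \<open>u\<close> is moved into the block, so
    \<open>len u\<close> has to be replaced by \<open>len x + 1\<close> in the sign before the cut
    is shifted.\<close>
  have "B2 = split3 (\<lambda>u v w. on_last (\<lambda>x a. sg (d * (len x + 1) + len x) (\<Psi> x (a * g v) w)) u) xs"
    unfolding B2_def push_sg
    by (intro split3_cong on_last_cong sg_cong) auto
  then have BC2: "B2 = C2"
    unfolding split3_on_last_left C2_def sums_sg[symmetric]
    by (simp only:) (intro split3_cong on_hd_cong sg_cong; simp add: d_def algebra_simps)
  have BC1: "B3 = C1"
    unfolding B3_def push_sg split3_on_hd_right C1_def
    by (intro split3_cong on_last_cong sg_cong; simp add: d_def algebra_simps)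
  have AC3: "A2 = sg d C3"
    unfolding C3_def push_sg split3_adj2_mid A2_def
    by (intro adj2_cong split2_cong sg_cong) (auto simp: d_def algebra_simps)
  show ?thesis
    unfolding d_def[symmetric] L R C AB1 AB4 AC3 BC1 BC2
    by (simp add: sg_add sg_diff)
qed

section \<open>Outer terms of the differential, and the differential of an insertion\<close>

definition lmul :: "('a::{ring, monoid_mult} list \<Rightarrow> 'a) \<Rightarrow> 'a list \<Rightarrow> 'a" where
  "lmul f = on_hd (\<lambda>a x. a * f x)"

definition rmul :: "('a::{ring, monoid_mult} list \<Rightarrow> 'a) \<Rightarrow> 'a list \<Rightarrow> 'a" where
  "rmul f = on_last (\<lambda>x a. f x * a)"

lemma hb_eq: "hb r f xs = rmul f xs + sg (r + 1) (lmul f xs - contr f xs)"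
  by (simp add: hb_def lmul_def rmul_def)

text \<open>The form in which the cocycle condition is used: the inner terms are traded for the two
  outer ones, which can be moved around or telescoped.\<close>

lemma contr_eq:
  assumes "hb r f xs = 0"
  shows "contr f xs = lmul f xs + sg (r + 1) (rmul f xs)"
  using assms by (auto simp: hb_eq sg_def algebra_simps split: if_splits)

lemma lmul_middle: "lmul f (us @ c # ws) = on_hd (\<lambda>a z. a * f (z @ c # ws)) us + (if us = [] then c * f ws else 0)"
  by (simp add: lmul_def on_hd_append)

lemma rmul_middle: "rmul f (us @ c # ws) = (if ws = [] then f us * c else 0) + on_last (\<lambda>z a. f (us @ c # z) * a) ws"
  by (simp add: rmul_def on_last_append)

lemma circ_add: "circ d (\<lambda>xs. f xs + g xs) h xs = circ d f h xs + circ d g h xs"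
  and circ_diff: "circ d (\<lambda>xs. f xs - g xs) h xs = circ d f h xs - circ d g h xs"
  and circ_sg: "circ d (\<lambda>xs. sg n (f xs)) h xs = sg n (circ d f h xs)"
  by (simp_all only: circ_def ins_def sg_add sg_diff split3_add split3_diff push_sg add.commute)

text \<open>The first letter seen by \<open>lmul f\<close> is an ordinary letter, unless the block
  of \<open>g\<close> starts the word; then it is the value of \<open>g\<close>, and a cup product
  splits off. \<open>circ_rmul\<close> is the mirror image at the end of the word.\<close>

lemma circ_lmul: "circ d (lmul f) g xs = sg d (lmul (circ d f g) xs) + conv g f xs"
proof -
  have "split3 (\<lambda>u v w. sg (d * len u) (on_hd (\<lambda>a z. a * f (z @ g v # w)) u)) xs
     = split3 (\<lambda>u v w. on_hd (\<lambda>a z. sg (d * (1 + len z)) (a * f (z @ g v # w))) u) xs"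
    unfolding sums_sg[symmetric] by (intro split3_cong on_hd_cong sg_cong) auto
  also have "\<dots> = sg d (lmul (circ d f g) xs)"
    unfolding split3_on_hd_left lmul_def circ_def ins_def sums_sg[symmetric] sg_mult_right[symmetric] sums_mult
    by (simp only: sums_sg[symmetric] sg_mult_right[symmetric] sums_mult sg_sg)
      (simp add: sg_mult_right algebra_simps)
  finally have 1: "split3 (\<lambda>u v w. sg (d * len u) (on_hd (\<lambda>a z. a * f (z @ g v # w)) u)) xs = sg d (lmul (circ d f g) xs)" .
  have "split3 (\<lambda>u v w. sg (d * len u) (if u = [] then g v * f w else 0)) xs = split3 (\<lambda>u v w. if u = [] then g v * f w else 0) xs"
    by (intro split3_cong) simp
  also have "\<dots> = conv g f xs"
    unfolding split3_unit_left conv_def ..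
  finally show ?thesis
    unfolding circ_def ins_def lmul_middle sg_add split3_add using 1 by (simp add: circ_def ins_def)
qed

lemma circ_rmul:
  assumes "homog p f"
  shows "circ d (rmul f) g xs = rmul (circ d f g) xs + sg (d * p) (conv f g xs)"
proof -
  have 1: "split3 (\<lambda>u v w. sg (d * len u) (on_last (\<lambda>z a. f (u @ g v # z) * a) w)) xs = rmul (circ d f g) xs"
    unfolding sums_sg[symmetric] split3_on_last_right rmul_def circ_def ins_def sums_mult sg_mult_left ..
  have "split3 (\<lambda>u v w. sg (d * len u) (if w = [] then f u * g v else 0)) xs = split3 (\<lambda>u v w. if w = [] then sg (d * p) (f u * g v) else 0) xs"
    using assms by (intro split3_cong) (auto simp: homog_def)
  also have "\<dots> = sg (d * p) (conv f g xs)"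
    unfolding split3_unit_right conv_def sums_sg ..
  finally show ?thesis
    unfolding circ_def ins_def rmul_middle sg_add split3_add using 1 by (simp add: circ_def ins_def)
qed

text \<open>Gerstenhaber's formula: insertion commutes with the differential up to the graded
  commutator of the cup product, which comes from the extremal positions in \<open>circ_lmul\<close>
  and \<open>circ_rmul\<close>. For cocycles it is the homotopy behind graded commutativity.\<close>

theorem hb_circ:
  assumes f: "madd f" "homog p f" and g: "homog q g"
  shows "hb (p + q - 1) (circ (q - 1) f g) xs = circ (q - 1) (hb p f) g xs - sg p (circ q f (hb q g) xs)
    - sg ((q - 1) * p) (conv f g xs) + sg p (conv g f xs)"
proof -
  have c: "contr (circ (q - 1) f g) xs = sg (q - 1) (circ (q - 1) (contr f) g xs) - sg (q - 1) (circ q f (hb q g) xs)"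
    unfolding circ_def contr_ins[OF padd_madd[OF f(1)] g] contr_middle ..
  have h: "hb p f = (\<lambda>xs. rmul f xs + sg (p + 1) (lmul f xs - contr f xs))"
    by (simp add: hb_eq fun_eq_iff)
  show ?thesis
    unfolding hb_eq[of _ "circ (q - 1) f g"] c h circ_add circ_diff circ_sg circ_lmul circ_rmul[OF f(2)] sg_add sg_diff sg_sg
    by (simp add: sg_def)
qed

text \<open>Insertion strictly to the right of a letter \<open>c\<close> that already occupies a
  slot of \<open>f\<close>. In the sign \<open>c\<close> counts as one letter, even when it is later
  the value of a cochain on a longer block.\<close>

definition pins :: "int \<Rightarrow> ('a list \<Rightarrow> 'b) \<Rightarrow> ('a list \<Rightarrow> 'a) \<Rightarrow> 'a list \<Rightarrow> 'a \<Rightarrow> 'a list \<Rightarrow> 'b::ab_group_add" where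
  "pins d f g us c ws = split3 (\<lambda>u v w. sg (d * (len us + 1 + len u)) (f (us @ c # u @ g v # w))) ws"

text \<open>The two-fold brace \<open>f{g, h}\<close>, up to sign conventions: both are inserted
  into different slots of \<open>f\<close>, with \<open>g\<close> to the left of
  \<open>h\<close>.\<close>

definition brace :: "int \<Rightarrow> int \<Rightarrow> ('a list \<Rightarrow> 'b) \<Rightarrow> ('a list \<Rightarrow> 'a) \<Rightarrow> ('a list \<Rightarrow> 'a) \<Rightarrow> 'a list \<Rightarrow> 'b::ab_group_add" where
  "brace d e f g h = ins d g (pins e f h)"

text \<open>The pre-Lie identity. The block of \<open>h\<close> lies to the right of
  \<open>g\<close>, inside \<open>g\<close>, or to the left of \<open>g\<close>; the outer cases are
  the two braces, which together are symmetric in \<open>g\<close> and \<open>h\<close> up to sign.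
  This symmetry yields the Jacobi identity.\<close>

lemma circ_circ:
  fixes f :: "'a::ab_group_add list \<Rightarrow> 'b::ab_group_add"
  assumes f: "madd f" and g: "homog m g"
  shows "circ e (circ (m - 1) f g) h xs = circ (m - 1 + e) f (circ e g h) xs
     + sg ((m - 1) * e) (brace (m - 1) e f g h xs) + brace e (m - 1) f h g xs"
proof -
  define d where "d = m - 1"
  note F = padd_madd[OF f]
  have 1: "split3 (\<lambda>u v w. split3 (\<lambda>x y z. sg (e * len u + d * len x) (f (x @ g y # z @ h v # w))) u) xs
      = sg (d * e) (brace d e f g h xs)"
  proof -
    \<comment> \<open>On the left the block of \<open>g\<close> counts with its \<open>m\<close>
      letters in the position of \<open>h\<close>, in the brace it counts as one letter. The
      difference \<open>d = m - 1\<close> produces the factor \<open>sg (d * e)\<close>.\<close>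
    have "split3 (\<lambda>u v w. split3 (\<lambda>x y z. sg (e * len u + d * len x) (f (x @ g y # z @ h v # w))) u) xs
       = split3 (\<lambda>u v w. split3 (\<lambda>x y z. sg (d * e + (d * len x + e * (len x + 1 + len z))) (f (x @ g y # z @ h v # w))) u) xs"
    proof (intro split3_cong)
      fix u v w x y z :: "'a list"
      assume "x @ y @ z = u"
      then show "sg (e * len u + d * len x) (f (x @ g y # z @ h v # w))
         = sg (d * e + (d * len x + e * (len x + 1 + len z))) (f (x @ g y # z @ h v # w))"
        by (intro homog_sg_cong[OF g F]) (auto simp: d_def)
    qed
    also have "\<dots> = sg (d * e) (brace d e f g h xs)"
      unfolding split3_split3_left brace_def ins_def pins_def push_sg ..
    finally show ?thesis .
  qed
  have 2: "split3 (\<lambda>u v w. split2 (\<lambda>x y. split2 (\<lambda>z t. sg (e * len u + d * len x) (f (x @ g (y @ h v # z) # t))) w) u) xs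
      = circ (d + e) f (circ e g h) xs"
  proof -
    have "split3 (\<lambda>u v w. split2 (\<lambda>x y. split2 (\<lambda>z t. sg (e * len u + d * len x) (f (x @ g (y @ h v # z) # t))) w) u) xs
       = split3 (\<lambda>u v w. split2 (\<lambda>x y. split2 (\<lambda>z t. sg (e * (len x + len y) + d * len x) (f (x @ g (y @ h v # z) # t))) w) u) xs"
      by (intro split3_cong split2_cong sg_cong) auto
    also have "\<dots> = circ (d + e) f (circ e g h) xs"
      unfolding split3_split22_mid circ_def ins_def padd_sums[OF F] padd_sg[OF F] push_sg
      by (intro split3_cong sg_cong) (auto simp: algebra_simps)
    finally show ?thesis .
  qed
  have 3: "split3 (\<lambda>u v w. split3 (\<lambda>x y z. sg (e * len u + d * len (u @ h v # x)) (f ((u @ h v # x) @ g y # z))) w) xs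
      = brace e d f h g xs"
    unfolding brace_def ins_def pins_def push_sg
    by (intro split3_cong sg_cong) auto
  show ?thesis
    unfolding d_def[symmetric] 1[symmetric] 2[symmetric] 3[symmetric]
    unfolding circ_def[of _ "circ d f g"] ins_def[of _ h]
    unfolding circ_def[of _ f g] ins_def[of _ g] split3_middle
    by (simp only: sg_add split3_add push_sg append_Cons append_assoc ac_simps)
qed

section \<open>The Poisson identity up to homotopy\<close>

lemma padd_pins:
  assumes "madd f"
  shows "padd (pins d f g)"
  using maddD[OF assms] by (simp add: padd_def pins_def sg_add split3_add)

lemma pins_add: "pins d (\<lambda>xs. f xs + f' xs) g us c ws = pins d f g us c ws + pins d f' g us c ws"
  and pins_sg: "pins d (\<lambda>xs. sg n (f xs)) g us c ws = sg n (pins d f g us c ws)"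
  by (simp_all only: pins_def sg_add split3_add push_sg add.commute)

text \<open>As in \<open>contr_ins\<close>, with one new effect: in \<open>contr f\<close> the
  letter \<open>c\<close> may be multiplied by the inserted value when the two are adjacent. No
  contraction of the original word does this, so these terms remain; with \<open>c\<close> a value
  of another cochain they become a cup product.\<close>

lemma pins_contr:
  assumes f: "madd f" and g: "homog r g" "hb r g = (\<lambda>_. 0)"
  shows "pcontr (pins (r - 1) f g) us c ws = sg (r - 1) (pins (r - 1) (contr f) g us c ws)
    - sg (r - 1) (split2 (\<lambda>v w. sg (r * len us + (r - 1)) (f (us @ (c * g v) # w))) ws)"
proof -
  define d where "d = r - 1"
  define \<Psi> where "\<Psi> = (\<lambda>u c' w. f (us @ c # u @ c' # w))"
  have P: "padd \<Psi>"
    unfolding padd_def \<Psi>_def using maddD[OF f, of "us @ c # u" for u] by simp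
  have pins: "pins d f g us c = (\<lambda>ws. sg (d * (len us + 1)) (ins d g \<Psi> ws))"
    unfolding pins_def ins_def \<Psi>_def push_sg
    by (intro ext split3_cong sg_cong) (auto simp: algebra_simps)
  \<comment> \<open>The cocycle condition on \<open>g\<close> removes the terms that contain its
    differential.\<close>
  have c0: "contr (ins d g \<Psi>) ws = sg d (ins d g (pcontr \<Psi>) ws)"
    using contr_ins[OF P g(1), of ws] padd_zero[OF P] unfolding g(2) d_def[symmetric]
    by (simp add: ins_def)
  define T1 where "T1 = split3 (\<lambda>u v w. sg (d * (len us + 1 + len u)) (adj2 (\<lambda>x a b z. sg (len x) (f (x @ (a * b) # z @ c # u @ g v # w))) us)) ws"
  define T2 where "T2 = split3 (\<lambda>u v w. sg (d * (len us + 1 + len u)) (on_last (\<lambda>x a. sg (len x) (f (x @ (a * c) # u @ g v # w))) us)) ws"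
  define T3 where "T3 = split3 (\<lambda>u v w. sg (d * (len us + 1 + len u)) (on_hd (\<lambda>b z. sg (len us) (f (us @ (c * b) # z @ g v # w))) u)) ws"
  define T4 where "T4 = split3 (\<lambda>u v w. sg (d * (len us + 1 + len u)) (if u = [] then sg (len us) (f (us @ (c * g v) # w)) else 0)) ws"
  define T5 where "T5 = split3 (\<lambda>u v w. sg (d * (len us + 1 + len u)) (sg (len us + 1) (pcontr \<Psi> u (g v) w))) ws"
  have R: "pins d (contr f) g us c ws = T1 + T2 + T3 + T4 + T5"
  proof -
    have 1: "adj2 (\<lambda>x a b z. sg (len us + 1 + len x) (f (us @ c # x @ (a * b) # z))) (u @ v # w)
      = sg (len us + 1) (pcontr \<Psi> u v w)" for u v w
    proof -
      have "adj2 (\<lambda>x a b z. sg (len us + 1 + len x) (f (us @ c # x @ (a * b) # z))) (u @ v # w)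
        = sg (len us + 1) (contr (\<lambda>l. f (us @ c # l)) (u @ v # w))"
        unfolding contr_def push_sg ..
      then show ?thesis unfolding contr_middle \<Psi>_def .
    qed
    show ?thesis
      unfolding pins_def contr_middle
      unfolding pcontr_def[of "\<lambda>us c ws. f (us @ c # ws)"] 1 on_hd_append sg_add split3_add T1_def T2_def T3_def T4_def T5_def
      by (simp add: ac_simps)
  qed
  have 1: "adj2 (\<lambda>x a b z. sg (len x) (pins d f g (x @ (a * b) # z) c ws)) us = sg d T1"
    unfolding T1_def pins_def push_sg split3_adj2_swap
    by (intro adj2_cong split3_cong sg_cong) (auto simp: algebra_simps)
  have 2: "on_last (\<lambda>x a. sg (len x) (pins d f g x (a * c) ws)) us = sg d T2"
    unfolding T2_def pins_def push_sg split3_on_last_swap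
    by (intro on_last_cong split3_cong sg_cong) (auto simp: algebra_simps)
  have "T3 = split3 (\<lambda>u v w. on_hd (\<lambda>b z. sg (d * (len us + 1 + (1 + len z)) + len us) (f (us @ (c * b) # z @ g v # w))) u) ws"
    unfolding T3_def push_sg by (intro split3_cong on_hd_cong sg_cong) auto
  then have 3: "on_hd (\<lambda>b z. sg (len us) (pins d f g us (c * b) z)) ws = sg d T3"
    unfolding pins_def push_sg split3_on_hd_left
    by (simp only: push_sg) (intro on_hd_cong split3_cong sg_cong; simp add: algebra_simps)
  have "T4 = split3 (\<lambda>u v w. if u = [] then sg (r * len us + d) (f (us @ (c * g v) # w)) else 0) ws"
    unfolding T4_def by (intro split3_cong) (auto simp: d_def algebra_simps)
  then have 4: "T4 = split2 (\<lambda>v w. sg (r * len us + d) (f (us @ (c * g v) # w))) ws"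
    unfolding split3_unit_left .
  have 5: "adj2 (\<lambda>x a b z. sg (len us + 1 + len x) (pins d f g us c (x @ (a * b) # z))) ws = sg d T5"
  proof -
    have "adj2 (\<lambda>x a b z. sg (len us + 1 + len x) (pins d f g us c (x @ (a * b) # z))) ws
        = sg (len us + 1 + d * (len us + 1)) (contr (ins d g \<Psi>) ws)"
      unfolding pins contr_def push_sg by (intro adj2_cong sg_cong) auto
    also have "\<dots> = sg d T5"
      unfolding c0
      unfolding T5_def ins_def push_sg by (intro split3_cong sg_cong) (auto simp: algebra_simps)
    finally show ?thesis .
  qed
  show ?thesis
    unfolding pcontr_def d_def[symmetric] R 1 2 3 5 4[symmetric] by (simp add: sg_add)
qed

text \<open>The value of \<open>g\<close> is the first letter seen by \<open>f\<close> exactly when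
  nothing precedes its block, and then it splits off as a left factor. In \<open>brace_rmul\<close>
  the value of \<open>h\<close> splits off at the end in the same way.\<close>

lemma brace_lmul:
  fixes f :: "'a::{ring, monoid_mult} list \<Rightarrow> 'a"
  shows "brace d e (lmul f) g h xs = sg (d + e) (lmul (brace d e f g h) xs) + sg e (conv g (circ e f h) xs)"
proof -
  define G where "G = (\<lambda>(us::'a list) c ws. split3 (\<lambda>u v w. sg (e * (len us + 1 + len u)) (if us = [] then c * f (u @ h v # w) else 0)) ws)"
  define H where "H = (\<lambda>(us::'a list) c ws. split3 (\<lambda>u v w. sg (e * (len us + 1 + len u)) (on_hd (\<lambda>a z. a * f (z @ c # u @ h v # w)) us)) ws)"
  have P: "pins e (lmul f) h us c ws = H us c ws + G us c ws" for us c ws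
    unfolding pins_def lmul_middle sg_add split3_add G_def H_def ..
  have G: "G us c ws = (if us = [] then sg e (c * circ e f h ws) else 0)" for us c ws
    unfolding G_def circ_def ins_def sums_mult sums_sg[symmetric]
    by (simp add: sums_mult sums_sg[symmetric] sg_mult_right algebra_simps)
  have 1: "ins d g G xs = sg e (conv g (circ e f h) xs)"
  proof -
    have "ins d g G xs = split3 (\<lambda>u v w. if u = [] then sg e (g v * circ e f h w) else 0) xs"
      unfolding ins_def G by (intro split3_cong) simp
    then show ?thesis
      unfolding split3_unit_left conv_def sums_sg .
  qed
  have H: "H us c ws = on_hd (\<lambda>a z. sg e (a * pins e f h z c ws)) us" for us c ws
    unfolding H_def pins_def push_sg split3_on_hd_swap sums_mult sg_mult_right
    by (intro on_hd_cong split3_cong sg_cong) (auto simp: algebra_simps)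
  have 2: "ins d g H xs = sg (d + e) (lmul (brace d e f g h) xs)"
  proof -
    have "ins d g H xs = split3 (\<lambda>u v w. on_hd (\<lambda>a z. sg (d + e + d * len z) (a * pins e f h z (g v) w)) u) xs"
      unfolding ins_def H push_sg
      by (intro split3_cong on_hd_cong sg_cong) (auto simp: algebra_simps)
    also have "\<dots> = sg (d + e) (lmul (brace d e f g h) xs)"
      unfolding split3_on_hd_left lmul_def brace_def ins_def sums_sg[symmetric] sums_mult sg_mult_right sg_sg ..
    finally show ?thesis .
  qed
  show ?thesis
    unfolding brace_def[of _ _ "lmul f"] 1[symmetric] 2[symmetric] ins_def P sg_add split3_add ..
qed

lemma brace_rmul:
  fixes f :: "'a::{ring, monoid_mult} list \<Rightarrow> 'a"
  assumes "homog p f"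
  shows "brace d e (rmul f) g h xs = rmul (brace d e f g h) xs + sg (e * p) (conv (circ d f g) h xs)"
proof -
  define G where "G = (\<lambda>(us::'a list) c ws. split3 (\<lambda>u v w. sg (e * (len us + 1 + len u)) (if w = [] then f (us @ c # u) * h v else 0)) ws)"
  define H where "H = (\<lambda>(us::'a list) c ws. split3 (\<lambda>u v w. sg (e * (len us + 1 + len u)) (on_last (\<lambda>z a. f (us @ c # u @ h v # z) * a) w)) ws)"
  have "rmul f (us @ c # u @ h v # w) = (if w = [] then f (us @ c # u) * h v else 0) + on_last (\<lambda>z a. f (us @ c # u @ h v # z) * a) w" for us c u v w
    using rmul_middle[of f "us @ c # u" "h v" w] by simp
  then have P: "pins e (rmul f) h us c ws = G us c ws + H us c ws" for us c ws
    unfolding pins_def G_def H_def by (simp only: sg_add split3_add)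
  have *: "sg (e * (len us + 1 + len u)) (f (us @ c # u) * h v) = sg (e * p) (f (us @ c # u) * h v)" for us c u v
  proof (cases "len (us @ c # u) = p")
    case True
    then show ?thesis by (intro sg_cong) auto
  next
    case False
    then have "f (us @ c # u) = 0" using assms by (simp add: homog_def)
    then show ?thesis by simp
  qed
  have G: "G us c ws = split2 (\<lambda>u v. sg (e * p) (f (us @ c # u) * h v)) ws" for us c ws
  proof -
    have "G us c ws = split3 (\<lambda>u v w. if w = [] then sg (e * p) (f (us @ c # u) * h v) else 0) ws"
      unfolding G_def using * by (intro split3_cong) auto
    then show ?thesis unfolding split3_unit_right .
  qed
  have 1: "ins d g G xs = sg (e * p) (conv (circ d f g) h xs)"
    unfolding ins_def G sums_sg[symmetric] split3_split2_right conv_def circ_def sums_mult sg_mult_left sg_sg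
    by (intro split2_cong split3_cong sg_cong) auto
  have H: "H us c ws = on_last (\<lambda>z a. pins e f h us c z * a) ws" for us c ws
    unfolding H_def pins_def sums_sg[symmetric] split3_on_last_right sums_mult sg_mult_left ..
  have 2: "ins d g H xs = rmul (brace d e f g h) xs"
    unfolding ins_def H sums_sg[symmetric] split3_on_last_right rmul_def brace_def sums_mult sg_mult_left ..
  show ?thesis
    unfolding brace_def[of _ _ "rmul f"] 1[symmetric] 2[symmetric] ins_def P sg_add split3_add by (rule add.commute)
qed

lemma ins_add: "ins d g (\<lambda>us c ws. \<Phi> us c ws + \<Psi> us c ws) xs = ins d g \<Phi> xs + ins d g \<Psi> xs"
  and ins_diff: "ins d g (\<lambda>us c ws. \<Phi> us c ws - \<Psi> us c ws) xs = ins d g \<Phi> xs - ins d g \<Psi> xs"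
  and ins_sg: "ins d g (\<lambda>us c ws. sg n (\<Psi> us c ws)) xs = sg n (ins d g \<Psi> xs)"
  by (simp_all only: ins_def sg_add sg_diff split3_add split3_diff push_sg add.commute)

text \<open>For cocycles the brace bounds the failure of insertion into \<open>f\<close> to be a
  derivation of the cup product. The three products come from \<open>g\<close> at the front, from
  \<open>h\<close> at the end, and from the values of \<open>g\<close> and \<open>h\<close> being
  neighbours (the extra terms of \<open>pins_contr\<close>).\<close>

theorem hb_brace:
  assumes f: "madd f" "homog p f" "hb p f = (\<lambda>_. 0)"
    and g: "homog q g" "hb q g = (\<lambda>_. 0)" and h: "homog r h" "hb r h = (\<lambda>_. 0)"
  shows "hb (p + q + r - 2) (brace (q - 1) (r - 1) f g h) xs =
    sg (p + q + r) (sg (q - 1) (conv g (circ (r - 1) f h) xs)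
      + sg (q - 1 + r * (p + 1)) (conv (circ (q - 1) f g) h xs) - sg (q - 1) (circ (q + r - 1) f (conv g h) xs))"
proof -
  define d e where "d = q - 1" and "e = r - 1"
  define Y where "Y = brace d e f g h"
  have cf: "contr f = (\<lambda>xs. lmul f xs + sg (p + 1) (rmul f xs))"
    using contr_eq[of p f] f(3) by (simp add: fun_eq_iff)
  have 1: "contr Y xs = sg d (ins d g (pcontr (pins e f h)) xs)"
    unfolding Y_def brace_def using contr_ins[OF padd_pins[OF f(1)] g(1)] padd_zero[OF padd_pins[OF f(1)]]
    by (simp add: g(2) d_def ins_def[of q])
  have 2: "ins d g (\<lambda>us c ws. split2 (\<lambda>v w. sg (r * len us + e) (f (us @ (c * h v) # w))) ws) xs
     = sg e (circ (q + r - 1) f (conv g h) xs)"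
    unfolding ins_def push_sg conv_def circ_def padd_sums[OF padd_madd[OF f(1)]]
    unfolding split3_def split2_assoc
    by (intro split2_cong sg_cong) (auto simp: d_def e_def algebra_simps)
  have 3: "ins d g (pcontr (pins e f h)) xs = sg e (brace d e (contr f) g h xs) - circ (q + r - 1) f (conv g h) xs"
  proof -
    have "pcontr (pins e f h) = (\<lambda>us c ws. sg e (pins e (contr f) h us c ws)
        - sg e (split2 (\<lambda>v w. sg (r * len us + e) (f (us @ (c * h v) # w))) ws))"
      by (intro ext) (rule pins_contr[OF f(1) h, folded e_def])
    then have "ins d g (pcontr (pins e f h)) xs = sg e (ins d g (pins e (contr f) h) xs)
        - sg e (ins d g (\<lambda>us c ws. split2 (\<lambda>v w. sg (r * len us + e) (f (us @ (c * h v) # w))) ws) xs)"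
      by (simp only: ins_diff ins_sg)
    also have "\<dots> = sg e (brace d e (contr f) g h xs) - circ (q + r - 1) f (conv g h) xs"
      unfolding 2 brace_def by (simp add: sg_def)
    finally show ?thesis .
  qed
  have 4: "brace d e (contr f) g h xs = brace d e (lmul f) g h xs + sg (p + 1) (brace d e (rmul f) g h xs)"
    unfolding cf brace_def pins_add[abs_def] pins_sg[abs_def] by (simp only: ins_add ins_sg)
  show ?thesis
    unfolding hb_eq d_def[symmetric] e_def[symmetric] Y_def[symmetric] 1 3 4 brace_lmul brace_rmul[OF f(2)]
    unfolding d_def e_def
    by (simp add: sg_def Y_def)
qed

section \<open>Sums over cyclic rotations\<close>

text \<open>The block \<open>c # W\<close> stays in one piece while the letters in front of it are moved, one at a time, to
  the end of the word, each of them picking up \<open>N\<close>: the analogue of Connes' operator.\<close>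

definition rot :: "('a \<Rightarrow> 'a) \<Rightarrow> ('a list \<Rightarrow> 'b) \<Rightarrow> 'a list \<Rightarrow> 'a \<Rightarrow> 'a list \<Rightarrow> 'b::ab_group_add" where
  "rot N \<phi> us c W = split2 (\<lambda>u v. sg (len u * (len v + 1 + len W)) (\<phi> (v @ c # W @ map N u))) us"

text \<open>A pair contracted before the rotation is never cut apart, and a pair contracted after it
  lies wholly in \<open>v\<close> or wholly in \<open>map N u\<close>. The second case uses that
  \<open>N\<close> is multiplicative.\<close>

lemma rot_adj2:
  assumes N: "\<And>a b. N (a * b) = N a * N b"
  shows "adj2 (\<lambda>x a b z. sg (len x) (rot N \<phi> (x @ (a * b) # z) c W)) us =
    split2 (\<lambda>u v. sg (len u * (len v + 1 + len W)) (adj2 (\<lambda>x a b z. sg (len x) (\<phi> (x @ (a * b) # z @ c # W @ map N u))) v)) us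
    + split2 (\<lambda>u v. sg (len u * (len v + 1 + len W))
        (adj2 (\<lambda>x a b z. sg (len v + 1 + len W + len x) (\<phi> (v @ c # W @ x @ (a * b) # z))) (map N u))) us"
proof -
  have 1: "split2 (\<lambda>u v. sg (len u * (len v + 1 + len W)) (adj2 (\<lambda>x a b z. sg (len x) (\<phi> (x @ (a * b) # z @ c # W @ map N u))) v)) us
    = split2 (\<lambda>u v. adj2 (\<lambda>x a b z. sg (len u * (len x + 2 + len z + 1 + len W) + len x) (\<phi> (x @ (a * b) # z @ c # W @ map N u))) v) us"
    unfolding push_sg by (intro split2_cong adj2_cong sg_cong) auto
  have 2: "split2 (\<lambda>u v. sg (len u * (len v + 1 + len W))
        (adj2 (\<lambda>x a b z. sg (len v + 1 + len W + len x) (\<phi> (v @ c # W @ x @ (a * b) # z))) (map N u))) us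
    = split2 (\<lambda>u v. adj2 (\<lambda>x a b z. sg ((len x + 2 + len z) * (len v + 1 + len W) + (len v + 1 + len W + len x))
          (\<phi> (v @ c # W @ map N x @ (N a * N b) # map N z))) u) us"
    unfolding push_sg adj2_map by (intro split2_cong adj2_cong sg_cong) auto
  show ?thesis
    unfolding 1 2 adj2_split2_left adj2_split2_right
    unfolding rot_def split2_middle sg_add adj2_add push_sg
    by (rule arg_cong2[where f = "(+)"]; intro adj2_cong split2_cong sg_cong; auto simp: algebra_simps N)
qed

lemma rot_on_last:
  "on_last (\<lambda>x a. sg (len x) (rot N \<phi> x (a * c) W)) us =
    split2 (\<lambda>u v. sg (len u * (len v + 1 + len W)) (on_last (\<lambda>x a. sg (len x) (\<phi> (x @ (a * c) # W @ map N u))) v)) us"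
proof -
  have "split2 (\<lambda>u v. sg (len u * (len v + 1 + len W)) (on_last (\<lambda>x a. sg (len x) (\<phi> (x @ (a * c) # W @ map N u))) v)) us
    = split2 (\<lambda>u v. on_last (\<lambda>x a. sg (len u * (len x + 1 + 1 + len W) + len x) (\<phi> (x @ (a * c) # W @ map N u))) v) us"
    unfolding push_sg by (intro split2_cong on_last_cong sg_cong) auto
  then show ?thesis
    unfolding split2_on_last_right rot_def push_sg
    by (simp only:) (intro on_last_cong split2_cong sg_cong; auto simp: algebra_simps)
qed

lemma rot_on_hd:
  "split2 (\<lambda>u v. sg (len u * (len v + 1 + len W)) (on_hd (\<lambda>b z. F v b z) (map N u))) us
    = on_hd (\<lambda>y us. split2 (\<lambda>u v. sg ((len u + 1) * (len v + 1 + len W)) (F v (N y) (map N u))) us) us"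
proof -
  have "split2 (\<lambda>u v. sg (len u * (len v + 1 + len W)) (on_hd (\<lambda>b z. F v b z) (map N u))) us
    = split2 (\<lambda>u v. on_hd (\<lambda>b z. sg ((len z + 1) * (len v + 1 + len W)) (F v (N b) (map N z))) u) us"
    unfolding on_hd_map sums_sg[symmetric] by (intro split2_cong on_hd_cong sg_cong) auto
  then show ?thesis unfolding split2_on_hd_left .
qed

text \<open>After a rotation the letter following \<open>c\<close> is \<open>N y\<close>, where
  \<open>y\<close> was the first letter of \<open>us\<close>. The resulting products
  \<open>c * N y\<close> have the shape that \<open>form_lmul\<close> gives to the left outer term
  of a differential.\<close>

lemma rot_contr_nil:
  assumes N: "\<And>a b. N (a * b) = N a * N b"
  shows "rot N (contr \<phi>) us c [] = contr (\<lambda>us. rot N \<phi> us c []) us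
    + on_last (\<lambda>x a. sg (len x) (rot N \<phi> x (a * c) [])) us - on_hd (\<lambda>y us. rot N \<phi> us (c * N y) []) us"
proof -
  have 3: "on_hd (\<lambda>y us. rot N \<phi> us (c * N y) []) us = - split2 (\<lambda>u v. sg (len u * (len v + 1 + len [])) (on_hd (\<lambda>b z. sg (len v) (\<phi> (v @ (c * b) # z))) (map N u))) us"
    unfolding rot_on_hd
    unfolding rot_def uminus_eq_sg push_sg
    by (intro on_hd_cong split2_cong sg_cong) (auto simp: algebra_simps)
  show ?thesis
    unfolding contr_def[of "\<lambda>us. rot N \<phi> us c []"] rot_adj2[OF N] rot_on_last
    unfolding rot_def[of _ "contr \<phi>"] contr_middle pcontr_def sg_add split2_add
    using 3 by simp
qed

text \<open>As \<open>rot_contr_nil\<close> for a longer block. Its last letter \<open>z\<close>,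
  the future argument of the form, is kept apart: products with \<open>z\<close> on the left or on
  the right become the outer terms in \<open>form_hb_cartan\<close>, or a product of an inserted
  value with \<open>z\<close>.\<close>

lemma rot_contr_snoc:
  assumes N: "\<And>a b. N (a * b) = N a * N b"
  shows "rot N (contr \<phi>) us c (ws @ [z]) = pcontr (\<lambda>us c ws. rot N \<phi> us c (ws @ [z])) us c ws
    + (if ws = [] then sg (len us) (rot N \<phi> us (c * z) []) else 0)
    + on_last (\<lambda>w y. sg (len us + len ws) (rot N \<phi> us c (w @ [y * z]))) ws
    - on_hd (\<lambda>y us. rot N \<phi> us c (ws @ [z * N y])) us"
proof -
  let ?k = "\<lambda>u v. len u * (len v + 1 + len (ws @ [z]))"
  have 3: "on_hd (\<lambda>b y. sg (len us) (rot N \<phi> us (c * b) (y @ [z]))) ws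
     = split2 (\<lambda>u v. sg (?k u v) (on_hd (\<lambda>b y. sg (len v) (\<phi> (v @ (c * b) # y @ z # map N u))) ws)) us"
    unfolding rot_def push_sg split2_on_hd_swap
    by (intro on_hd_cong split2_cong sg_cong; auto simp: algebra_simps)
  have 4: "(if ws = [] then sg (len us) (rot N \<phi> us (c * z) []) else 0)
     = split2 (\<lambda>u v. sg (?k u v) (if ws = [] then sg (len v) (\<phi> (v @ (c * z) # map N u)) else 0)) us"
    by (auto simp: rot_def sums_sg[symmetric] intro!: split2_cong sg_cong)
  have 5: "adj2 (\<lambda>x a b y. sg (len us + 1 + len x) (rot N \<phi> us c ((x @ (a * b) # y) @ [z]))) ws
     = split2 (\<lambda>u v. sg (?k u v) (adj2 (\<lambda>x a b y. sg (len v + 1 + len x) (\<phi> (v @ c # x @ (a * b) # y @ z # map N u))) ws)) us"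
    unfolding rot_def push_sg split2_adj2_swap
    by (intro adj2_cong split2_cong sg_cong) (auto simp: algebra_simps)
  have 6: "on_last (\<lambda>w y. sg (len us + len ws) (rot N \<phi> us c (w @ [y * z]))) ws
     = split2 (\<lambda>u v. sg (?k u v) (on_last (\<lambda>w y. sg (len v + 1 + len w) (\<phi> (v @ c # w @ (y * z) # map N u))) ws)) us"
    unfolding rot_def push_sg split2_on_last_swap
    by (intro on_last_cong split2_cong sg_cong; auto simp: algebra_simps)
  have 7: "on_hd (\<lambda>y us. rot N \<phi> us c (ws @ [z * N y])) us
     = - split2 (\<lambda>u v. sg (?k u v) (on_hd (\<lambda>b y. sg (len v + 1 + len ws) (\<phi> (v @ c # ws @ (z * b) # y))) (map N u))) us"
    unfolding rot_on_hd
    unfolding rot_def uminus_eq_sg push_sg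
    by (intro on_hd_cong split2_cong sg_cong) (auto simp: algebra_simps)
  have e: "contr \<phi> (v @ c # (ws @ [z]) @ map N u) =
      adj2 (\<lambda>x a b y. sg (len x) (\<phi> (x @ (a * b) # y @ c # (ws @ [z]) @ map N u))) v
    + on_last (\<lambda>x a. sg (len x) (\<phi> (x @ (a * c) # (ws @ [z]) @ map N u))) v
    + on_hd (\<lambda>b y. sg (len v) (\<phi> (v @ (c * b) # y @ z # map N u))) ws
    + (if ws = [] then sg (len v) (\<phi> (v @ (c * z) # map N u)) else 0)
    + adj2 (\<lambda>x a b y. sg (len v + 1 + len x) (\<phi> (v @ c # x @ (a * b) # y @ z # map N u))) ws
    + on_last (\<lambda>w y. sg (len v + 1 + len w) (\<phi> (v @ c # w @ (y * z) # map N u))) ws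
    + on_hd (\<lambda>b y. sg (len v + 1 + len ws) (\<phi> (v @ c # ws @ (z * b) # y))) (map N u)
    + adj2 (\<lambda>x a b y. sg (len v + 1 + len (ws @ [z]) + len x) (\<phi> (v @ c # (ws @ [z]) @ x @ (a * b) # y))) (map N u)" for u v
    unfolding contr_middle pcontr_def append_assoc append_Cons append_Nil on_hd_append adj2_middle
    by (simp add: algebra_simps)
  show ?thesis
    unfolding rot_def[of _ "contr \<phi>"] e
    unfolding pcontr_def rot_adj2[OF N] rot_on_last 3 4 5 6 7 sg_add split2_add
    by (simp add: algebra_simps)
qed

section \<open>The operator on cochains of a Frobenius algebra\<close>

lemma contr_ins_cocycle:
  assumes "padd \<Psi>" "homog m g" "hb m g = (\<lambda>_. 0)"
  shows "contr (ins (m - 1) g \<Psi>) xs = sg (m - 1) (ins (m - 1) g (pcontr \<Psi>) xs)"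
  using contr_ins[OF assms(1,2), of xs] padd_zero[OF assms(1)] by (simp add: assms(3) ins_def[of m])

lemma rot_add: "rot N (\<lambda>l. \<phi> l + \<psi> l) us c W = rot N \<phi> us c W + rot N \<psi> us c W"
  and rot_diff: "rot N (\<lambda>l. \<phi> l - \<psi> l) us c W = rot N \<phi> us c W - rot N \<psi> us c W"
  and rot_sg: "rot N (\<lambda>l. sg n (\<phi> l)) us c W = sg n (rot N \<phi> us c W)"
  by (simp_all only: rot_def sg_add sg_diff split2_add split2_diff push_sg add.commute)

lemma rot_homog:
  assumes "homog p \<phi>" "len us + 1 + len W \<noteq> p"
  shows "rot N \<phi> us c W = 0"
proof -
  have "rot N \<phi> us c W = split2 (\<lambda>u v. 0) us"
    unfolding rot_def using assms by (intro split2_cong) (auto simp: homog_def)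
  then show ?thesis by simp
qed

lemma madd_rot:
  assumes "madd \<phi>"
  shows "padd (\<lambda>us c ws. rot N \<phi> us c (F ws))"
    "rot N \<phi> us c (w @ (a + b) # w') = rot N \<phi> us c (w @ a # w') + rot N \<phi> us c (w @ b # w')"
proof -
  show "padd (\<lambda>us c ws. rot N \<phi> us c (F ws))"
    unfolding padd_def rot_def by (simp add: maddD[OF assms] sg_add split2_add)
  have "\<phi> (v @ c # w @ (a + b) # r) = \<phi> (v @ c # w @ a # r) + \<phi> (v @ c # w @ b # r)" for v r
    using maddD[OF assms, of "v @ c # w"] by simp
  then show "rot N \<phi> us c (w @ (a + b) # w') = rot N \<phi> us c (w @ a # w') + rot N \<phi> us c (w @ b # w')"
    by (simp add: rot_def sg_add split2_add)
qed

definition mlin :: "('k::field \<Rightarrow> 'a::ab_group_add \<Rightarrow> 'a) \<Rightarrow> ('k \<Rightarrow> 'b::ab_group_add \<Rightarrow> 'b) \<Rightarrow> ('a list \<Rightarrow> 'b) \<Rightarrow> bool" where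
  "mlin s t f \<longleftrightarrow> madd f \<and> (\<forall>us k a ws. f (us @ s k a # ws) = t k (f (us @ a # ws)))"

lemma mlin_madd: "mlin s t f \<Longrightarrow> madd f"
  by (simp add: mlin_def)

lemma mlin_scale: "mlin s t f \<Longrightarrow> f (us @ s k a # ws) = t k (f (us @ a # ws))"
  by (simp add: mlin_def)

lemma mult_sg_right: "k * sg n x = sg n (k * x :: 'k::field)"
  by (simp add: sg_def)

context frobenius_algebra
begin

abbreviation N :: "'a \<Rightarrow> 'a" where
  "N \<equiv> nakayama form"

lemma form_add_left: "form (a + b) c = form a c + form b c"
  and form_scale_left: "form (k *s a) c = k * form a c"
  using form_linear_left[of c] by (simp_all add: Vector_Spaces.linear_iff)

lemma form_add_right: "form a (b + c) = form a b + form a c"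
  and form_scale_right: "form a (k *s b) = k * form a b"
  using form_linear_right[of a] by (simp_all add: Vector_Spaces.linear_iff)

lemmas form_left = form_add_left additive_zero[of "\<lambda>a. form a c", OF form_add_left]
  additive_sg[of "\<lambda>a. form a c", OF form_add_left] additive_diff[of "\<lambda>a. form a c", OF form_add_left]
  additive_uminus[of "\<lambda>a. form a c", OF form_add_left]
  sums_additive[of "\<lambda>a. form a c", OF form_add_left] for c

lemma form_left_eqI: "(\<And>z. form a z = form b z) \<Longrightarrow> a = b"
  using form_nondegenerate_left[of "a - b"] by (simp add: form_left)

lemma N_add: "N (a + b) = N a + N b"
  and N_scale: "N (k *s a) = k *s N a"
  using nakayama_linear by (simp_all add: Vector_Spaces.linear_iff)

lemma N_zero: "N 0 = 0"
  by (rule additive_zero[OF N_add])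

lemma form_zero_right: "form a 0 = 0"
  by (rule additive_zero[OF form_add_right])

lemma form_N: "form (N a) (N b) = form a b"
  by (metis form_nakayama)

lemma form_mult_left: "form (a * b) z = form a (b * z)"
  by (rule form_assoc)

text \<open>A left factor travels around the form at the price of \<open>N\<close>. This is the
  origin of the twisted rotations.\<close>

lemma form_mult_rotate: "form (a * b) z = form b (z * N a)"
  by (metis form_assoc form_nakayama)

lemma form_mult_one: "form (a * b) 1 = form a b"
  by (simp add: form_assoc)

text \<open>By nondegeneracy \<open>c\<close> is determined by the functional \<open>form c\<close>.
  Encoding a functional by its values on a basis, as coefficients of that same basis, turns this
  into an injective endomorphism \<open>L\<close> of the algebra, which is surjective by finite
  dimension.\<close>

lemma ex_form_repr:
  assumes add: "\<And>x y. \<psi> (x + y) = \<psi> x + \<psi> y" and scl: "\<And>k x. \<psi> (k *s x) = k * \<psi> x"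
  shows "\<exists>c. \<forall>z. form c z = \<psi> z"
proof -
  obtain S where S: "finite S" "span S = UNIV"
    using finite_dim by blast
  obtain B where B: "B \<subseteq> S" "independent B" "S \<subseteq> span B"
    using maximal_independent_subset[of S] by blast
  have spanB: "span B = UNIV"
    using span_minimal[OF B(3) subspace_span] S(2) by blast
  have fB: "finite B" using B(1) S(1) finite_subset by blast
  interpret fd: finite_dimensional_vector_space scale B
    by unfold_locales (use fB B spanB in auto)
  define L where "L = (\<lambda>c. \<Sum>b\<in>B. form c b *s b)"
  have vs: "vector_space scale" by unfold_locales
  have linL: "Vector_Spaces.linear scale scale L"
    unfolding Vector_Spaces.linear_iff L_def
    using vs by (simp add: form_add_left form_scale_left scale_left_distrib sum.distrib scale_sum_right)
  have coeff: "f b = g b" if "(\<Sum>b\<in>B. f b *s b) = (\<Sum>b\<in>B. g b *s b)" "b \<in> B" for f g b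
  proof -
    have "(\<Sum>b\<in>B. (f b - g b) *s b) = 0"
      using that(1) by (simp add: scale_left_diff_distrib sum_subtractf)
    then have "f b - g b = 0"
      using independentD[OF B(2) fB order.refl, of "\<lambda>b. f b - g b"] that(2) by blast
    then show ?thesis by simp
  qed
  have vk: "vector_space ((*) :: 'k \<Rightarrow> 'k \<Rightarrow> 'k)"
    using form_linear_left by (simp add: Vector_Spaces.linear_def vector_space_pair_def)
  have ext: "f = g" if "Vector_Spaces.linear scale (*) f" "Vector_Spaces.linear scale (*) g"
    "\<And>b. b \<in> B \<Longrightarrow> f b = g b" for f g
  proof
    fix x
    interpret p: vector_space_pair scale "(*) :: 'k \<Rightarrow> 'k \<Rightarrow> 'k"
      using that(1) by (simp add: vector_space_pair_def Vector_Spaces.linear_def)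
    show "f x = g x"
      by (rule p.linear_eq_on_span[OF that(1,2), of B]) (simp_all add: that(3) spanB)
  qed
  have "inj L"
  proof (rule injI)
    fix c d assume eq: "L c = L d"
    have "form c = form d"
      by (rule ext[OF form_linear_right form_linear_right]) (use coeff eq in \<open>auto simp: L_def\<close>)
    then show "c = d"
      by (intro form_left_eqI) simp
  qed
  then have "surj L"
    using fd.linear_inj_imp_surj[OF linL] by simp
  then obtain c where c: "(\<Sum>b\<in>B. \<psi> b *s b) = L c"
    by (metis surjD)
  have "Vector_Spaces.linear scale (*) \<psi>"
    using vs vk add scl by (simp add: Vector_Spaces.linear_iff)
  then have "\<psi> = form c"
    by (rule ext[OF _ form_linear_right]) (use coeff c in \<open>auto simp: L_def\<close>)
  then show ?thesis by metis
qed

definition repr :: "('a \<Rightarrow> 'k) \<Rightarrow> 'a" where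
  "repr \<psi> = (THE c. \<forall>z. form c z = \<psi> z)"

lemma repr_eqI: "(\<And>z. form c z = \<psi> z) \<Longrightarrow> repr \<psi> = c"
  unfolding repr_def by (rule the_equality) (auto intro: form_left_eqI)

lemma form_repr:
  assumes "\<And>x y. \<psi> (x + y) = \<psi> x + \<psi> y" and "\<And>k x. \<psi> (k *s x) = k * \<psi> x"
  shows "form (repr \<psi>) z = \<psi> z"
  using ex_form_repr[of \<psi>, OF assms] repr_eqI by metis

definition Delta :: "('a list \<Rightarrow> 'a) \<Rightarrow> 'a list \<Rightarrow> 'a" where
  "Delta f xs = repr (\<lambda>z. rot N (\<lambda>l. form (f l) 1) xs z [])"

text \<open>The word is rotated only as far as the value of \<open>g\<close>, so that this value
  stays in front of \<open>z\<close> and the block between them stays intact. Both ends of this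
  restricted sum matter: they give \<open>cross\<close> and \<open>circ\<close> in
  \<open>form_hb_cartan\<close>.\<close>

definition cartan :: "int \<Rightarrow> ('a list \<Rightarrow> 'a) \<Rightarrow> ('a list \<Rightarrow> 'a) \<Rightarrow> 'a list \<Rightarrow> 'a" where
  "cartan d f g xs = repr (\<lambda>z. ins d g (\<lambda>us c ws. rot N (\<lambda>l. form (f l) 1) us c (ws @ [z])) xs)"

lemma mlin_form: "mlin scale scale f \<Longrightarrow> mlin scale (*) (\<lambda>l. form (f l) z)"
  by (simp add: mlin_def madd_def form_add_left form_scale_left)

lemma mlin_rot:
  assumes "mlin scale (*) \<phi>"
  shows "rot N \<phi> us (k *s c) W = k * rot N \<phi> us c W"
    "rot N \<phi> us c (w @ (k *s a) # w') = k * rot N \<phi> us c (w @ a # w')"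
proof -
  have d: "k * (x + y) = k * x + k * y" for x y :: 'k by (rule distrib_left)
  show "rot N \<phi> us (k *s c) W = k * rot N \<phi> us c W"
    unfolding rot_def sums_additive(1)[of "\<lambda>x. k * x", OF d] by (simp add: mlin_scale[OF assms] mult_sg_right)
  have "\<phi> (v @ c # w @ (k *s a) # r) = k * \<phi> (v @ c # w @ a # r)" for v r
    using mlin_scale[OF assms, of "v @ c # w"] by simp
  then show "rot N \<phi> us c (w @ (k *s a) # w') = k * rot N \<phi> us c (w @ a # w')"
    unfolding rot_def sums_additive(1)[of "\<lambda>x. k * x", OF d] by (simp add: mult_sg_right)
qed

lemma form_Delta:
  assumes "mlin scale scale f"
  shows "form (Delta f xs) z = rot N (\<lambda>l. form (f l) 1) xs z []"
proof -
  note \<phi> = mlin_form[OF assms, of 1]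
  show ?thesis
    unfolding Delta_def
    by (rule form_repr) (use paddD[OF madd_rot(1)[OF mlin_madd[OF \<phi>], of _ "\<lambda>_. []"]] mlin_rot(1)[OF \<phi>] in auto)
qed

lemma form_cartan:
  assumes "mlin scale scale f"
  shows "form (cartan d f g xs) z = ins d g (\<lambda>us c ws. rot N (\<lambda>l. form (f l) 1) us c (ws @ [z])) xs"
proof -
  note \<phi> = mlin_form[OF assms, of 1]
  have d: "k * (x + y) = k * x + k * y" for k x y :: 'k by (rule distrib_left)
  show ?thesis
    unfolding cartan_def
    by (rule form_repr)
      (simp_all add: ins_def madd_rot(2)[OF mlin_madd[OF \<phi>]] mlin_rot(2)[OF \<phi>] sg_add split3_add
        sums_additive(2)[of "\<lambda>x. k * x" for k, OF d] mult_sg_right)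
qed

lemma form_contr: "form (contr f xs) z = contr (\<lambda>l. form (f l) z) xs"
  by (simp add: contr_def form_left)

lemma form_lmul: "form (lmul f xs) z = on_hd (\<lambda>a x. form (f x) (z * N a)) xs"
  by (simp add: lmul_def form_left form_mult_rotate)

lemma form_rmul: "form (rmul f xs) z = on_last (\<lambda>x a. form (f x) (a * z)) xs"
  by (simp add: rmul_def form_left form_mult_left)

lemma form_hb:
  "form (hb r f xs) z = on_last (\<lambda>x a. form (f x) (a * z)) xs
     + sg (r + 1) (on_hd (\<lambda>a x. form (f x) (z * N a)) xs - contr (\<lambda>l. form (f l) z) xs)"
  by (simp add: hb_eq form_left form_lmul form_rmul form_contr)

text \<open>Both sums run over the rotations of one word, and the end of each rotation is the beginning of the
  next one: the sum telescopes.\<close>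

lemma rot_lmul_rmul:
  assumes "homog p f"
  shows "rot N (\<lambda>l. form (lmul f l) 1) us c W + sg (p + 1) (rot N (\<lambda>l. form (rmul f l) 1) us c W)
    = sg (len us * (1 + len W)) (form (f (W @ map N us)) (N c)) + sg (p + 1) (form (rmul f (us @ c # W)) 1)"
proof -
  define I1 where "I1 = split2 (\<lambda>u v. on_hd (\<lambda>a z. sg (len u * (len z + 2 + len W)) (form (f (z @ c # W @ map N u)) (N a))) v) us"
  define I2 where "I2 = split2 (\<lambda>u v. on_last (\<lambda>x a. sg ((len x + 1) * (len v + 1 + len W)) (form (f (v @ c # W @ map N x)) (N a))) u) us"
  have "I1 = split2 (\<lambda>u v. sg (len u * (len v + 1 + len W)) (on_hd (\<lambda>a z. form (f (z @ c # W @ map N u)) (N a)) v)) us"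
    unfolding I1_def sums_sg[symmetric] by (intro split2_cong on_hd_cong sg_cong) auto
  moreover have "sg (len us * (1 + len W)) (form (f (W @ map N us)) (N c))
    = split2 (\<lambda>u v. sg (len u * (len v + 1 + len W)) (if v = [] then form (f (W @ map N u)) (N c) else 0)) us"
    unfolding split2_sg_unit_right by simp
  ultimately have E: "rot N (\<lambda>l. form (lmul f l) 1) us c W = I1 + sg (len us * (1 + len W)) (form (f (W @ map N us)) (N c))"
    unfolding rot_def form_lmul on_hd_append sg_add split2_add mult_1_left by simp
  have r: "form (rmul f (v @ c # W @ map N u)) 1 = (if u = [] then form (rmul f (v @ c # W)) 1 else 0)
      + on_last (\<lambda>x a. form (f (v @ c # W @ map N x)) (N a)) u" for u v :: "'a list"
    unfolding form_rmul by (cases u rule: rev_cases) (simp_all add: on_last_def butlast_append)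
  have "I2 = split2 (\<lambda>u v. sg (len u * (len v + 1 + len W)) (on_last (\<lambda>x a. form (f (v @ c # W @ map N x)) (N a)) u)) us"
    unfolding I2_def sums_sg[symmetric] by (intro split2_cong on_last_cong sg_cong) auto
  moreover have "split2 (\<lambda>u v. sg (len u * (len v + 1 + len W)) (if u = [] then form (rmul f (v @ c # W)) 1 else 0)) us
      = split2 (\<lambda>u v. if u = [] then form (rmul f (v @ c # W)) 1 else 0) us"
    by (intro split2_cong) simp
  ultimately have R: "rot N (\<lambda>l. form (rmul f l) 1) us c W = form (rmul f (us @ c # W)) 1 + I2"
    unfolding rot_def r sg_add split2_add split2_unit_left by simp
  have "sg (len u * (len v + 2 + len W)) (form (f (v @ c # W @ map N u)) (N a))
     = sg (p + (len u + 1) * (len v + 1 + len W)) (form (f (v @ c # W @ map N u)) (N a))" for u v a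
  proof (cases "len (v @ c # W @ map N u) = p")
    case True
    then show ?thesis by (intro sg_cong) (auto simp: algebra_simps)
  next
    case False
    then have "f (v @ c # W @ map N u) = 0" using assms by (simp add: homog_def)
    then show ?thesis by (simp add: form_left)
  qed
  then have "I1 = sg p I2"
    unfolding I1_def I2_def split2_on_last_left push_sg by simp
  then show ?thesis unfolding E R by (simp add: sg_def)
qed

definition twist :: "('a list \<Rightarrow> 'a) \<Rightarrow> 'a list \<Rightarrow> 'a" where
  "twist f xs = inv_into UNIV N (f (map N xs))"

lemma form_twist: "form (twist f xs) z = form (f (map N xs)) (N z)"
  using form_N[of "inv_into UNIV N (f (map N xs))" z] bij_inv_eq_iff[OF nakayama_bij] by (simp add: twist_def)
    (metis nakayama_bij bij_inv_eq_iff)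

lemma form_one_hb: "form (hb p f l) 1 = form (rmul f l) 1 + sg (p + 1) (form (lmul f l) 1 - contr (\<lambda>l. form (f l) 1) l)"
  by (simp add: hb_eq form_left form_contr)

text \<open>The outer terms of \<open>hb p f\<close> telescope over the rotations and leave the
  unrotated word, that is \<open>f\<close>, and the fully rotated one, that is
  \<open>twist f\<close>. The inner terms make up the differential of \<open>Delta f\<close> by
  \<open>rot_contr_nil\<close>.\<close>

theorem Delta_hb:
  assumes f: "mlin scale scale f" "homog p f"
  shows "Delta (hb p f) xs = f xs - twist f xs - hb (p - 1) (Delta f) xs"
  unfolding Delta_def[of "hb p f"]
proof (rule repr_eqI)
  fix z
  let ?\<phi> = "\<lambda>l. form (f l) 1"
  have hom\<phi>: "homog p ?\<phi>" using f(2) by (simp add: homog_def form_left)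
  have s: "sg (len x) (rot N ?\<phi> x c []) = sg (p - 1) (rot N ?\<phi> x c [])" for x c
    by (cases "len x + 1 = p") (auto simp: rot_homog[OF hom\<phi>] intro: sg_cong)
  have c: "rot N (contr ?\<phi>) xs z [] = contr (\<lambda>us. form (Delta f us) z) xs
    + sg (p - 1) (on_last (\<lambda>x a. form (Delta f x) (a * z)) xs) - on_hd (\<lambda>y us. form (Delta f us) (z * N y)) xs"
    unfolding rot_contr_nil[of N, OF nakayama_mult] s sums_sg form_Delta[OF f(1)] ..
  have "rot N (\<lambda>l. form (hb p f l) 1) xs z [] = sg (p + 1) (rot N (\<lambda>l. form (lmul f l) 1) xs z [] + sg (p + 1) (rot N (\<lambda>l. form (rmul f l) 1) xs z []))
     - sg (p + 1) (rot N (contr ?\<phi>) xs z [])"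
    unfolding form_one_hb rot_add rot_sg rot_diff by (simp add: sg_def)
  also have "\<dots> = sg (p + 1 + len xs) (form (twist f xs) z) + form (f xs) z - sg (p + 1) (rot N (contr ?\<phi>) xs z [])"
  proof -
    have "form (rmul f (xs @ [z])) 1 = form (f xs) z"
      unfolding form_rmul on_last_simps(2) by simp
    then show ?thesis
      unfolding rot_lmul_rmul[OF f(2)] form_twist by (simp add: sg_def)
  qed
  also have "sg (p + 1 + len xs) (form (twist f xs) z) = - form (twist f xs) z"
    unfolding form_twist using f(2) by (cases "len xs = p") (auto simp: sg_def homog_def form_left)
  finally show "form (f xs - twist f xs - hb (p - 1) (Delta f) xs) z = rot N (\<lambda>l. form (hb p f l) 1) xs z []"
    unfolding c form_left form_hb by (simp add: sg_def)
qed

text \<open>The part of \<open>\<Delta> (f \<cdot> g)\<close> in which \<open>f\<close> contains the last argument.\<close>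

definition cross :: "int \<Rightarrow> ('a list \<Rightarrow> 'a) \<Rightarrow> ('a list \<Rightarrow> 'a) \<Rightarrow> 'a list \<Rightarrow> 'a \<Rightarrow> 'k" where
  "cross d f g xs z = split3 (\<lambda>u v w. sg (d * len u + len u * len w) (form (f (w @ z # map N u)) (N (g v)))) xs"

text \<open>The cocycle condition on \<open>f\<close> turns the contractions into telescoping sums
  with end terms \<open>T1\<close> and \<open>T2\<close>; inserting \<open>g\<close> gives
  \<open>cross\<close> and \<open>circ\<close>. Among the boundary terms of
  \<open>rot_contr_snoc\<close>, \<open>E1\<close> multiplies the value of \<open>g\<close> by
  \<open>z\<close> and gives \<open>conv (Delta f) g\<close>, whereas \<open>E2\<close> and
  \<open>E3\<close> are the outer terms of the differential of \<open>cartan\<close>.\<close>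

theorem form_hb_cartan:
  assumes f: "mlin scale scale f" "homog p f" "hb p f = (\<lambda>_. 0)" and g: "homog q g" "hb q g = (\<lambda>_. 0)"
  shows "form (hb (p + q - 2) (cartan (q - 1) f g) xs) z = - sg p (cross (q - 1) f g xs z
     - sg p (form (circ (q - 1) f g xs) z) - sg (q * (p - 1)) (form (conv (Delta f) g xs) z))"
proof -
  define d where "d = q - 1"
  let ?\<phi> = "\<lambda>l. form (f l) 1"
  define \<Psi> where "\<Psi> = (\<lambda>z us c ws. rot N ?\<phi> us c (ws @ [z]))"
  have hom\<phi>: "homog p ?\<phi>" using f(2) by (simp add: homog_def form_left)
  have \<phi>: "madd ?\<phi>" using mlin_madd[OF mlin_form[OF f(1)]] .
  have P: "padd (\<Psi> z)" for z
    unfolding \<Psi>_def by (rule madd_rot(1)[OF \<phi>])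
  have H: "form (cartan d f g xs) z = ins d g (\<Psi> z) xs" for xs z
    unfolding \<Psi>_def form_cartan[OF f(1)] ..
  have cf: "contr f = (\<lambda>xs. lmul f xs + sg (p + 1) (rmul f xs))"
    using contr_eq[of p f] f(3) by (simp add: fun_eq_iff)
  have c\<phi>: "contr ?\<phi> = (\<lambda>l. form (lmul f l) 1 + sg (p + 1) (form (rmul f l) 1))"
    unfolding form_contr[symmetric] cf form_left ..
  \<comment> \<open>Only the rotation that moves all of \<open>us\<close> and the one that moves
    none of it survive the telescope.\<close>
  have T: "rot N (contr ?\<phi>) us c (ws @ [z]) = sg (len us * len ws) (form (f (ws @ z # map N us)) (N c)) + sg (p + 1) (form (f (us @ c # ws)) z)" for us c ws
  proof -
    have "rot N (contr ?\<phi>) us c (ws @ [z]) = sg (len us * (1 + len (ws @ [z]))) (form (f ((ws @ [z]) @ map N us)) (N c)) + sg (p + 1) (form (rmul f (us @ c # ws @ [z])) 1)"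
      unfolding c\<phi> rot_add rot_sg rot_lmul_rmul[OF f(2)] ..
    also have "form (rmul f (us @ c # ws @ [z])) 1 = form (f (us @ c # ws)) z"
      unfolding form_rmul using on_last_simps(2)[of "\<lambda>x a. form (f x) (a * 1)" "us @ c # ws" z] by simp
    also have "sg (len us * (1 + len (ws @ [z]))) (form (f ((ws @ [z]) @ map N us)) (N c)) = sg (len us * len ws) (form (f (ws @ z # map N us)) (N c))"
      by (rule sg_cong) auto
    finally show ?thesis .
  qed
  define E1 E2 E3 where "E1 = (\<lambda>(us::'a list) c (ws::'a list). if ws = [] then sg (len us) (rot N ?\<phi> us (c * z) []) else (0::'k))"
    and "E2 = (\<lambda>(us::'a list) c (ws::'a list). on_last (\<lambda>w y. sg (len us + len ws) (\<Psi> (y * z) us c w)) ws)"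
    and "E3 = (\<lambda>(us::'a list) c (ws::'a list). on_hd (\<lambda>y us. \<Psi> (z * N y) us c ws) us)"
  define T1 T2 where "T1 = (\<lambda>(us::'a list) c (ws::'a list). sg (len us * len ws) (form (f (ws @ z # map N us)) (N c)))"
    and "T2 = (\<lambda>(us::'a list) c (ws::'a list). form (f (us @ c # ws)) z)"
  have "pcontr (\<Psi> z) us c ws = T1 us c ws + sg (p + 1) (T2 us c ws) - E1 us c ws - E2 us c ws + E3 us c ws" for us c ws
    using rot_contr_snoc[of N ?\<phi> us c ws z, OF nakayama_mult, unfolded T]
    unfolding E1_def E2_def E3_def T1_def T2_def \<Psi>_def by (simp add: algebra_simps)
  then have pc: "pcontr (\<Psi> z) = (\<lambda>us c ws. T1 us c ws + sg (p + 1) (T2 us c ws) - E1 us c ws - E2 us c ws + E3 us c ws)"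
    by blast
  have T1: "ins d g T1 xs = cross d f g xs z"
    unfolding ins_def T1_def cross_def sg_sg ..
  have T2: "ins d g T2 xs = form (circ d f g xs) z"
    unfolding ins_def T2_def circ_def form_left ..
  have E1: "ins d g E1 xs = sg (q * (p - 1)) (form (conv (Delta f) g xs) z)"
  proof -
    have s: "sg (d * len u + len u) (rot N ?\<phi> u c []) = sg (q * (p - 1)) (rot N ?\<phi> u c [])" for u c
    proof (cases "len u = p - 1")
      case True
      then show ?thesis by (intro sg_cong) (auto simp: d_def algebra_simps)
    qed (simp add: rot_homog[OF hom\<phi>])
    have "ins d g E1 xs = split3 (\<lambda>u v w. if w = [] then sg (q * (p - 1)) (rot N ?\<phi> u (g v * z) []) else 0) xs"
      unfolding ins_def E1_def by (intro split3_cong) (simp add: s)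
    then show ?thesis
      unfolding split3_unit_right conv_def form_left form_mult_left form_Delta[OF f(1)] sums_sg .
  qed
  have E2: "ins d g E2 xs = sg (p - 1) (on_last (\<lambda>x a. form (cartan d f g x) (a * z)) xs)"
  proof -
    have s: "sg (len us + len w + 1) (\<Psi> a us c w) = sg (p - 1) (\<Psi> a us c w)" for a us c w
    proof (cases "len us + 1 + len (w @ [a]) = p")
      case True
      then show ?thesis by (intro sg_cong) auto
    qed (simp add: \<Psi>_def rot_homog[OF hom\<phi>])
    have e: "E2 us c ws = on_last (\<lambda>w y. sg (len us + len w + 1) (\<Psi> (y * z) us c w)) ws" for us c ws
      unfolding E2_def by (intro on_last_cong sg_cong) auto
    show ?thesis
      unfolding H ins_def e s push_sg split3_on_last_right
      by (intro on_last_cong split3_cong sg_cong) auto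
  qed
  have E3: "ins d g E3 xs = sg d (on_hd (\<lambda>a x. form (cartan d f g x) (z * N a)) xs)"
  proof -
    have "ins d g E3 xs = split3 (\<lambda>u v w. on_hd (\<lambda>y u. sg (d + d * len u) (\<Psi> (z * N y) u (g v) w)) u) xs"
      unfolding ins_def E3_def sums_sg[symmetric]
      by (intro split3_cong on_hd_cong sg_cong) (auto simp: algebra_simps)
    then show ?thesis unfolding split3_on_hd_left H ins_def push_sg .
  qed
  have c: "contr (\<lambda>l. form (cartan d f g l) z) xs = sg d (cross d f g xs z + sg (p + 1) (form (circ d f g xs) z)
     - sg (q * (p - 1)) (form (conv (Delta f) g xs) z) - sg (p - 1) (on_last (\<lambda>x a. form (cartan d f g x) (a * z)) xs)
     + sg d (on_hd (\<lambda>a x. form (cartan d f g x) (z * N a)) xs))"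
    unfolding H contr_ins_cocycle[OF P g, folded d_def] pc ins_add ins_diff ins_sg T1 T2
    unfolding E1 E2 E3 H ..
  show ?thesis
    unfolding d_def[symmetric] form_hb c unfolding d_def by (simp add: sg_def)
qed

text \<open>The cut between the arguments of \<open>f\<close> and \<open>g\<close> falls before or
  after \<open>z\<close>. If it falls before, \<open>g\<close> contains \<open>z\<close>, and
  \<open>form_nakayama\<close> exchanges the two factors. If it falls after, \<open>g\<close> sees
  only rotated letters, and its invariance pulls \<open>N\<close> out.\<close>

lemma rot_conv:
  assumes f: "homog p f" and g: "homog q g" "\<And>xs. g (map N xs) = N (g xs)"
  shows "rot N (\<lambda>l. form (conv f g l) 1) xs z [] = sg (p * q) (cross (q - 1) f g xs z) + cross (p - 1) g f xs z"
proof -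
  have a: "sg (len u * (len (s @ t) + 1)) (form (f s) (g (t @ z # map N u)))
     = sg ((p - 1) * len u + len u * len t) (form (g (t @ z # map N u)) (N (f s)))" for u s t
  proof (cases "len s = p")
    case True
    then show ?thesis unfolding form_nakayama[of "f s"] by (intro sg_cong) (auto simp: algebra_simps)
  next
    case False
    then have "f s = 0" using f by (simp add: homog_def)
    then show ?thesis by (simp add: N_zero form_zero_right form_left)
  qed
  have b: "sg (len (s @ t) * (len v + 1)) (form (f (v @ z # map N s)) (g (map N t)))
     = sg (p * q + ((q - 1) * len s + len s * len v)) (form (f (v @ z # map N s)) (N (g t)))" for s t v
  proof (cases "len (v @ z # map N s) = p")
    case True
    show ?thesis
    proof (cases "len t = q")
      case t: True
      show ?thesis unfolding g(2) by (intro sg_cong) (simp_all add: True[symmetric] t[symmetric] algebra_simps)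
    next
      case False
      then have "g t = 0" using g by (simp add: homog_def)
      then show ?thesis unfolding g(2) by (simp add: N_zero form_zero_right)
    qed
  next
    case False
    then have "f (v @ z # map N s) = 0" using f by (simp add: homog_def)
    then show ?thesis by (simp add: form_left)
  qed
  have "rot N (\<lambda>l. form (conv f g l) 1) xs z [] =
     split2 (\<lambda>u v. split2 (\<lambda>s t. sg (len u * (len v + 1)) (form (f s) (g (t @ z # map N u)))) v
       + split2 (\<lambda>s t. sg (len u * (len v + 1)) (form (f (v @ z # map N s)) (g (map N t)))) u) xs"
    unfolding rot_def conv_def form_left split2_middle form_mult_one append_Nil split2_map sg_add sums_sg by simp
  also have "\<dots> = split2 (\<lambda>u v. split2 (\<lambda>s t. sg (len u * (len (s @ t) + 1)) (form (f s) (g (t @ z # map N u)))) v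
       + split2 (\<lambda>s t. sg (len (s @ t) * (len v + 1)) (form (f (v @ z # map N s)) (g (map N t)))) u) xs"
    by (intro split2_cong arg_cong2[where f = "(+)"] sg_cong) auto
  also have "\<dots> = sg (p * q) (cross (q - 1) f g xs z) + cross (p - 1) g f xs z"
    unfolding a b split2_add cross_def split3_def split2_assoc push_sg by (rule add.commute)
  finally show ?thesis .
qed

theorem Delta_conv:
  assumes f: "mlin scale scale f" "homog p f" "hb p f = (\<lambda>_. 0)" "\<And>xs. f (map N xs) = N (f xs)"
    and g: "mlin scale scale g" "homog q g" "hb q g = (\<lambda>_. 0)" "\<And>xs. g (map N xs) = N (g xs)"
  shows "Delta (conv f g) xs =
    sg (p * q) (sg p (circ (q - 1) f g xs) + sg (q * (p - 1)) (conv (Delta f) g xs) - sg p (hb (p + q - 2) (cartan (q - 1) f g) xs))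
    + (sg q (circ (p - 1) g f xs) + sg (p * (q - 1)) (conv (Delta g) f xs) - sg q (hb (p + q - 2) (cartan (p - 1) g f) xs))"
  unfolding Delta_def[of "conv f g"]
proof (rule repr_eqI)
  fix z
  have 1: "cross (q - 1) f g xs z = sg p (form (circ (q - 1) f g xs) z) + sg (q * (p - 1)) (form (conv (Delta f) g xs) z) - sg p (form (hb (p + q - 2) (cartan (q - 1) f g) xs) z)"
    unfolding form_hb_cartan[OF f(1-3) g(2,3)] by (simp add: sg_def)
  have 2: "cross (p - 1) g f xs z = sg q (form (circ (p - 1) g f xs) z) + sg (p * (q - 1)) (form (conv (Delta g) f xs) z) - sg q (form (hb (p + q - 2) (cartan (p - 1) g f) xs) z)"
    unfolding add.commute[of p q] form_hb_cartan[OF g(1-3) f(2,3)] by (simp add: sg_def)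
  show "form (sg (p * q) (sg p (circ (q - 1) f g xs) + sg (q * (p - 1)) (conv (Delta f) g xs) - sg p (hb (p + q - 2) (cartan (q - 1) f g) xs))
    + (sg q (circ (p - 1) g f xs) + sg (p * (q - 1)) (conv (Delta g) f xs) - sg q (hb (p + q - 2) (cartan (p - 1) g f) xs))) z
    = rot N (\<lambda>l. form (conv f g l) 1) xs z []"
    unfolding rot_conv[OF f(2) g(2,4)] 1 2 form_left ..
qed

end

section \<open>Semisimplicity and multilinear forms\<close>

text \<open>The value of the scalar extension of \<open>\<phi>\<close> at vectors given by their coordinates.\<close>

fun ac_ext :: "'a list \<Rightarrow> ('a list \<Rightarrow> 'k::field) \<Rightarrow> (nat \<Rightarrow> 'k alg_closure) list \<Rightarrow> 'k alg_closure" where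
  "ac_ext bs \<phi> [] = to_ac (\<phi> [])"
| "ac_ext bs \<phi> (v # vs) = (\<Sum>i<length bs. v i * ac_ext bs (\<lambda>l. \<phi> (bs ! i # l)) vs)"

lemma ac_ext_diff: "ac_ext bs (\<lambda>l. \<phi> l - \<psi> l) vs = ac_ext bs \<phi> vs - ac_ext bs \<psi> vs"
  by (induction vs arbitrary: \<phi> \<psi>) (simp_all add: sum_subtractf right_diff_distrib)

lemma ac_ext_sum: "ac_ext bs (\<lambda>l. \<Sum>i\<in>I. c i * \<phi> i l) vs = (\<Sum>i\<in>I. to_ac (c i) * ac_ext bs (\<phi> i) vs)"
proof (induction vs arbitrary: \<phi>)
  case Nil
  then show ?case by (simp add: to_ac_sum)
next
  case (Cons v vs)
  have "ac_ext bs (\<lambda>l. \<Sum>i\<in>I. c i * \<phi> i l) (v # vs)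
     = (\<Sum>j<length bs. \<Sum>i\<in>I. v j * (to_ac (c i) * ac_ext bs (\<lambda>l. \<phi> i (bs ! j # l)) vs))"
    by (simp add: Cons[of "\<lambda>i l. \<phi> i (bs ! j # l)" for j] sum_distrib_left)
  also have "\<dots> = (\<Sum>i\<in>I. to_ac (c i) * ac_ext bs (\<phi> i) (v # vs))"
    by (subst sum.swap) (simp add: sum_distrib_left mult.left_commute)
  finally show ?case .
qed

lemma sum_mult_delta:
  fixes f :: "nat \<Rightarrow> 'c::semiring_0"
  assumes "j < n"
  shows "(\<Sum>k<n. f k * (if k = j then c else 0)) = f j * c"
proof -
  have "(\<Sum>k<n. f k * (if k = j then c else 0)) = (\<Sum>k<n. if k = j then f j * c else 0)"
    by (rule sum.cong) auto
  then show ?thesis using assms by simp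
qed

lemma mlin_Cons: "mlin s t \<phi> \<Longrightarrow> mlin s t (\<lambda>l. \<phi> (x # l))"
  unfolding mlin_def madd_def by (metis append_Cons)

context k_algebra
begin

lemma mlin_Cons_sum:
  assumes "mlin scale (*) \<phi>"
  shows "\<phi> ((\<Sum>i\<in>I. c i *s b i) # l) = (\<Sum>i\<in>I. c i * \<phi> (b i # l))"
proof -
  have add: "\<phi> ((x + y) # l) = \<phi> (x # l) + \<phi> (y # l)" for x y
    using maddD[OF mlin_madd[OF assms], of "[]"] by simp
  have scl: "\<phi> ((k *s x) # l) = k * \<phi> (x # l)" for k x
    using mlin_scale[OF assms, of "[]"] by simp
  have "\<phi> (0 # l) = 0" using scl[of 0 0] by simp
  then show ?thesis
    by (induction I rule: infinite_finite_induct) (simp_all add: add scl)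
qed

lemma mlin_map:
  assumes "mlin scale t \<phi>" "\<And>a b. T (a + b) = T a + T b" "\<And>k a. T (k *s a) = k *s T a"
  shows "mlin scale t (\<lambda>l. \<phi> (map T l))"
  using assms unfolding mlin_def madd_def by simp

text \<open>Over the algebraic closure \<open>T\<close> acts on the multilinear forms diagonally: evaluate at eigenvectors.\<close>

lemma semisimple_fixed:
  assumes T: "semisimple_endo scale T" and \<phi>: "mlin scale (*) \<phi>"
    and fixed: "\<And>xs. \<phi> (map T (map T xs)) - \<phi> (map T xs) = \<phi> (map T xs) - \<phi> xs"
  shows "\<phi> (map T xs) = \<phi> xs"
proof -
  have Tadd: "T (a + b) = T a + T b" and Tscale: "T (k *s a) = k *s T a" for a b k
    using T by (simp_all add: semisimple_endo_def Vector_Spaces.linear_iff)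
  obtain bs D where bs: "distinct bs" "independent (set bs)" "span (set bs) = UNIV"
    and D: "diagonal_mat D" and sim: "similar_mat (map_mat to_ac (endo_matrix scale bs T)) D"
    using T unfolding semisimple_endo_def by blast
  define n where "n = length bs"
  define M where "M i j = representation (set bs) (T (bs ! j)) (bs ! i)" for i j
  obtain P Q where wit: "similar_mat_wit (map_mat to_ac (endo_matrix scale bs T)) D P Q"
    using sim unfolding similar_mat_def by blast
  have A: "map_mat to_ac (endo_matrix scale bs T) \<in> carrier_mat n n"
    by (simp add: endo_matrix_def n_def)
  note w = similar_mat_witD2[OF A wit]
  have Dd: "D $$ (i, j) = (if i = j then D $$ (j, j) else 0)" if "i < n" "j < n" for i j
    using D w(5) that by (auto simp: diagonal_mat_def)
  \<comment> \<open>Equivalently, column \<open>j\<close> of \<open>P\<close> is an eigenvector with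
    eigenvalue \<open>D $$ (j, j)\<close>.\<close>
  have AP: "map_mat to_ac (endo_matrix scale bs T) * P = P * D"
  proof -
    have "P * D * Q * P = P * D * (Q * P)"
      by (rule assoc_mult_mat[of _ n n _ n _ n]) (use w in auto)
    also have "\<dots> = P * D"
      unfolding w(2) by (rule right_mult_one_mat[of _ n n]) (use w in auto)
    finally show ?thesis unfolding w(3) .
  qed
  have dims: "dim_row P = n" "dim_col P = n" "dim_row D = n" "dim_col D = n" "dim_row Q = n" "dim_col Q = n"
    using w by auto
  have eig: "(\<Sum>k<n. to_ac (M i k) * P $$ (k, j)) = P $$ (i, j) * D $$ (j, j)" if "i < n" "j < n" for i j
  proof -
    have e1: "(map_mat to_ac (endo_matrix scale bs T) * P) $$ (i, j) = (\<Sum>k<n. to_ac (M i k) * P $$ (k, j))"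
      using that dims by (simp add: scalar_prod_def endo_matrix_def n_def[symmetric] M_def atLeast0LessThan)
    have e2: "(P * D) $$ (i, j) = (\<Sum>k<n. P $$ (i, k) * (if k = j then D $$ (j, j) else 0))"
    proof -
      have "(P * D) $$ (i, j) = (\<Sum>k<n. P $$ (i, k) * D $$ (k, j))"
        using that dims by (simp add: scalar_prod_def atLeast0LessThan)
      also have "\<dots> = (\<Sum>k<n. P $$ (i, k) * (if k = j then D $$ (j, j) else 0))"
        by (rule sum.cong[OF refl], subst Dd) (use that in auto)
      finally show ?thesis .
    qed
    have e3: "(\<Sum>k<n. P $$ (i, k) * (if k = j then D $$ (j, j) else 0)) = P $$ (i, j) * D $$ (j, j)"
      by (rule sum_mult_delta[OF that(2)])
    show ?thesis
      by (rule trans[OF e1[symmetric, unfolded AP] trans[OF e2 e3]])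
  qed
  have PQ: "(\<Sum>k<n. P $$ (i, k) * Q $$ (k, j)) = (if i = j then 1 else 0)" if "i < n" "j < n" for i j
  proof -
    have 1: "(P * Q) $$ (i, j) = row P i \<bullet> col Q j"
      by (rule index_mult_mat) (simp_all only: dims that)
    have 2: "row P i \<bullet> col Q j = (\<Sum>k<n. P $$ (i, k) * Q $$ (k, j))"
      unfolding scalar_prod_def dim_col dims atLeast0LessThan
      by (rule sum.cong[OF refl]) (simp only: index_row index_col lessThan_iff dims that)
    show ?thesis using 1 unfolding 2 w(1) index_one_mat(1)[OF that] by (rule sym)
  qed
  have rep: "x = (\<Sum>i<n. representation (set bs) x (bs ! i) *s bs ! i)" for x
  proof -
    have "x = (\<Sum>b\<in>set bs. representation (set bs) x b *s b)"
      using sum_representation_eq[OF bs(2), of x "set bs"] bs(3) by simp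
    also have "\<dots> = (\<Sum>i<n. representation (set bs) x (bs ! i) *s bs ! i)"
      using sum.reindex_bij_betw[OF bij_betw_nth[OF bs(1) refl refl], of "\<lambda>b. representation (set bs) x b *s b"]
      by (simp add: n_def)
    finally show ?thesis .
  qed
  define p where "p j = (\<lambda>i. P $$ (i, j))" for j
  have p_app: "p j i = P $$ (i, j)" for i j by (simp add: p_def)
  define ev where "ev J = prod_list (map (\<lambda>j. D $$ (j, j)) J)" for J
  have T_ext: "ac_ext bs (\<lambda>l. \<phi> (map T l)) (map p J) = ev J * ac_ext bs \<phi> (map p J)"
    if "mlin scale (*) \<phi>" "set J \<subseteq> {..<n}" for \<phi> J
    using that
  proof (induction J arbitrary: \<phi>)
    case (Cons j J)
    have step: "(\<lambda>l. \<phi> (T (bs ! k) # map T l)) = (\<lambda>l. \<Sum>i<n. M i k * \<phi> (bs ! i # map T l))" for k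
      using mlin_Cons_sum[OF Cons.prems(1), of "\<lambda>i. M i k" "\<lambda>i. bs ! i" "{..<n}", folded rep[of "T (bs ! k)", folded M_def]]
      by (simp only:)
    have "ac_ext bs (\<lambda>l. \<phi> (map T l)) (map p (j # J))
        = (\<Sum>k<n. p j k * (\<Sum>i<n. to_ac (M i k) * ac_ext bs (\<lambda>l. \<phi> (bs ! i # map T l)) (map p J)))"
      using ac_ext_sum[of bs "\<lambda>i. M i k" "\<lambda>i l. \<phi> (bs ! i # map T l)" "{..<n}" "map p J" for k]
      by (simp add: step n_def[symmetric])
    also have "\<dots> = (\<Sum>k<n. \<Sum>i<n. p j k * (to_ac (M i k) * (ev J * ac_ext bs (\<lambda>l. \<phi> (bs ! i # l)) (map p J))))"
      using Cons.IH[OF mlin_Cons[OF Cons.prems(1)]] Cons.prems(2) by (simp add: sum_distrib_left)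
    also have "\<dots> = (\<Sum>i<n. (\<Sum>k<n. to_ac (M i k) * P $$ (k, j)) * (ev J * ac_ext bs (\<lambda>l. \<phi> (bs ! i # l)) (map p J)))"
      unfolding sum_distrib_right by (subst sum.swap) (intro sum.cong refl, simp only: p_app mult_ac)
    also have "\<dots> = (\<Sum>i<n. (P $$ (i, j) * D $$ (j, j)) * (ev J * ac_ext bs (\<lambda>l. \<phi> (bs ! i # l)) (map p J)))"
      using Cons.prems(2) by (intro sum.cong refl) (simp add: eig)
    also have "\<dots> = ev (j # J) * ac_ext bs \<phi> (map p (j # J))"
      by (simp add: ev_def p_app n_def[symmetric] sum_distrib_left mult_ac)
    finally show ?case .
  qed (simp add: ev_def)
  \<comment> \<open>The columns of the invertible matrix \<open>P\<close> form a basis over the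
    closure, so a form that vanishes on all tuples of columns is zero. One argument is treated at a
    time.\<close>
  have nondeg: "\<psi> xs = 0"
    if "mlin scale (*) \<psi>" "\<And>J. length J = length xs \<Longrightarrow> set J \<subseteq> {..<n} \<Longrightarrow> ac_ext bs \<psi> (map p J) = 0" for \<psi> xs
    using that
  proof (induction xs arbitrary: \<psi>)
    case Nil
    then show ?case using Nil(2)[of "[]"] by simp
  next
    case (Cons x xs)
    have z: "ac_ext bs (\<lambda>l. \<psi> (bs ! k # l)) (map p J) = 0" if J: "length J = length xs" "set J \<subseteq> {..<n}" and k: "k < n" for J k
    proof -
      define e where "e i = ac_ext bs (\<lambda>l. \<psi> (bs ! i # l)) (map p J)" for i
      have 0: "(\<Sum>i<n. P $$ (i, j) * e i) = 0" if "j < n" for j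
      proof -
        have "ac_ext bs \<psi> (map p (j # J)) = 0"
          by (rule Cons.prems(2)) (use J that in auto)
        then have "(\<Sum>i<n. p j i * e i) = 0"
          unfolding e_def n_def by (simp only: list.map ac_ext.simps)
        then show ?thesis unfolding p_app .
      qed
      \<comment> \<open>Multiplication by the inverse \<open>Q\<close> passes from the eigenvectors
        back to the original basis vector \<open>bs ! k\<close>.\<close>
      have "0 = (\<Sum>j<n. (\<Sum>i<n. P $$ (i, j) * e i) * Q $$ (j, k))"
        by (simp add: 0)
      also have "\<dots> = (\<Sum>i<n. e i * (\<Sum>j<n. P $$ (i, j) * Q $$ (j, k)))"
        unfolding sum_distrib_right sum_distrib_left
        by (subst sum.swap) (intro sum.cong refl, simp only: mult_ac)
      also have "\<dots> = (\<Sum>i<n. e i * (if i = k then 1 else 0))"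
        using k by (intro sum.cong refl) (simp add: PQ)
      also have "\<dots> = e k" using sum_mult_delta[OF k, of e 1] by (simp only: mult_1_right)
      finally show ?thesis by (simp add: e_def)
    qed
    have "\<psi> (bs ! k # xs) = 0" if "k < n" for k
      using Cons.IH[OF mlin_Cons[OF Cons.prems(1)], of "bs ! k"] z[OF _ _ that] by simp
    then show ?case
      by (subst rep[of x]) (simp add: mlin_Cons_sum[OF Cons.prems(1)])
  qed
  define \<psi> where "\<psi> = (\<lambda>xs. \<phi> (map T xs) - \<phi> xs)"
  have \<psi>: "mlin scale (*) \<psi>"
    using mlin_map[OF \<phi> Tadd Tscale] \<phi> unfolding \<psi>_def mlin_def madd_def by (auto simp: algebra_simps)
  have \<psi>T: "(\<lambda>xs. \<psi> (map T xs)) = \<psi>"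
    using fixed unfolding \<psi>_def by (intro ext) simp
  have "\<psi> xs = 0"
  proof (rule nondeg[OF \<psi>])
    fix J assume J: "set J \<subseteq> {..<n}"
    have 1: "ac_ext bs \<psi> (map p J) = ev J * ac_ext bs \<psi> (map p J)"
      using T_ext[OF \<psi> J] unfolding \<psi>T .
    have 2: "ac_ext bs \<psi> (map p J) = (ev J - 1) * ac_ext bs \<phi> (map p J)"
      unfolding \<psi>_def ac_ext_diff T_ext[OF \<phi> J] by (simp add: algebra_simps)
    \<comment> \<open>If the eigenvalue \<open>ev J\<close> is not 1, invariance of
      \<open>\<psi>\<close> forces the value to vanish. If it is 1, the value vanishes because
      \<open>\<psi>\<close> is a difference \<open>\<phi> (map T l) - \<phi> l\<close>.\<close>
    show "ac_ext bs \<psi> (map p J) = 0"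
      using 1 2 by (cases "ev J = 1") auto
  qed
  then show ?thesis by (simp add: \<psi>_def)
qed

end

text \<open>Assumption \<open>ker\<close> says that \<open>S\<close> is injective on
  \<open>W = S(C)\<close>. As \<open>W\<close> is finite dimensional and mapped into itself,
  \<open>S(W) = W\<close>.\<close>

lemma (in vector_space) linear_image_stable:
  assumes S: "Vector_Spaces.linear scale scale S" and C: "subspace C" "S ` C \<subseteq> C"
    and F: "finite F" "C \<subseteq> span F"
    and ker: "\<And>x. x \<in> C \<Longrightarrow> S (S x) = 0 \<Longrightarrow> S x = 0" and x: "x \<in> C"
  shows "\<exists>y\<in>C. S x = S (S y)"
proof -
  interpret S: Vector_Spaces.linear scale scale S by (rule S)
  define W where "W = S ` C"
  have W: "subspace W" "W \<subseteq> C" using C S.subspace_image unfolding W_def by auto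
  obtain B where B: "B \<subseteq> W" "independent B" "W \<subseteq> span B"
    using maximal_independent_subset[of W] by blast
  have fB: "finite B"
    using independent_span_bound[OF F(1) B(2)] B(1) W(2) F(2) by blast
  have sB: "span B = W"
    using B(3) span_minimal[OF B(1) W(1)] by blast
  have inj: "inj_on S (span B)"
  proof (subst S.inj_on_iff_eq_0)
    show "subspace (span B)" by (rule subspace_span)
    show "\<forall>w\<in>span B. S w = 0 \<longrightarrow> w = 0"
      unfolding sB W_def using ker by auto
  qed
  have iSB: "independent (S ` B)"
    by (rule S.independent_injective_image[OF B(2) inj])
  \<comment> \<open>A vector of \<open>W\<close> outside the span of \<open>S(B)\<close> would
    enlarge \<open>S(B)\<close> to an independent set with more elements than the basis
    \<open>B\<close> of \<open>W\<close>.\<close>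
  have "W \<subseteq> span (S ` B)"
  proof (rule ccontr)
    assume "\<not> W \<subseteq> span (S ` B)"
    then obtain w where w: "w \<in> W" "w \<notin> span (S ` B)" by blast
    have "independent (insert w (S ` B))"
      by (rule independent_insertI[OF w(2) iSB])
    moreover have "insert w (S ` B) \<subseteq> span B"
      using w(1) B(1) W(2) unfolding sB by (simp add: W_def) blast
    ultimately have "card (insert w (S ` B)) \<le> card B"
      using independent_span_bound[OF fB] by blast
    moreover have "w \<notin> S ` B" using w(2) span_base by blast
    moreover have "card (S ` B) = card B"
      by (rule card_image) (use inj span_superset inj_on_subset in blast)
    ultimately show False using fB by simp
  qed
  then have "S x \<in> S ` span B"
    using x unfolding W_def S.span_image by blast
  then show ?thesis unfolding sB W_def by blast
qed

section \<open>Normalized cochains\<close>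

text \<open>With \<open>e = 0\<close> these are the linear maps, with \<open>e = 1\<close> those which vanish on the unit.\<close>

definition nlin :: "('k::field \<Rightarrow> 'a::ab_group_add \<Rightarrow> 'a) \<Rightarrow> ('k \<Rightarrow> 'b::ab_group_add \<Rightarrow> 'b) \<Rightarrow> 'a \<Rightarrow> ('a \<Rightarrow> 'b) \<Rightarrow> bool" where
  "nlin s t e h \<longleftrightarrow> (\<forall>a b. h (a + b) = h a + h b) \<and> (\<forall>k a. h (s k a) = t k (h a)) \<and> h e = 0"

definition nml :: "('k::field \<Rightarrow> 'a::ab_group_add \<Rightarrow> 'a) \<Rightarrow> ('k \<Rightarrow> 'b::ab_group_add \<Rightarrow> 'b) \<Rightarrow> 'a \<Rightarrow> ('a list \<Rightarrow> 'b) \<Rightarrow> bool" where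
  "nml s t e f \<longleftrightarrow> (\<forall>us ws. nlin s t e (\<lambda>a. f (us @ a # ws)))"

lemma nmlD: "nml s t e f \<Longrightarrow> nlin s t e (\<lambda>a. f (us @ a # ws))"
  by (simp add: nml_def)

lemma nmlD2: "nml s t e f \<Longrightarrow> nlin s t e (\<lambda>a. f (us @ c # ws @ a # ws'))"
  using nmlD[of s t e f "us @ c # ws" ws'] by simp

lemma nmlD3: "nml s t e f \<Longrightarrow> nlin s t e (\<lambda>a. f ((us @ a # ws) @ ws'))"
  using nmlD[of s t e f us "ws @ ws'"] by simp

lemma nlin_mono: "nlin s t e h \<Longrightarrow> nlin s t 0 h"
  using additive_zero[of h] by (simp add: nlin_def)

lemma nlin_comp: "nlin s' t 0 g \<Longrightarrow> nlin s s' e h \<Longrightarrow> nlin s t e (\<lambda>a. g (h a))"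
  by (simp add: nlin_def)

lemma nlin_comp': "nlin s t e g \<Longrightarrow> (\<And>a b. h (a + b) = h a + h b) \<Longrightarrow> (\<And>k a. h (s k a) = s k (h a)) \<Longrightarrow> h e = e \<Longrightarrow> nlin s t e (\<lambda>a. g (h a))"
  by (simp add: nlin_def)

lemma nml_mono: "nml s t e f \<Longrightarrow> nml s t 0 f"
  by (auto simp: nml_def intro: nlin_mono)

lemma mlin_iff_nml: "mlin s t f \<longleftrightarrow> nml s t 0 f"
  using madd_zero[of f] by (auto simp: mlin_def madd_def nml_def nlin_def)

lemma nml_madd: "nml s t e f \<Longrightarrow> madd f"
  by (auto simp: nml_def nlin_def madd_def)

lemma padd_nlin: "(\<And>u w. nlin s t 0 (\<lambda>c. \<Psi> u c w)) \<Longrightarrow> padd \<Psi>"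
  by (simp add: nlin_def padd_def)

lemma hb_diff: "hb r (\<lambda>xs. f xs - g xs) xs = hb r f xs - hb r g xs"
  unfolding hb_def contr_def left_diff_distrib right_diff_distrib sg_diff sums_diff by simp

lemma hb_add: "hb r (\<lambda>xs. f xs + g xs) xs = hb r f xs + hb r g xs"
  unfolding hb_def contr_def distrib_left distrib_right sg_diff sg_add sums_add by simp

lemma hb_sg: "hb r (\<lambda>xs. sg n (f xs)) xs = sg n (hb r f xs)"
  unfolding hb_def contr_def sg_mult_left sg_mult_right sg_diff sg_add push_sg by (simp add: ac_simps)

lemma hb_zero: "hb r (\<lambda>_. 0) xs = 0"
  by (simp add: hb_def contr_def)

text \<open>Normalization has to be checked for values in the algebra and, under the form, for
  values in the field. Additivity of the scalar action is all that both cases share here.\<close>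

locale additive_scale =
  fixes t :: "'k::field \<Rightarrow> 'b::ab_group_add \<Rightarrow> 'b"
  assumes t_add: "t k (x + y) = t k x + t k y"
begin

lemmas t_simps = t_add additive_zero[of "t k", OF t_add] additive_sg[of "t k", OF t_add] additive_diff[of "t k", OF t_add] for k
lemmas t_sums = sums_additive[of "t k", OF t_add, symmetric] for k

lemma nlin_zero: "nlin s t e (\<lambda>a. 0)"
  by (simp add: nlin_def t_simps)

lemma nlin_add: "nlin s t e f \<Longrightarrow> nlin s t e g \<Longrightarrow> nlin s t e (\<lambda>a. f a + g a)"
  by (simp add: nlin_def t_simps)

lemma nlin_diff: "nlin s t e f \<Longrightarrow> nlin s t e g \<Longrightarrow> nlin s t e (\<lambda>a. f a - g a)"
  by (simp add: nlin_def t_simps)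

lemma nlin_sg: "nlin s t e f \<Longrightarrow> nlin s t e (\<lambda>a. sg n (f a))"
  by (simp add: nlin_def t_simps sg_add)

lemma nlin_if: "(P \<Longrightarrow> nlin s t e f) \<Longrightarrow> (\<not> P \<Longrightarrow> nlin s t e g) \<Longrightarrow> nlin s t e (\<lambda>a. if P then f a else g a)"
  by (cases P) simp_all

lemma nlin_split2:
  assumes "\<And>u v. nlin s t e (\<lambda>a. F a u v)"
  shows "nlin s t e (\<lambda>a. split2 (F a) xs)"
proof -
  have "F (a + b) = (\<lambda>u v. F a u v + F b u v)" "F (s k a) = (\<lambda>u v. t k (F a u v))" "F e = (\<lambda>u v. 0)" for a b k
    using assms by (simp_all add: nlin_def fun_eq_iff)
  then show ?thesis by (simp add: nlin_def t_sums split2_add)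
qed

lemma nlin_split3:
  assumes "\<And>u v w. nlin s t e (\<lambda>a. F a u v w)"
  shows "nlin s t e (\<lambda>a. split3 (F a) xs)"
proof -
  have "F (a + b) = (\<lambda>u v w. F a u v w + F b u v w)" "F (s k a) = (\<lambda>u v w. t k (F a u v w))" "F e = (\<lambda>u v w. 0)" for a b k
    using assms by (simp_all add: nlin_def fun_eq_iff)
  then show ?thesis by (simp add: nlin_def t_sums split3_add)
qed

lemma nlin_adj2:
  assumes "\<And>u v w x. nlin s t e (\<lambda>a. F a u v w x)"
  shows "nlin s t e (\<lambda>a. adj2 (F a) xs)"
proof -
  have "F (a + b) = (\<lambda>u v w x. F a u v w x + F b u v w x)" "F (s k a) = (\<lambda>u v w x. t k (F a u v w x))" "F e = (\<lambda>u v w x. 0)" for a b k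
    using assms by (simp_all add: nlin_def fun_eq_iff)
  then show ?thesis by (simp add: nlin_def t_sums adj2_add)
qed

lemma nlin_on_hd:
  assumes "\<And>u v. nlin s t e (\<lambda>a. F a u v)"
  shows "nlin s t e (\<lambda>a. on_hd (F a) xs)"
proof -
  have "F (a + b) = (\<lambda>u v. F a u v + F b u v)" "F (s k a) = (\<lambda>u v. t k (F a u v))" "F e = (\<lambda>u v. 0)" for a b k
    using assms by (simp_all add: nlin_def fun_eq_iff)
  then show ?thesis by (simp add: nlin_def t_sums on_hd_add)
qed

lemma nlin_on_last:
  assumes "\<And>u v. nlin s t e (\<lambda>a. F a u v)"
  shows "nlin s t e (\<lambda>a. on_last (F a) xs)"
proof -
  have "F (a + b) = (\<lambda>u v. F a u v + F b u v)" "F (s k a) = (\<lambda>u v. t k (F a u v))" "F e = (\<lambda>u v. 0)" for a b k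
    using assms by (simp_all add: nlin_def fun_eq_iff)
  then show ?thesis by (simp add: nlin_def t_sums on_last_add)
qed

lemmas nlin_intros = nlin_zero nlin_add nlin_diff nlin_sg nlin_if nlin_split2 nlin_split3 nlin_adj2 nlin_on_hd nlin_on_last

lemma nml_ins:
  assumes "\<And>x y c w. nlin s t e (\<lambda>a. \<Psi> (x @ a # y) c w)" "\<And>u w. nlin s' t 0 (\<lambda>c. \<Psi> u c w)"
    "\<And>u c x y. nlin s t e (\<lambda>a. \<Psi> u c (x @ a # y))" "nml s s' e g"
  shows "nml s t e (ins d g \<Psi>)"
  unfolding nml_def ins_def split3_middle length_append list.size
proof (intro allI nlin_intros)
  fix x y z w
  show "nlin s t e (\<lambda>a. \<Psi> x (g (y @ a # z)) w)"
    by (rule nlin_comp[OF assms(2) nmlD[OF assms(4)]])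
qed (use assms nmlD[OF assms(4)] in auto)

lemma nml_pins:
  assumes "nml s t e f" "nml s s e h"
  shows "nlin s t e (\<lambda>a. pins d f h (x @ a # y) c w)" "nlin s t e (\<lambda>c. pins d f h u c w)"
    "nlin s t e (\<lambda>a. pins d f h u c (x @ a # y))"
proof -
  show "nlin s t e (\<lambda>a. pins d f h (x @ a # y) c w)"
    unfolding pins_def length_append list.size by (intro nlin_intros nmlD3[OF assms(1)])
  show "nlin s t e (\<lambda>c. pins d f h u c w)"
    unfolding pins_def by (intro nlin_intros nmlD[OF assms(1)])
  show "nlin s t e (\<lambda>a. pins d f h u c (x @ a # y))"
    unfolding pins_def split3_middle length_append list.size
  proof (intro nlin_intros)
    fix x' y' z w
    show "nlin s t e (\<lambda>a. f (u @ c # x' @ h y' # z @ a # y))"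
      using nmlD[OF assms(1), of "u @ c # x' @ h y' # z" y] by simp
    show "nlin s t e (\<lambda>a. f (u @ c # (x @ a # x') @ h y' # z))"
      using nmlD[OF assms(1), of "u @ c # x" "x' @ h y' # z"] by simp
    show "nlin s t e (\<lambda>a. f (u @ c # x' @ h (y' @ a # z) # w))"
      using nlin_comp[OF nlin_mono[OF nmlD[OF assms(1), of "u @ c # x'" w]] nmlD[OF assms(2), of y' z]] by simp
  qed
qed

lemma nml_brace:
  assumes "nml s t e f" "nml s s e g" "nml s s e h"
  shows "nml s t e (brace d d' f g h)"
  unfolding brace_def
  by (intro nml_ins[of s e _ s] nml_pins[OF assms(1,3)] nlin_mono[OF nml_pins(2)[OF assms(1,3)]] assms(2))

lemma nml_circ:
  assumes "nml s t e f" "nml s s e g"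
  shows "nml s t e (circ d f g)"
  unfolding circ_def
proof (rule nml_ins[of s e _ s])
  fix x y c w show "nlin s t e (\<lambda>a. f ((x @ a # y) @ c # w))" by (rule nmlD3[OF assms(1)])
next
  fix u w show "nlin s t 0 (\<lambda>c. f (u @ c # w))" by (rule nlin_mono[OF nmlD[OF assms(1)]])
next
  fix u c x y show "nlin s t e (\<lambda>a. f (u @ c # x @ a # y))" by (rule nmlD2[OF assms(1)])
qed (rule assms(2))

lemma nml_rot:
  assumes "nml s t e \<phi>" and N: "\<And>a b. N (a + b) = N a + N b" "\<And>k a. N (s k a) = s k (N a)" "N e = e"
  shows "nlin s t e (\<lambda>a. rot N \<phi> (x @ a # y) c W)" "nlin s t e (\<lambda>c. rot N \<phi> us c W)"
    "nlin s t e (\<lambda>a. rot N \<phi> us c (w @ a # w'))"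
proof -
  show "nlin s t e (\<lambda>a. rot N \<phi> (x @ a # y) c W)"
    unfolding rot_def split2_middle length_append list.size
  proof (intro nlin_intros)
    fix u v
    show "nlin s t e (\<lambda>a. \<phi> ((v @ a # y) @ c # W @ map N u))" by (rule nmlD3[OF assms(1)])
    show "nlin s t e (\<lambda>a. \<phi> (v @ c # W @ map N (x @ a # u)))"
      using nlin_comp'[OF nmlD[OF assms(1), of "v @ c # W @ map N x" "map N u"] N] by simp
  qed
  show "nlin s t e (\<lambda>c. rot N \<phi> us c W)"
    unfolding rot_def by (intro nlin_intros nmlD[OF assms(1)])
  show "nlin s t e (\<lambda>a. rot N \<phi> us c (w @ a # w'))"
    unfolding rot_def length_append list.size
  proof (intro nlin_intros)
    fix u v
    show "nlin s t e (\<lambda>a. \<phi> (v @ c # (w @ a # w') @ map N u))"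
      using nmlD[OF assms(1), of "v @ c # w" "w' @ map N u"] by simp
  qed
qed

end

section \<open>Degrees of the constructed cochains\<close>

lemma homog_ins:
  fixes g :: "'x list \<Rightarrow> 'a::ab_group_add"
  assumes "homog m g" "padd \<Psi>" "\<And>u c w. len u + 1 + len w \<noteq> n \<Longrightarrow> \<Psi> u c w = 0"
  shows "homog (n + m - 1) (ins d g \<Psi>)"
  unfolding homog_def
proof (intro allI impI)
  fix xs :: "'x list" assume xs: "len xs \<noteq> n + m - 1"
  have "ins d g \<Psi> xs = split3 (\<lambda>u v w. 0) xs"
    unfolding ins_def
  proof (rule split3_cong)
    fix u v w :: "'x list" assume uvw: "u @ v @ w = xs"
    show "sg (d * len u) (\<Psi> u (g v) w) = 0"
    proof (cases "len v = m")
      case True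
      then show ?thesis using assms(3)[of u w "g v"] uvw xs by auto
    next
      case False
      then show ?thesis using assms(1,2) by (simp add: homog_def padd_zero)
    qed
  qed
  then show "ins d g \<Psi> xs = 0" by simp
qed

lemma homog_circ:
  assumes "homog n f" "homog m g" "madd f"
  shows "homog (n + m - 1) (circ d f g)"
  unfolding circ_def by (rule homog_ins[OF assms(2) padd_madd[OF assms(3)]]) (use assms(1) in \<open>auto simp: homog_def\<close>)

lemma homog_pins:
  fixes f :: "'a::ab_group_add list \<Rightarrow> 'b::ab_group_add"
  assumes f: "homog p f" "madd f" and h: "homog r h" and l: "len u + 1 + len w \<noteq> p + r - 1"
  shows "pins d f h u c w = 0"
proof -
  have "pins d f h u c w = split3 (\<lambda>_ _ _. 0) w"
    unfolding pins_def
  proof (rule split3_cong)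
    fix x v y :: "'a list" assume uvw: "x @ v @ y = w"
    show "sg (d * (len u + 1 + len x)) (f (u @ c # x @ h v # y)) = 0"
    proof (cases "len v = r")
      case True
      then have "len (u @ c # x @ h v # y) \<noteq> p" using l uvw by auto
      then show ?thesis using f(1) by (simp add: homog_def)
    next
      case False
      then show ?thesis using h madd_zero[OF f(2), of "u @ c # x" y] by (simp add: homog_def)
    qed
  qed
  then show ?thesis by simp
qed

lemma homog_brace:
  assumes "homog p f" "madd f" "homog q g" "homog r h"
  shows "homog (p + q + r - 2) (brace d e f g h)"
proof -
  have "homog ((p + r - 1) + q - 1) (brace d e f g h)"
    unfolding brace_def by (rule homog_ins[OF assms(3) padd_pins[OF assms(2)] homog_pins[OF assms(1,2,4)]])
  then show ?thesis by (simp add: algebra_simps)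
qed

lemma homog_conv:
  assumes "homog p f" "homog q g"
  shows "homog (p + q) (conv f g)"
  unfolding homog_def
proof (intro allI impI)
  fix xs :: "'a list" assume xs: "len xs \<noteq> p + q"
  have "conv f g xs = split2 (\<lambda>u v. 0) xs"
    unfolding conv_def
  proof (rule split2_cong)
    fix u v :: "'a list" assume "u @ v = xs"
    then have "len u \<noteq> p \<or> len v \<noteq> q" using xs by auto
    then show "f u * g v = 0" using assms by (auto simp: homog_def)
  qed
  then show "conv f g xs = 0" by simp
qed

lemma homog_hb:
  assumes "homog r f"
  shows "homog (r + 1) (hb r f)"
  unfolding homog_def
proof (intro allI impI)
  fix xs :: "'a list" assume xs: "len xs \<noteq> r + 1"
  have "on_last (\<lambda>x a. f x * a) xs = on_last (\<lambda>x a. 0) xs"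
    by (rule on_last_cong) (use assms xs in \<open>auto simp: homog_def\<close>)
  moreover have "on_hd (\<lambda>a x. a * f x) xs = on_hd (\<lambda>x a. 0) xs"
    by (rule on_hd_cong) (use assms xs in \<open>auto simp: homog_def\<close>)
  moreover have "contr f xs = adj2 (\<lambda>x a b z. 0) xs"
    unfolding contr_def by (rule adj2_cong) (use assms xs in \<open>auto simp: homog_def\<close>)
  ultimately show "hb r f xs = 0" by (simp add: hb_def)
qed

lemma sum_fun_app: "(\<Sum>i\<in>I. f i) x = (\<Sum>i\<in>I. f i x)"
  by (induction I rule: infinite_finite_induct) simp_all

section \<open>Agreement of the sums over words with the given definitions\<close>

context k_algebra
begin

abbreviation C :: "int \<Rightarrow> ('a list \<Rightarrow> 'a) set" where "C \<equiv> cochains scale"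

lemma scale_powi: "(-1) powi n *s x = sg n x"
  by (simp add: power_int_minus_left sg_def)

sublocale additive_scale scale
  by unfold_locales (rule scale_right_distrib)

lemma cochains_iff: "f \<in> C n \<longleftrightarrow> homog n f \<and> nml scale scale 1 f"
proof -
  have "vector_space scale" by unfold_locales
  moreover have "(\<forall>xs c ys. f (xs @ (c *s 1) # ys) = 0) \<longleftrightarrow> (\<forall>xs ys. f (xs @ 1 # ys) = 0)"
    if "\<forall>xs ys c a. f (xs @ (c *s a) # ys) = c *s f (xs @ a # ys)"
    using that by (metis scale_one scale_zero_right)
  ultimately show ?thesis
    unfolding cochains_def homog_def nml_def nlin_def Vector_Spaces.linear_iff by blast
qed

lemma hochschild_b_eq:
  assumes "f \<in> C r"
  shows "hochschild_b scale r f = hb r f"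
proof
  fix xs :: "'a list"
  have f: "homog r f" using assms by (simp add: cochains_iff)
  show "hochschild_b scale r f xs = hb r f xs"
  proof (cases "len xs = r + 1 \<and> xs \<noteq> []")
    case True
    then have r: "nat r = length xs - 1" "r = len xs - 1" by auto
    have "(\<Sum>i = 1..nat r. (-1) powi (r + 1 - int i) *s f (take (i - 1) xs @ (xs ! (i - 1) * xs ! i) # drop (i + 1) xs))
        = (\<Sum>i<length xs - 1. sg (r + 1 - int (Suc i)) (f (take i xs @ (xs ! i * xs ! Suc i) # drop (i + 2) xs)))"
      unfolding scale_powi r(1) by (simp add: sum.atLeast1_atMost_eq)
    also have "\<dots> = adj2 (\<lambda>x a b z. sg (r - len x) (f (x @ (a * b) # z))) xs"
      unfolding adj2_sum by (intro sum.cong refl sg_cong) auto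
    also have "\<dots> = - sg (r + 1) (contr f xs)"
      unfolding contr_def uminus_eq_sg push_sg by (intro adj2_cong sg_cong) auto
    finally have 1: "(\<Sum>i = 1..nat r. (-1) powi (r + 1 - int i) *s f (take (i - 1) xs @ (xs ! (i - 1) * xs ! i) # drop (i + 1) xs))
        = - sg (r + 1) (contr f xs)" .
    have 2: "on_hd (\<lambda>a x. a * f x) xs = hd xs * f (tl xs)" "on_last (\<lambda>x a. f x * a) xs = f (butlast xs) * last xs"
      using True by (cases xs, auto) (simp add: on_last_def)
    show ?thesis
      unfolding hochschild_b_def hb_def 1 2 using True by (simp add: scale_powi sg_diff)
  next
    case False
    have "hochschild_b scale r f xs = 0"
    proof (cases "xs = []")
      case True
      \<comment> \<open>In degree \<open>-1\<close> the formula is evaluated at the empty list,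
        where \<open>hd\<close> and \<open>last\<close> are unspecified; both are multiplied by
        \<open>f [] = 0\<close>.\<close>
      have "f [] = 0" if "r = -1" using f that by (simp add: homog_def)
      then show ?thesis using True by (simp add: hochschild_b_def)
    qed (use False in \<open>simp add: hochschild_b_def\<close>)
    moreover have "hb r f xs = 0"
    proof (cases "xs = []")
      case True
      then show ?thesis by (simp add: hb_def contr_def)
    next
      case n: False
      then have "len xs \<noteq> r + 1" using False by simp
      then show ?thesis using homog_hb[OF f] by (simp add: homog_def)
    qed
    ultimately show ?thesis by simp
  qed
qed

lemma cup_cochain_eq:
  assumes "f \<in> C p" "g \<in> C q"
  shows "cup_cochain scale p q f g = (\<lambda>xs. sg (p * q) (conv f g xs))"
proof
  fix xs :: "'a list"
  have f: "homog p f" and g: "homog q g" using assms by (simp_all add: cochains_iff)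
  show "cup_cochain scale p q f g xs = sg (p * q) (conv f g xs)"
  proof (cases "len xs = p + q \<and> p \<ge> 0 \<and> q \<ge> 0")
    case True
    have "conv f g xs = (if nat p \<le> length xs then f (take (nat p) xs) * g (drop (nat p) xs) else 0)"
      unfolding conv_def by (rule split2_single) (use f True in \<open>auto simp: homog_def\<close>)
    moreover have "nat p \<le> length xs" using True by (simp add: nat_le_iff)
    ultimately show ?thesis using True by (simp add: cup_cochain_def scale_powi)
  next
    case False
    \<comment> \<open>In a negative degree \<open>nat p\<close> collapses to 0 and the formula of
      \<open>cup_cochain\<close> loses its meaning, but then the cochain is zero.\<close>
    have z: "f = 0" if "p < 0" using f that by (auto simp: homog_def fun_eq_iff)
    have z': "g = 0" if "q < 0" using g that by (auto simp: homog_def fun_eq_iff)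
    show ?thesis
    proof (cases "len xs = p + q")
      case True
      then have "f = 0 \<or> g = 0" using False z z' by linarith
      then show ?thesis by (auto simp: cup_cochain_def conv_def)
    next
      case n: False
      then show ?thesis using homog_conv[OF f g] by (simp add: homog_def cup_cochain_def)
    qed
  qed
qed

lemma circ_cochain_eq:
  assumes "f \<in> C n" "g \<in> C m"
  shows "circ_cochain scale n m f g = circ (m - 1) f g"
proof
  fix xs :: "'a list"
  have f: "homog n f" "madd f" and g: "homog m g"
    using assms by (auto simp: cochains_iff intro: nml_madd)
  have L: "circ_cochain scale n m f g xs = (\<Sum>i<nat n. sg ((m - 1) * int i) (insert_cochain n m (Suc i) f g xs))"
    unfolding circ_cochain_def scale_cochain_def sum_fun_app scale_powi
    by (simp add: sum.atLeast1_atMost_eq)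
  show "circ_cochain scale n m f g xs = circ (m - 1) f g xs"
  proof (cases "len xs = n + m - 1")
    case True
    show ?thesis
    proof (cases "n \<ge> 1 \<and> m \<ge> 0")
      case nm: True
      have s: "split2 (\<lambda>v w. sg ((m - 1) * len u) (f (u @ g v # w))) r
         = (if nat m \<le> length r then sg ((m - 1) * len u) (f (u @ g (take (nat m) r) # drop (nat m) r)) else 0)" for u r
        by (rule split2_single) (use g nm in \<open>auto simp: homog_def madd_zero[OF f(2)]\<close>)
      have "circ (m - 1) f g xs = (\<Sum>i\<le>length xs. if i < nat n then sg ((m - 1) * int i) (insert_cochain n m (Suc i) f g xs) else 0)"
        unfolding circ_def ins_def split3_def s unfolding split2_sum insert_cochain_def
        using True nm by (intro sum.cong) (auto simp: add.commute)
      also have "\<dots> = (\<Sum>i<nat n. sg ((m - 1) * int i) (insert_cochain n m (Suc i) f g xs))"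
        using True nm by (subst sum.inter_filter[symmetric]) (auto intro!: sum.cong)
      finally show ?thesis using L by simp
    next
      case False
      have "circ (m - 1) f g xs = split3 (\<lambda>u v w. 0) xs"
        unfolding circ_def ins_def
      proof (rule split3_cong)
        fix u v w
        show "sg ((m - 1) * len u) (f (u @ g v # w)) = 0"
          using False f g madd_zero[OF f(2), of u w] by (cases "n \<ge> 1") (auto simp: homog_def)
      qed
      moreover have "insert_cochain n m (Suc i) f g xs = 0" if "i < nat n" for i
      proof -
        \<comment> \<open>A slot \<open>i\<close> exists only for \<open>n \<ge> 1\<close>, so it is
          the degree \<open>m\<close> that is negative.\<close>
        have "g = 0" using False that g by (auto simp: homog_def fun_eq_iff)
        then show ?thesis using madd_zero[OF f(2)] by (simp add: insert_cochain_def)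
      qed
      ultimately show ?thesis unfolding L by simp
    qed
  next
    case False
    then show ?thesis
      unfolding L using homog_circ[OF f(1) g f(2)] by (simp add: homog_def insert_cochain_def)
  qed
qed

lemma bracket_cochain_eq:
  assumes "f \<in> C n" "g \<in> C m"
  shows "bracket_cochain scale n m f g = (\<lambda>xs. circ (m - 1) f g xs - sg ((n - 1) * (m - 1)) (circ (n - 1) g f xs))"
  unfolding bracket_cochain_def circ_cochain_eq[OF assms] circ_cochain_eq[OF assms(2,1)]
  by (auto simp: scale_cochain_def scale_powi fun_eq_iff)

section \<open>Closure of the normalized cochains under the operations\<close>

lemma C_zero: "0 \<in> C n"
  by (simp add: cochains_iff homog_def nml_def nlin_def)

lemma C_add: "f \<in> C n \<Longrightarrow> g \<in> C n \<Longrightarrow> (\<lambda>xs. f xs + g xs) \<in> C n"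
  by (auto simp: cochains_iff homog_def nml_def intro: nlin_add)

lemma C_diff: "f \<in> C n \<Longrightarrow> g \<in> C n \<Longrightarrow> (\<lambda>xs. f xs - g xs) \<in> C n"
  by (auto simp: cochains_iff homog_def nml_def intro: nlin_diff)

lemma C_sg: "f \<in> C n \<Longrightarrow> (\<lambda>xs. sg k (f xs)) \<in> C n"
  by (auto simp: cochains_iff homog_def nml_def intro: nlin_sg)

lemma C_scale: "f \<in> C n \<Longrightarrow> (\<lambda>xs. c *s f xs) \<in> C n"
  by (auto simp: cochains_iff homog_def nml_def nlin_def scale_right_distrib scale_left_commute)

lemma C_conv:
  assumes "f \<in> C p" "g \<in> C q"
  shows "conv f g \<in> C (p + q)"
proof -
  note f = assms(1)[unfolded cochains_iff] and g = assms(2)[unfolded cochains_iff]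
  have l: "nlin scale scale 1 (\<lambda>a. h a * c)" and r: "nlin scale scale 1 (\<lambda>a. c * h a)"
    if "nlin scale scale 1 h" for h c
    using that by (simp_all add: nlin_def algebra_simps scale_mult_left scale_mult_right)
  have "nml scale scale 1 (conv f g)"
    unfolding nml_def conv_def split2_middle
    by (intro allI nlin_intros l r nmlD) (use f g in auto)
  then show ?thesis using homog_conv[of p f q g] f g by (simp add: cochains_iff)
qed

lemma C_circ: "f \<in> C p \<Longrightarrow> g \<in> C q \<Longrightarrow> circ d f g \<in> C (p + q - 1)"
  by (auto simp: cochains_iff intro: nml_circ homog_circ nml_madd)

lemma C_brace: "f \<in> C p \<Longrightarrow> g \<in> C q \<Longrightarrow> h \<in> C r \<Longrightarrow> brace d e f g h \<in> C (p + q + r - 2)"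
  by (auto simp: cochains_iff intro: nml_brace homog_brace nml_madd)

lemma mlin_hb:
  assumes "mlin scale scale f"
  shows "mlin scale scale (hb r f)"
proof -
  note f = assms[unfolded mlin_iff_nml]
  have l: "nlin scale scale 0 (\<lambda>a. h a * c)" and r: "nlin scale scale 0 (\<lambda>a. c * h a)"
    if "nlin scale scale 0 h" for h c
    using that by (simp_all add: nlin_def algebra_simps scale_mult_left scale_mult_right)
  have id: "nlin scale scale 0 (\<lambda>a. a)" by (simp add: nlin_def)
  have lm: "nlin scale scale 0 (\<lambda>a. f (us @ (a * z) # ws))" and rm: "nlin scale scale 0 (\<lambda>a. f (us @ (z * a) # ws))" for us z ws
    using nlin_comp[OF nmlD[OF f] l[OF id]] nlin_comp[OF nmlD[OF f] r[OF id]] by auto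
  show ?thesis
    unfolding mlin_iff_nml nml_def hb_eq lmul_middle rmul_middle contr_middle pcontr_def
    by (intro allI nlin_intros l r nmlD[OF f] id lm rm)
qed

end

section \<open>Reduction to invariant cochains\<close>

context frobenius_algebra
begin

sublocale form_scale: additive_scale "(*) :: 'k \<Rightarrow> 'k \<Rightarrow> 'k"
  by unfold_locales (rule distrib_left)

lemma N_one: "N 1 = 1"
  by (rule nakayama_one)

lemma inv_N_N: "inv_into UNIV N (N a) = a" and N_inv_N: "N (inv_into UNIV N a) = a"
  using nakayama_bij by (simp_all add: bij_def surj_f_inv_f)

lemma N_inject: "N a = N b \<longleftrightarrow> a = b"
  using nakayama_bij by (auto simp: bij_def inj_def)

lemma N_twist: "N (twist f xs) = f (map N xs)"
  by (simp add: twist_def N_inv_N)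

lemma nlin_formI:
  assumes "\<And>z. nlin scale (*) e (\<lambda>a. form (h a) z)"
  shows "nlin scale scale e h"
  unfolding nlin_def
  by (intro conjI allI form_left_eqI) (use assms in \<open>simp_all add: nlin_def form_left form_scale_left\<close>)

lemma nml_form:
  assumes "nml scale scale e f"
  shows "nml scale (*) e (\<lambda>l. form (f l) z)"
  using assms by (simp add: nml_def nlin_def form_left form_scale_left)

lemma homog_form: "homog p f \<Longrightarrow> homog p (\<lambda>l. form (f l) z)"
  by (simp add: homog_def form_left)

lemma C_mlin: "f \<in> C n \<Longrightarrow> mlin scale scale f"
  by (auto simp: cochains_iff mlin_iff_nml intro: nml_mono)

lemma C_homog: "f \<in> C n \<Longrightarrow> homog n f"
  by (simp add: cochains_iff)

lemma C_Delta:
  assumes f: "f \<in> C p"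
  shows "Delta f \<in> C (p - 1)"
  unfolding cochains_iff
proof
  show "homog (p - 1) (Delta f)"
    unfolding homog_def
  proof (intro allI impI form_left_eqI)
    fix xs :: "'a list" and z assume "len xs \<noteq> p - 1"
    then show "form (Delta f xs) z = form 0 z"
      using rot_homog[OF homog_form[OF C_homog[OF f]], of xs "[]" N 1 z]
      by (simp add: form_Delta[OF C_mlin[OF f]] form_left)
  qed
  have "nml scale (*) 1 (\<lambda>l. form (f l) 1)"
    using f by (intro nml_form) (simp add: cochains_iff)
  then have "nlin scale (*) 1 (\<lambda>a. form (Delta f (us @ a # ws)) z)" for us ws z
    unfolding form_Delta[OF C_mlin[OF f]]
    by (rule form_scale.nml_rot(1)[where N = N and s = scale, OF _ N_add N_scale N_one])
  then show "nml scale scale 1 (Delta f)"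
    unfolding nml_def by (intro allI nlin_formI)
qed

lemma C_cartan:
  assumes f: "f \<in> C p" and g: "g \<in> C q"
  shows "cartan d f g \<in> C (p + q - 2)"
  unfolding cochains_iff
proof
  let ?\<Psi> = "\<lambda>z us c ws. rot N (\<lambda>l. form (f l) 1) us c (ws @ [z])"
  have n: "nml scale (*) 1 (\<lambda>l. form (f l) 1)"
    using f by (intro nml_form) (simp add: cochains_iff)
  note r = form_scale.nml_rot[where N = N, OF n N_add N_scale N_one]
  have P: "padd (?\<Psi> z)" for z
    using nlin_mono[OF r(2)] by (intro padd_nlin)
  have "homog ((p - 1) + q - 1) (ins d g (?\<Psi> z))" for z
    by (intro homog_ins[OF C_homog[OF g] P] rot_homog[OF homog_form[OF C_homog[OF f]]]) auto
  then have "homog (p + q - 2) (ins d g (?\<Psi> z))" for z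
    by (simp add: algebra_simps)
  then show "homog (p + q - 2) (cartan d f g)"
    unfolding homog_def by (auto intro!: form_left_eqI simp: form_cartan[OF C_mlin[OF f]] form_left)
  have "nml scale (*) 1 (ins d g (?\<Psi> z))" for z
  proof (rule form_scale.nml_ins[where s' = scale])
    show "nlin scale (*) 0 (\<lambda>c. rot N (\<lambda>l. form (f l) 1) u c (w @ [z]))" for u w
      by (rule nlin_mono[OF r(2)])
    show "nlin scale (*) 1 (\<lambda>a. rot N (\<lambda>l. form (f l) 1) u c ((x @ a # y) @ [z]))" for u c x y
      using r(3)[of u c x "y @ [z]"] by simp
  qed (use r(1) g in \<open>auto simp: cochains_iff\<close>)
  then have "nlin scale (*) 1 (\<lambda>a. form (cartan d f g (us @ a # ws)) z)" for us ws z
    unfolding form_cartan[OF C_mlin[OF f]] by (rule nmlD)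
  then show "nml scale scale 1 (cartan d f g)"
    unfolding nml_def by (intro allI nlin_formI)
qed

lemma nml_twist:
  assumes "nml scale scale e f" "N e = e"
  shows "nml scale scale e (twist f)"
  unfolding nml_def
proof (intro allI nlin_formI)
  fix us ws z
  show "nlin scale (*) e (\<lambda>a. form (twist f (us @ a # ws)) z)"
    using nlin_comp'[OF nmlD[OF nml_form[OF assms(1)], of "map N us" "map N ws" "N z"] N_add N_scale assms(2)]
    by (simp add: form_twist)
qed

lemma C_twist:
  assumes "f \<in> C n"
  shows "twist f \<in> C n"
proof -
  have "inv_into UNIV N 0 = 0" using inv_N_N[of 0] by (simp add: N_zero)
  then have "homog n (twist f)" using C_homog[OF assms] by (simp add: homog_def twist_def)
  then show ?thesis using nml_twist[OF _ N_one] assms by (simp add: cochains_iff)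
qed

lemmas N_sums = sums_additive[of N, OF N_add] additive_sg[of N, OF N_add] additive_diff[of N, OF N_add]

text \<open>The twist is a cochain map because \<open>N\<close> is an algebra automorphism.\<close>

lemma twist_hb: "hb r (twist f) = twist (hb r f)"
proof
  fix xs
  have "N (hb r (twist f) xs) = hb r f (map N xs)"
    by (simp add: hb_def contr_def N_add N_sums N_twist nakayama_mult on_last_map on_hd_map adj2_map)
  then show "hb r (twist f) xs = twist (hb r f) xs"
    by (metis N_inject N_twist)
qed

lemma twist_diff: "twist (\<lambda>xs. f xs - g xs) xs = twist f xs - twist g xs"
  and twist_add: "twist (\<lambda>xs. f xs + g xs) xs = twist f xs + twist g xs"
  and twist_scale: "twist (\<lambda>xs. k *s f xs) xs = k *s twist f xs"
  by (simp_all add: N_inject[symmetric] N_twist N_add N_scale additive_diff[of N, OF N_add])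

lemma twist_eq_iff: "twist f = f \<longleftrightarrow> (\<forall>xs. f (map N xs) = N (f xs))"
  unfolding fun_eq_iff by (metis N_inject N_twist)

text \<open>The hypothesis says that \<open>(twist - 1)^2\<close> kills \<open>f\<close>. Passing to
  the scalar form in one more argument, \<open>form (f x) a\<close>, turns the twist into
  precomposition with \<open>N\<close>, since \<open>N\<close> preserves the Frobenius form, and
  \<open>semisimple_fixed\<close> applies.\<close>

lemma twist_unipotent:
  assumes ss: "semisimple_endo scale N" and f: "mlin scale scale f"
    and fixed: "\<And>xs. twist (twist f) xs - twist f xs = twist f xs - f xs"
  shows "twist f = f"
proof
  define \<phi> where "\<phi> h = on_last (\<lambda>x a. form (h x) a)" for h
  have N: "\<phi> h (map N l) = \<phi> (twist h) l" for h l
    unfolding \<phi>_def on_last_map form_twist ..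
  have diff: "\<phi> h l - \<phi> h' l = \<phi> (\<lambda>xs. h xs - h' xs) l" for h h' l
    unfolding \<phi>_def on_last_diff[symmetric] form_left ..
  have "mlin scale (*) (\<phi> f)"
    unfolding mlin_iff_nml nml_def \<phi>_def on_last_append
  proof (intro allI form_scale.nlin_intros)
    fix us show "nlin scale (*) 0 (\<lambda>a. form (f us) a)"
      by (simp add: nlin_def form_add_right form_scale_right form_zero_right)
  next
    fix us z b show "nlin scale (*) 0 (\<lambda>a. form (f (us @ a # z)) b)"
      using f nmlD[OF nml_form] unfolding mlin_iff_nml by blast
  qed
  then have "\<phi> f (map N l) = \<phi> f l" for l
    by (rule semisimple_fixed[OF ss]) (simp only: N diff fixed)
  then have "\<phi> (twist f) (xs @ [z]) = \<phi> f (xs @ [z])" for xs z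
    by (simp only: N)
  then show "twist f xs = f xs" for xs
    unfolding \<phi>_def by (intro form_left_eqI) simp
qed

section \<open>Finite dimension of the cochain spaces and the splitting under the twist\<close>

lemma vector_space_fun: "vector_space (scale_cochain scale)"
  by unfold_locales (simp_all add: scale_cochain_def fun_eq_iff scale_right_distrib scale_left_distrib)

sublocale fv: vector_space "scale_cochain scale"
  by (rule vector_space_fun)

text \<open>Expanding the first argument in a basis writes a function of \<open>m + 1\<close>
  arguments as a sum of coordinate functions times functions of \<open>m\<close> arguments.\<close>

lemma multilinear_finite_span:
  "\<exists>F. finite F \<and> (\<forall>f. mlin scale scale f \<longrightarrow> (\<forall>xs. length xs \<noteq> m \<longrightarrow> f xs = 0) \<longrightarrow> f \<in> fv.span F)"
proof -
  obtain S where S: "finite S" "span S = UNIV"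
    using finite_dim by blast
  obtain B where B: "B \<subseteq> S" "independent B" "S \<subseteq> span B"
    using maximal_independent_subset[of S] by blast
  have spanB: "span B = UNIV"
    using span_minimal[OF B(3) subspace_span] S(2) by blast
  have fB: "finite B" using B(1) S(1) finite_subset by blast
  have rep: "(\<Sum>b\<in>B. representation B x b *s b) = x" for x
    using sum_representation_eq[OF B(2), of x B] fB spanB by simp
  show ?thesis
  proof (induction m)
    case 0
    define E where "E b = (\<lambda>xs::'a list. if xs = [] then b else 0)" for b :: 'a
    have "f \<in> fv.span (E ` B)" if "\<forall>xs. length xs \<noteq> 0 \<longrightarrow> f xs = 0" for f :: "'a list \<Rightarrow> 'a"
    proof -
      have eq: "f = (\<Sum>b\<in>B. scale_cochain scale (representation B (f []) b) (E b))"
      proof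
        fix x show "f x = (\<Sum>b\<in>B. scale_cochain scale (representation B (f []) b) (E b)) x"
          using that by (cases x) (simp_all add: sum_fun_app scale_cochain_def E_def rep)
      qed
      show ?thesis
        by (subst eq) (intro fv.span_sum fv.span_scale fv.span_base imageI)
    qed
    then show ?case using fB by (intro exI[of _ "E ` B"]) auto
  next
    case (Suc m)
    then obtain F where F: "finite F" "\<And>f. mlin scale scale f \<Longrightarrow> (\<forall>xs. length xs \<noteq> m \<longrightarrow> f xs = 0) \<Longrightarrow> f \<in> fv.span F"
      by blast
    define E where "E b g = (\<lambda>xs. case xs of [] \<Rightarrow> 0 | x # l \<Rightarrow> representation B x b *s g l)" for b and g :: "'a list \<Rightarrow> 'a"
    have lin: "Vector_Spaces.linear (scale_cochain scale) (scale_cochain scale) (E b)" for b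
      unfolding Vector_Spaces.linear_iff using vector_space_fun
      by (auto simp: E_def fun_eq_iff scale_cochain_def scale_right_distrib scale_left_commute split: list.split)
    define F' where "F' = (\<Union>b\<in>B. E b ` F)"
    have "f \<in> fv.span F'" if f: "mlin scale scale f" "\<forall>xs. length xs \<noteq> Suc m \<longrightarrow> f xs = 0" for f
    proof -
      have add: "f ((x + y) # l) = f (x # l) + f (y # l)" for x y l
        using maddD[OF mlin_madd[OF f(1)], of "[]"] by simp
      have scl: "f ((k *s x) # l) = k *s f (x # l)" for k x l
        using mlin_scale[OF f(1), of "[]"] by simp
      have z: "f (0 # l) = 0" for l using scl[of 0 0] by simp
      have fsum: "f ((\<Sum>b\<in>B. c b *s b) # l) = (\<Sum>b\<in>B. c b *s f (b # l))" for c l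
        using fB by (induction B rule: finite_induct) (simp_all add: add scl z)
      have eq: "f = (\<Sum>b\<in>B. E b (\<lambda>l. f (b # l)))"
      proof
        fix xs show "f xs = (\<Sum>b\<in>B. E b (\<lambda>l. f (b # l))) xs"
        proof (cases xs)
          case Nil
          then show ?thesis using f(2) by (simp add: sum_fun_app E_def)
        next
          case (Cons x l)
          show ?thesis
            unfolding Cons sum_fun_app E_def list.case fsum[symmetric] rep ..
        qed
      qed
      have sp: "E b (\<lambda>l. f (b # l)) \<in> fv.span F'" if "b \<in> B" for b
      proof -
        interpret E: Vector_Spaces.linear "scale_cochain scale" "scale_cochain scale" "E b" by (rule lin)
        have "(\<lambda>l. f (b # l)) \<in> fv.span F"
          by (rule F(2)[OF mlin_Cons[OF f(1)]]) (use f(2) in simp)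
        then have "E b (\<lambda>l. f (b # l)) \<in> fv.span (E b ` F)"
          unfolding E.span_image by blast
        then show ?thesis
          using fv.span_mono[of "E b ` F" F'] that unfolding F'_def by blast
      qed
      show ?thesis by (subst eq) (intro fv.span_sum sp)
    qed
    then show ?case using fB F(1) by (intro exI[of _ F']) (auto simp: F'_def)
  qed
qed

lemma C_finite_span: "\<exists>F. finite F \<and> C n \<subseteq> fv.span F"
proof -
  obtain F where F: "finite F" "\<And>f. mlin scale scale f \<Longrightarrow> (\<forall>xs. length xs \<noteq> nat n \<longrightarrow> f xs = 0) \<Longrightarrow> f \<in> fv.span F"
    using multilinear_finite_span[of "nat n"] by blast
  have "f \<in> fv.span F" if "f \<in> C n" for f
    by (rule F(2)[OF C_mlin[OF that]]) (use C_homog[OF that] in \<open>auto simp: homog_def\<close>)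
  then show ?thesis using F(1) by blast
qed

lemma subspace_C: "fv.subspace (C n)"
  using C_zero C_add C_scale unfolding fv.subspace_def
  by (auto simp: scale_cochain_def plus_fun_def)

text \<open>With \<open>S = twist - 1\<close>, \<open>twist_unipotent\<close> gives that
  \<open>S (S g) = 0\<close> implies \<open>S g = 0\<close>, so \<open>S\<close> and its square have
  the same image. Choosing \<open>g\<close> with \<open>S f = S (S g)\<close> makes
  \<open>f - S g\<close> invariant.\<close>

lemma twist_decomp:
  assumes ss: "semisimple_endo scale N" and f: "f \<in> C n"
  shows "\<exists>u\<in>C n. \<exists>g\<in>C n. twist u = u \<and> (\<forall>xs. f xs = u xs + (twist g xs - g xs))"
proof -
  define S where "S = (\<lambda>f xs. twist f xs - f xs)"
  have lin: "Vector_Spaces.linear (scale_cochain scale) (scale_cochain scale) S"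
    unfolding Vector_Spaces.linear_iff using vector_space_fun
    by (auto simp: S_def fun_eq_iff scale_cochain_def plus_fun_def twist_add twist_scale scale_right_diff_distrib)
  obtain F where F: "finite F" "C n \<subseteq> fv.span F" using C_finite_span by blast
  have SC: "S g \<in> C n" if "g \<in> C n" for g
    unfolding S_def by (intro C_diff C_twist that)
  have ker: "S g = 0" if g: "g \<in> C n" "S (S g) = 0" for g
  proof -
    have "twist g = g"
    proof (rule twist_unipotent[OF ss C_mlin[OF g(1)]])
      fix xs
      have "S (S g) xs = 0" using g(2) by simp
      then show "twist (twist g) xs - twist g xs = twist g xs - g xs"
        unfolding S_def twist_diff by simp
    qed
    then show ?thesis by (simp add: S_def fun_eq_iff)
  qed
  obtain g where g: "g \<in> C n" "S f = S (S g)"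
    using fv.linear_image_stable[OF lin subspace_C _ F ker f] SC by blast
  define u where "u = (\<lambda>xs. f xs - S g xs)"
  have "u \<in> C n" unfolding u_def by (intro C_diff f SC g)
  moreover have "twist u = u"
  proof
    fix xs
    have "S f xs = S (S g) xs" using g(2) by simp
    then show "twist u xs = u xs"
      unfolding u_def twist_diff by (simp add: S_def twist_diff algebra_simps)
  qed
  ultimately show ?thesis
    using g(1) by (intro bexI[of _ u] bexI[of _ g]) (simp_all add: u_def S_def)
qed

text \<open>The non-invariant part of a cocycle is itself of the form \<open>twist g - g\<close> with \<open>g\<close> a cocycle,
  which is exact by Delta_hb.\<close>

theorem invariant_representative:
  assumes ss: "semisimple_endo scale N" and f: "f \<in> C n" "hb n f = (\<lambda>_. 0)"
  shows "\<exists>u\<in>C n. \<exists>h\<in>C (n - 1). hb n u = (\<lambda>_. 0) \<and> twist u = u \<and> (\<forall>xs. f xs - u xs = hb (n - 1) h xs)"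
proof -
  obtain u g where u: "u \<in> C n" "twist u = u" and g: "g \<in> C n" and fg: "\<And>xs. f xs = u xs + (twist g xs - g xs)"
    using twist_decomp[OF ss f(1)] by blast
  \<comment> \<open>The invariant part of \<open>g\<close> does not affect
    \<open>twist g - g\<close>. So \<open>g\<close> may be replaced by \<open>k'\<close>, which
    itself lies in the image of \<open>twist - 1\<close>; this is what makes it a cocycle.\<close>
  obtain v k where v: "v \<in> C n" "twist v = v" and k: "k \<in> C n" and gk: "\<And>xs. g xs = v xs + (twist k xs - k xs)"
    using twist_decomp[OF ss g] by blast
  define k' where "k' = (\<lambda>xs. twist k xs - k xs)"
  have k': "k' \<in> C n" unfolding k'_def by (intro C_diff C_twist k)
  have "g = (\<lambda>xs. v xs + k' xs)" using gk by (simp add: k'_def fun_eq_iff)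
  then have "twist g xs - g xs = twist k' xs - k' xs" for xs
    using v(2) by (simp add: twist_add)
  then have f': "f = (\<lambda>xs. u xs + (twist k' xs - k' xs))"
    using fg by (simp add: fun_eq_iff)
  have b0: "hb n u xs + (twist (hb n k') xs - hb n k' xs) = 0" for xs
    using f(2) unfolding f' by (simp add: fun_eq_iff hb_add hb_diff twist_hb)
  have bu: "twist (hb n u) = hb n u" using u(2) twist_hb by metis
  have m: "mlin scale scale (hb n k)" by (rule mlin_hb[OF C_mlin[OF k]])
  have hk': "hb n k' = (\<lambda>xs. twist (hb n k) xs - hb n k xs)"
    by (simp add: k'_def hb_diff twist_hb fun_eq_iff)
  \<comment> \<open>The cocycle condition on \<open>f\<close> equates
    \<open>(twist - 1) (hb n k')\<close> with \<open>- hb n u\<close>, which is invariant. Hence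
    \<open>(twist - 1)^2\<close> kills \<open>hb n k'\<close>.\<close>
  have fixk': "twist (hb n k') = hb n k'"
  proof (rule twist_unipotent[OF ss mlin_hb[OF C_mlin[OF k']]])
    fix xs
    have e: "(\<lambda>xs. twist (hb n k') xs - hb n k' xs) = (\<lambda>xs. - hb n u xs)"
      using b0 by (simp add: fun_eq_iff eq_neg_iff_add_eq_0 add.commute)
    have "twist (\<lambda>xs. twist (hb n k') xs - hb n k' xs) xs = twist (hb n k') xs - hb n k' xs"
      using fun_cong[OF e, of xs] unfolding e using twist_diff[of "\<lambda>_. 0" "hb n u" xs] bu twist_diff[of "\<lambda>_. 0" "\<lambda>_. 0" xs] by simp
    then show "twist (twist (hb n k')) xs - twist (hb n k') xs = twist (hb n k') xs - hb n k' xs"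
      unfolding twist_diff .
  qed
  then have bu0: "hb n u = (\<lambda>_. 0)" using b0 by (simp add: fun_eq_iff)
  \<comment> \<open>Now \<open>hb n k' = (twist - 1) (hb n k)\<close> is known to be invariant, so
    the same argument applies to \<open>hb n k\<close> and shows that \<open>hb n k'\<close> is
    zero.\<close>
  have "twist (hb n k) = hb n k"
  proof (rule twist_unipotent[OF ss m])
    fix xs
    have "twist (hb n k') xs = hb n k' xs" by (simp add: fixk')
    then show "twist (twist (hb n k)) xs - twist (hb n k) xs = twist (hb n k) xs - hb n k xs"
      unfolding hk' twist_diff .
  qed
  then have bk': "hb n k' = (\<lambda>_. 0)" by (simp add: hk')
  have D0: "Delta (\<lambda>_. 0) xs = 0" for xs
    unfolding Delta_def by (rule repr_eqI) (simp add: form_left rot_def)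
  have neg: "hb (n - 1) (\<lambda>xs. - Delta k' xs) xs = - hb (n - 1) (Delta k') xs" for xs
    using hb_diff[of "n - 1" "\<lambda>_. 0" "Delta k'" xs] hb_diff[of "n - 1" "\<lambda>_. 0" "\<lambda>_. 0" xs] by simp
  have d: "k' xs - twist k' xs = hb (n - 1) (Delta k') xs" for xs
    using Delta_hb[OF C_mlin[OF k'] C_homog[OF k'], of xs] unfolding bk' D0 by simp
  have "f xs - u xs = hb (n - 1) (\<lambda>xs. - Delta k' xs) xs" for xs
    unfolding neg d[symmetric] f' by simp
  moreover have "(\<lambda>xs. - Delta k' xs) \<in> C (n - 1)"
    using C_sg[OF C_Delta[OF k'], of 1] by (simp add: uminus_eq_sg)
  ultimately show ?thesis using u bu0 by blast
qed

text \<open>The invariant part \<open>v\<close> of \<open>h\<close> already works: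
  \<open>hb n h - hb n v\<close> is invariant and equals \<open>(twist - 1) (hb n g)\<close>, which
  therefore vanishes by \<open>twist_unipotent\<close>.\<close>

theorem invariant_primitive:
  assumes ss: "semisimple_endo scale N" and h: "h \<in> C n" and inv: "twist (hb n h) = hb n h"
  shows "\<exists>v\<in>C n. twist v = v \<and> hb n v = hb n h"
proof -
  obtain v g where v: "v \<in> C n" "twist v = v" and g: "g \<in> C n" and hg: "\<And>xs. h xs = v xs + (twist g xs - g xs)"
    using twist_decomp[OF ss h] by blast
  have h': "h = (\<lambda>xs. v xs + (twist g xs - g xs))" using hg by (simp add: fun_eq_iff)
  have e: "hb n h xs = hb n v xs + (twist (hb n g) xs - hb n g xs)" for xs
    unfolding h' by (simp add: hb_add hb_diff twist_hb)
  have bv: "twist (hb n v) = hb n v" using v(2) twist_hb by metis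
  have "twist (hb n g) = hb n g"
  proof (rule twist_unipotent[OF ss mlin_hb[OF C_mlin[OF g]]])
    fix xs
    have "hb n h = (\<lambda>xs. hb n v xs + (twist (hb n g) xs - hb n g xs))" using e by (simp add: fun_eq_iff)
    then have "twist (hb n h) xs = twist (hb n v) xs + (twist (twist (hb n g)) xs - twist (hb n g) xs)"
      by (simp only: twist_add twist_diff)
    then show "twist (twist (hb n g)) xs - twist (hb n g) xs = twist (hb n g) xs - hb n g xs"
      using e[of xs] by (simp add: inv bv)
  qed
  then show ?thesis using e v by (auto simp: fun_eq_iff)
qed

end

section \<open>The Gerstenhaber structure on Hochschild cohomology\<close>

text \<open>An insertion into a product goes into one of the factors. This half of the Poisson
  identity holds for cochains; the other half needs the homotopy of \<open>hb_brace\<close>.\<close>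

lemma conv_circ:
  fixes f :: "'a::{ring, monoid_mult} list \<Rightarrow> 'a"
  assumes "homog p f"
  shows "circ d (conv f g) h xs = conv (circ d f h) g xs + sg (d * p) (conv f (circ d g h) xs)"
proof -
  have "sg (d * (len s + len u)) (f s * y) = sg (d * p + d * len u) (f s * y)" for s u :: "'a list" and y
  proof (cases "len s = p")
    case True
    then show ?thesis by (intro sg_cong) (auto simp: algebra_simps)
  next
    case False
    then show ?thesis using assms by (simp add: homog_def)
  qed
  moreover have "split3 (\<lambda>u v w. split2 (\<lambda>x y. sg (d * len u) (f x * g (y @ h v # w))) u) xs
     = split3 (\<lambda>u v w. split2 (\<lambda>x y. sg (d * (len x + len y)) (f x * g (y @ h v # w))) u) xs"
    by (intro split3_cong split2_cong sg_cong) auto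
  ultimately have "split3 (\<lambda>u v w. split2 (\<lambda>x y. sg (d * len u) (f x * g (y @ h v # w))) u) xs
     = sg (d * p) (conv f (circ d g h) xs)"
    unfolding split3_split2_left conv_def circ_def ins_def sums_mult sg_mult_right push_sg by simp
  moreover have "split3 (\<lambda>u v w. split2 (\<lambda>x y. sg (d * len u) (f (u @ h v # x) * g y)) w) xs
     = conv (circ d f h) g xs"
    unfolding split3_split2_right conv_def circ_def ins_def sums_mult sg_mult_left ..
  ultimately show ?thesis
    unfolding circ_def[of _ "conv f g"] ins_def[of _ h]
    unfolding conv_def[of f g] split2_middle sg_add split3_add sums_sg[symmetric]
    by (simp add: add.commute)
qed

lemma conv_assoc: "conv (conv f g) h xs = conv f (conv g h) xs"
  by (simp add: conv_def sums_mult split2_assoc mult.assoc)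

lemma conv_add_left: "conv (\<lambda>xs. f xs + g xs) h xs = conv f h xs + conv g h xs"
  and conv_add_right: "conv h (\<lambda>xs. f xs + g xs) xs = conv h f xs + conv h g xs"
  and conv_diff_left: "conv (\<lambda>xs. f xs - g xs) h xs = conv f h xs - conv g h xs"
  and conv_diff_right: "conv h (\<lambda>xs. f xs - g xs) xs = conv h f xs - conv h g xs"
  and conv_sg_left: "conv (\<lambda>xs. sg n (f xs)) h xs = sg n (conv f h xs)"
  and conv_sg_right: "conv h (\<lambda>xs. sg n (f xs)) xs = sg n (conv h f xs)"
  by (simp_all only: conv_def distrib_left distrib_right left_diff_distrib right_diff_distrib
      sg_mult_left sg_mult_right sums_add sums_diff sums_sg)

lemmas conv_linear = conv_add_left conv_add_right conv_diff_left conv_diff_right conv_sg_left conv_sg_right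

text \<open>The Leibniz rule. A letter between the two factors can be multiplied to either one with
  the same result, so these two outer terms cancel; the sign conventions put \<open>sg q\<close> on
  the left factor.\<close>

lemma hb_conv:
  fixes f :: "'a::{ring, monoid_mult} list \<Rightarrow> 'a"
  assumes "homog p f"
  shows "hb (p + q) (conv f g) xs = conv f (hb q g) xs + sg q (conv (hb p f) g xs)"
proof -
  have r: "rmul (conv f g) xs = conv f (rmul g) xs"
    unfolding rmul_def conv_def sums_mult on_last_additive[of "\<lambda>y. x * y" for x, OF distrib_left] split2_on_last_right
    by (simp add: mult.assoc)
  have l: "lmul (conv f g) xs = conv (lmul f) g xs"
    unfolding lmul_def conv_def sums_mult on_hd_additive[of "\<lambda>x. x * y" for y, OF distrib_right] split2_on_hd_left
    by (simp add: mult.assoc)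
  have e: "conv (rmul f) g xs = conv f (lmul g) xs"
    unfolding rmul_def lmul_def conv_def on_last_additive[of "\<lambda>x. x * y" for y, OF distrib_right]
      on_hd_additive[of "\<lambda>y. x * y" for x, OF distrib_left] split2_on_last_left
    by (simp add: mult.assoc)
  have s: "sg (len s + len x) (f s * y) = sg (p + len x) (f s * y)" for s x :: "'a list" and y
    by (cases "len s = p") (use assms in \<open>auto simp: homog_def\<close>)
  have c: "contr (conv f g) xs = sg p (conv f (contr g) xs) + conv (contr f) g xs"
  proof -
    have "contr (conv f g) xs = adj2 (\<lambda>x a b z. split2 (\<lambda>s t. sg (len x) (f s * g (t @ (a * b) # z))) x) xs
       + adj2 (\<lambda>x a b z. split2 (\<lambda>s t. sg (len x) (f (x @ (a * b) # s) * g t)) z) xs"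
      unfolding contr_def conv_def split2_middle sg_add adj2_add sums_sg ..
    also have "adj2 (\<lambda>x a b z. split2 (\<lambda>s t. sg (len x) (f s * g (t @ (a * b) # z))) x) xs
       = adj2 (\<lambda>x a b z. split2 (\<lambda>s t. sg (len s + len t) (f s * g (t @ (a * b) # z))) x) xs"
      by (intro adj2_cong split2_cong sg_cong) auto
    also have "\<dots> = sg p (conv f (contr g) xs)"
      unfolding s contr_def conv_def adj2_additive[of "\<lambda>y. x * y" for x, OF distrib_left] sg_mult_right
        push_sg adj2_split2_right ..
    also have "adj2 (\<lambda>x a b z. split2 (\<lambda>s t. sg (len x) (f (x @ (a * b) # s) * g t)) z) xs = conv (contr f) g xs"
      unfolding contr_def conv_def adj2_additive[of "\<lambda>x. x * y" for y, OF distrib_right] sg_mult_left adj2_split2_left ..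
    finally show ?thesis .
  qed
  have hf: "hb p f = (\<lambda>xs. rmul f xs + sg (p + 1) (lmul f xs - contr f xs))"
    and hg: "hb q g = (\<lambda>xs. rmul g xs + sg (q + 1) (lmul g xs - contr g xs))"
    by (simp_all add: hb_eq fun_eq_iff)
  show ?thesis
    unfolding hf hg hb_eq[of _ "conv f g"] r l c conv_linear e by (simp add: sg_def)
qed

text \<open>The parameters are the shifted degrees, one less than the degrees of \<open>f\<close>
  and \<open>g\<close>.\<close>

definition br :: "int \<Rightarrow> int \<Rightarrow> ('a list \<Rightarrow> 'a) \<Rightarrow> ('a list \<Rightarrow> 'a) \<Rightarrow> 'a list \<Rightarrow> 'a::{ring, monoid_mult}" where
  "br p q f g = (\<lambda>xs. circ q f g xs - sg (p * q) (circ p g f xs))"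

lemma br_antisym: "br p q f g xs = - sg (p * q) (br q p g f xs)"
  by (simp add: br_def sg_def mult.commute)

lemma circ_right:
  assumes "madd f"
  shows "circ d f (\<lambda>xs. g xs + h xs) xs = circ d f g xs + circ d f h xs"
    "circ d f (\<lambda>xs. g xs - h xs) xs = circ d f g xs - circ d f h xs"
    "circ d f (\<lambda>xs. sg n (g xs)) xs = sg n (circ d f g xs)"
  unfolding circ_def ins_def paddD[OF padd_madd[OF assms]] padd_diff[OF padd_madd[OF assms]] padd_sg[OF padd_madd[OF assms]]
    sg_add sg_diff split3_add split3_diff push_sg
  by (simp_all add: add.commute)

lemmas circ_left = circ_add circ_diff circ_sg

text \<open>The iterated insertions are expanded by \<open>circ_circ\<close>. Nested insertions
  cancel directly, and the braces cancel in pairs by their symmetry.\<close>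

lemma br_jacobi:
  assumes f: "madd f" "homog (p + 1) f" and g: "madd g" "homog (q + 1) g" and h: "madd h" "homog (r + 1) h"
  shows "br p (q + r) f (br q r g h) xs = br (p + q) r (br p q f g) h xs + sg (p * q) (br q (p + r) g (br p r f h) xs)"
proof -
  have cc: "circ e (circ m F G) H xs = circ (m + e) F (circ e G H) xs
     + sg (m * e) (brace m e F G H xs) + brace e m F H G xs" if "madd F" "homog (m + 1) G" for e m F G H
    using circ_circ[OF that, of e H xs] by simp
  show ?thesis
    unfolding br_def circ_left circ_right[OF f(1)] circ_right[OF g(1)] circ_right[OF h(1)]
      cc[OF f(1) g(2)] cc[OF f(1) h(2)] cc[OF g(1) f(2)] cc[OF g(1) h(2)] cc[OF h(1) f(2)] cc[OF h(1) g(2)]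
    by (cases "even p"; cases "even q"; cases "even r"; simp add: sg_def add.commute)
qed

text \<open>The cup products in \<open>hb_circ\<close> for \<open>f\<close>, \<open>g\<close> and
  for \<open>g\<close>, \<open>f\<close> cancel against each other. So the bracket of a coboundary
  with a cocycle is a coboundary, with an explicit primitive.\<close>

lemma hb_br:
  assumes f: "madd f" "homog p f" and g: "madd g" "homog q g" "hb q g = (\<lambda>_. 0)"
  shows "br (p - 1 + 1) (q - 1) (hb p f) g xs
    = hb (p + q - 1) (\<lambda>xs. circ (q - 1) f g xs + sg (p * (q - 1) + q) (circ (p - 1) g f xs)) xs"
proof -
  have z: "circ q f (\<lambda>_. 0) xs = 0" "circ (p - 1) (\<lambda>_. 0) f xs = 0"
    using madd_zero[OF f(1)] by (simp_all add: circ_def ins_def)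
  have 1: "circ (q - 1) (hb p f) g xs = hb (p + q - 1) (circ (q - 1) f g) xs
      + sg ((q - 1) * p) (conv f g xs) - sg p (conv g f xs)"
    using hb_circ[OF f g(2), of xs] by (simp add: g(3) z)
  have 2: "circ p g (hb p f) xs = sg q (- hb (p + q - 1) (circ (p - 1) g f) xs
      - sg ((p - 1) * q) (conv g f xs) + sg q (conv f g xs))"
    using hb_circ[OF g(1,2) f(2), of xs]
    by (cases "even p"; cases "even q"; simp add: g(3) z sg_def add.commute[of q p])
  show ?thesis
    unfolding br_def diff_add_cancel 1 2
    unfolding hb_add hb_sg
    by (cases "even p"; cases "even q"; simp add: sg_def)
qed

section \<open>Cohomology classes and independence of representatives\<close>

context k_algebra
begin

abbreviation Z :: "int \<Rightarrow> ('a list \<Rightarrow> 'a) set" where "Z \<equiv> cocycles scale"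

abbreviation H :: "int \<Rightarrow> ('k, ('a list \<Rightarrow> 'a) set) module" where "H \<equiv> HH scale"

abbreviation cls :: "int \<Rightarrow> ('a list \<Rightarrow> 'a) \<Rightarrow> ('a list \<Rightarrow> 'a) set" where "cls \<equiv> HH_class scale"

lemma cocycles_iff: "f \<in> Z n \<longleftrightarrow> f \<in> C n \<and> hb n f = (\<lambda>_. 0)"
  unfolding cocycles_def using hochschild_b_eq by (auto simp: fun_eq_iff)

lemma ZD: assumes "f \<in> Z n" shows "f \<in> C n" "hb n f = (\<lambda>_. 0)" "homog n f" "madd f"
  using assms by (auto simp: cocycles_iff cochains_iff intro: nml_madd)

lemma CD: assumes "f \<in> C n" shows "homog n f" "madd f"
  using assms by (auto simp: cochains_iff intro: nml_madd)

lemma Z_zero: "(\<lambda>_. 0) \<in> Z n"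
  using C_zero by (simp add: cocycles_iff hb_zero zero_fun_def fun_eq_iff)

lemma Z_add: "f \<in> Z n \<Longrightarrow> g \<in> Z n \<Longrightarrow> (\<lambda>xs. f xs + g xs) \<in> Z n"
  by (simp add: cocycles_iff C_add hb_add fun_eq_iff)

lemma Z_sg: "f \<in> Z n \<Longrightarrow> (\<lambda>xs. sg k (f xs)) \<in> Z n"
  by (simp add: cocycles_iff C_sg hb_sg fun_eq_iff)

lemma Z_uminus: "f \<in> Z n \<Longrightarrow> (\<lambda>xs. - f xs) \<in> Z n"
  using Z_sg[of f n 1] by (simp add: uminus_eq_sg)

lemma hb_scale: "hb r (\<lambda>xs. c *s f xs) xs = c *s hb r f xs"
  by (simp add: hb_def contr_def scale_mult_left scale_mult_right t_sums t_simps flip: t_simps)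

lemma Z_scale: "f \<in> Z n \<Longrightarrow> (\<lambda>xs. c *s f xs) \<in> Z n"
  by (simp add: cocycles_iff C_scale hb_scale fun_eq_iff)

lemma conv_zero: "conv (\<lambda>_. 0) g xs = 0" "conv g (\<lambda>_. 0) xs = 0"
  by (simp_all add: conv_def)

lemma conv_scale: "conv (\<lambda>xs. c *s f xs) g xs = c *s conv f g xs" "conv g (\<lambda>xs. c *s f xs) xs = c *s conv g f xs"
  by (simp_all add: conv_def scale_mult_left scale_mult_right t_sums)

lemma Z_conv:
  assumes "f \<in> Z p" "g \<in> Z q"
  shows "conv f g \<in> Z (p + q)"
proof -
  have "hb (p + q) (conv f g) xs = 0" for xs
    unfolding hb_conv[OF ZD(3)[OF assms(1)]] ZD(2)[OF assms(1)] ZD(2)[OF assms(2)] by (simp add: conv_zero)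
  then show ?thesis using C_conv[OF ZD(1)[OF assms(1)] ZD(1)[OF assms(2)]] by (simp add: cocycles_iff fun_eq_iff)
qed

lemma C_br:
  assumes "f \<in> C p" "g \<in> C q"
  shows "br d e f g \<in> C (p + q - 1)"
  unfolding br_def using C_circ[OF assms] C_circ[OF assms(2,1)] by (intro C_diff C_sg) (simp_all add: add.commute)

lemma hb_circ_cocycles:
  assumes "f \<in> Z p" "g \<in> Z q"
  shows "hb (p + q - 1) (circ (q - 1) f g) xs = sg p (conv g f xs) - sg ((q - 1) * p) (conv f g xs)"
proof -
  have "circ q f (\<lambda>_. 0) xs = 0" "circ (q - 1) (\<lambda>_. 0) g xs = 0"
    using madd_zero[OF ZD(4)[OF assms(1)]] by (simp_all add: circ_def ins_def)
  then show ?thesis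
    using hb_circ[OF ZD(4,3)[OF assms(1)] ZD(3)[OF assms(2)], of xs] ZD(2)[OF assms(1)] ZD(2)[OF assms(2)] by simp
qed

lemma Z_br:
  assumes "f \<in> Z p" "g \<in> Z q"
  shows "br (p - 1) (q - 1) f g \<in> Z (p + q - 1)"
proof -
  have "hb (p + q - 1) (br (p - 1) (q - 1) f g) xs = 0" for xs
    unfolding br_def hb_diff hb_sg hb_circ_cocycles[OF assms]
      hb_circ_cocycles[OF assms(2,1), unfolded add.commute[of q p]]
    by (simp add: sg_def)
  then show ?thesis using C_br[OF ZD(1)[OF assms(1)] ZD(1)[OF assms(2)]] by (simp add: cocycles_iff fun_eq_iff)
qed

lemma cohomologous_iff:
  "(f, g) \<in> cohomologous scale n \<longleftrightarrow> f \<in> Z n \<and> g \<in> Z n \<and> (\<exists>h\<in>C (n - 1). \<forall>xs. f xs - g xs = hb (n - 1) h xs)"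
  unfolding cohomologous_def coboundaries_def using hochschild_b_eq[of _ "n - 1"] by (auto simp: fun_eq_iff image_iff)

lemma equiv_cohomologous: "equiv (Z n) (cohomologous scale n)"
proof (rule equivI)
  show "cohomologous scale n \<subseteq> Z n \<times> Z n" by (auto simp: cohomologous_iff)
  have "(\<lambda>_. 0) \<in> C (n - 1)" using Z_zero by (simp add: cocycles_iff)
  then show "refl_on (Z n) (cohomologous scale n)"
    unfolding refl_on_def by (metis cohomologous_iff hb_zero diff_self)
  show "sym (cohomologous scale n)"
  proof (rule symI)
    fix f g assume "(f, g) \<in> cohomologous scale n"
    then obtain h where h: "f \<in> Z n" "g \<in> Z n" "h \<in> C (n - 1)" "\<And>xs. f xs - g xs = hb (n - 1) h xs"
      unfolding cohomologous_iff by metis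
    have "g xs - f xs = hb (n - 1) (\<lambda>xs. sg 1 (h xs)) xs" for xs
      unfolding hb_sg h(4)[symmetric] by (simp add: sg_def)
    then show "(g, f) \<in> cohomologous scale n"
      unfolding cohomologous_iff using h(1,2) C_sg[OF h(3)] by blast
  qed
  show "trans (cohomologous scale n)"
  proof (rule transI)
    fix f g k assume "(f, g) \<in> cohomologous scale n" "(g, k) \<in> cohomologous scale n"
    then obtain h h' where h: "f \<in> Z n" "k \<in> Z n" "h \<in> C (n - 1)" "\<And>xs. f xs - g xs = hb (n - 1) h xs"
      "h' \<in> C (n - 1)" "\<And>xs. g xs - k xs = hb (n - 1) h' xs"
      unfolding cohomologous_iff by metis
    have "f xs - k xs = hb (n - 1) (\<lambda>xs. h xs + h' xs) xs" for xs
      unfolding hb_add h(4,6)[symmetric] by simp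
    then show "(f, k) \<in> cohomologous scale n"
      unfolding cohomologous_iff using h(1,2) C_add[OF h(3,5)] by blast
  qed
qed

lemma cls_eq_iff:
  assumes "f \<in> Z n" "g \<in> Z n"
  shows "cls n f = cls n g \<longleftrightarrow> (\<exists>h\<in>C (n - 1). \<forall>xs. f xs - g xs = hb (n - 1) h xs)"
  using eq_equiv_class_iff[OF equiv_cohomologous assms] assms unfolding HH_class_def cohomologous_iff by simp

lemma cls_eqI:
  assumes "f \<in> Z n" "g \<in> Z n" "h \<in> C m" "m = n - 1" "\<And>xs. f xs - g xs = hb m h xs"
  shows "cls n f = cls n g"
  using assms cls_eq_iff by blast

lemma cls_eqE:
  assumes "cls n f = cls n g" "f \<in> Z n" "g \<in> Z n"
  obtains h where "h \<in> C (n - 1)" "f = (\<lambda>xs. g xs + hb (n - 1) h xs)"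
proof -
  obtain h where "h \<in> C (n - 1)" "\<And>xs. f xs - g xs = hb (n - 1) h xs"
    using assms cls_eq_iff by blast
  then show ?thesis by (intro that[of h]) (auto simp: fun_eq_iff algebra_simps)
qed

lemma mem_cls: "f' \<in> cls n f \<longleftrightarrow> f \<in> Z n \<and> f' \<in> Z n \<and> cls n f' = cls n f"
  unfolding HH_class_def Image_singleton_iff
  using equiv_class_eq_iff[OF equiv_cohomologous] by (metis equiv_class_eq equiv_cohomologous)

text \<open>The unions in the definitions of the operations collapse once the result is independent
  of the representative; the class is nonempty because it contains \<open>f\<close>.\<close>

lemma UN_cls:
  assumes "f \<in> Z n" "\<And>f'. f' \<in> Z n \<Longrightarrow> cls n f' = cls n f \<Longrightarrow> F f' = A"
  shows "(\<Union>f'\<in>cls n f. F f') = A"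
  using assms by (auto simp: mem_cls)

lemma carrier_HH: "x \<in> carrier (H n) \<longleftrightarrow> (\<exists>f\<in>Z n. x = cls n f)"
  by (auto simp: HH_def quotient_def HH_class_def)

lemma cls_in_carrier: "f \<in> Z n \<Longrightarrow> cls n f \<in> carrier (H n)"
  by (auto simp: carrier_HH)

lemma carrierE:
  assumes "x \<in> carrier (H n)"
  obtains f where "f \<in> Z n" "x = cls n f"
  using assms by (auto simp: carrier_HH)

lemma zero_HH: "\<zero>\<^bsub>H n\<^esub> = cls n (\<lambda>_. 0)"
  by (simp add: HH_def zero_fun_def)

lemma add_HH:
  assumes "f \<in> Z n" "g \<in> Z n"
  shows "cls n f \<oplus>\<^bsub>H n\<^esub> cls n g = cls n (\<lambda>xs. f xs + g xs)"
proof -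
  have "cls n (f' + g') = cls n (\<lambda>xs. f xs + g xs)"
    if f': "f' \<in> Z n" "cls n f' = cls n f" and g': "g' \<in> Z n" "cls n g' = cls n g" for f' g'
  proof -
    obtain h h' where "h \<in> C (n - 1)" "f' = (\<lambda>xs. f xs + hb (n - 1) h xs)" "h' \<in> C (n - 1)" "g' = (\<lambda>xs. g xs + hb (n - 1) h' xs)"
      using cls_eqE[OF f'(2,1) assms(1)] cls_eqE[OF g'(2,1) assms(2)] by metis
    then show ?thesis
      using Z_add[OF f'(1) g'(1)] Z_add[OF assms]
      by (intro cls_eqI[of _ _ _ "\<lambda>xs. h xs + h' xs"]) (auto simp: plus_fun_def hb_add intro: C_add)
  qed
  then show ?thesis
    unfolding HH_def by (simp, intro UN_cls assms) blast+
qed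

lemma smult_HH:
  assumes "f \<in> Z n"
  shows "c \<odot>\<^bsub>H n\<^esub> cls n f = cls n (\<lambda>xs. c *s f xs)"
proof -
  have "cls n (scale_cochain scale c f') = cls n (\<lambda>xs. c *s f xs)" if f': "f' \<in> Z n" "cls n f' = cls n f" for f'
  proof -
    obtain h where "h \<in> C (n - 1)" "f' = (\<lambda>xs. f xs + hb (n - 1) h xs)"
      using cls_eqE[OF f'(2,1) assms] by metis
    then show ?thesis
      using Z_scale[OF f'(1), of c] Z_scale[OF assms, of c]
      by (intro cls_eqI[of _ _ _ "\<lambda>xs. c *s h xs"]) (auto simp: scale_cochain_def hb_scale scale_right_distrib intro: C_scale)
  qed
  then show ?thesis
    unfolding HH_def by (simp, intro UN_cls assms)
qed

lemma smult_powi_HH: "f \<in> Z n \<Longrightarrow> (-1) powi k \<odot>\<^bsub>H n\<^esub> cls n f = cls n (\<lambda>xs. sg k (f xs))"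
  by (simp add: smult_HH scale_powi)

lemma cup_HH:
  assumes f: "f \<in> Z p" and g: "g \<in> Z q"
  shows "HH_cup scale p q (cls p f) (cls q g) = cls (p + q) (\<lambda>xs. sg (p * q) (conv f g xs))"
proof -
  have "cls (p + q) (cup_cochain scale p q f' g') = cls (p + q) (\<lambda>xs. sg (p * q) (conv f g xs))"
    if f': "f' \<in> Z p" "cls p f' = cls p f" and g': "g' \<in> Z q" "cls q g' = cls q g" for f' g'
  proof -
    obtain h k where h: "h \<in> C (p - 1)" "f' = (\<lambda>xs. f xs + hb (p - 1) h xs)" and k: "k \<in> C (q - 1)" "g' = (\<lambda>xs. g xs + hb (q - 1) k xs)"
      using cls_eqE[OF f'(2,1) f] cls_eqE[OF g'(2,1) g] by metis
    have 1: "conv (hb (p - 1) h) g' xs = sg q (hb (p + q - 1) (conv h g') xs)" for xs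
      using hb_conv[OF CD(1)[OF h(1)], of q g' xs] ZD(2)[OF g'(1)] by (simp add: conv_zero sg_def algebra_simps)
    have 2: "conv f (hb (q - 1) k) xs = hb (p + q - 1) (conv f k) xs" for xs
      using hb_conv[OF ZD(3)[OF f], of "q - 1" k xs] ZD(2)[OF f] by (simp add: conv_zero algebra_simps)
    have d: "conv f' g' xs = conv f g xs + (conv (hb (p - 1) h) g' xs + conv f (hb (q - 1) k) xs)" for xs
    proof -
      have "conv f' g' xs = conv f g' xs + conv (hb (p - 1) h) g' xs"
        using h(2) by (simp add: conv_add_left)
      also have "conv f g' xs = conv f g xs + conv f (hb (q - 1) k) xs"
        using k(2) by (simp add: conv_add_right)
      finally show ?thesis by (simp add: algebra_simps)
    qed
    \<comment> \<open>The primitive of the difference of the two products: by the Leibniz rule,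
      changing \<open>f\<close> contributes \<open>conv h g'\<close> and changing \<open>g\<close>
      contributes \<open>conv f k\<close>.\<close>
    have "(\<lambda>xs. sg (p * q) (sg q (conv h g' xs) + conv f k xs)) \<in> C (p + q - 1)"
      using C_conv[OF h(1) ZD(1)[OF g'(1)]] C_conv[OF ZD(1)[OF f] k(1)]
      by (intro C_sg C_add) (simp_all add: algebra_simps)
    then show ?thesis
      unfolding cup_cochain_eq[OF ZD(1)[OF f'(1)] ZD(1)[OF g'(1)]]
      using Z_sg[OF Z_conv[OF f'(1) g'(1)]] Z_sg[OF Z_conv[OF f g]]
      by (intro cls_eqI) (auto simp: hb_sg hb_add d 1 2 sg_add)
  qed
  then show ?thesis
    unfolding HH_cup_def by (intro UN_cls f g) blast+
qed

lemma br_left: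
  assumes g: "g \<in> C n"
  shows "br p q (\<lambda>xs. f xs + f' xs) g xs = br p q f g xs + br p q f' g xs"
    "br p q (\<lambda>xs. c *s f xs) g xs = c *s br p q f g xs"
proof -
  show "br p q (\<lambda>xs. f xs + f' xs) g xs = br p q f g xs + br p q f' g xs"
    by (simp add: br_def circ_left circ_right[OF CD(2)[OF g]] sg_add)
  have "mlin scale scale g" using g unfolding mlin_iff_nml cochains_iff by (blast intro: nml_mono)
  then have m: "g (us @ (c *s a) # ws) = c *s g (us @ a # ws)" for us a ws by (rule mlin_scale)
  have "circ q (\<lambda>xs. c *s f xs) g xs = c *s circ q f g xs"
    unfolding circ_def ins_def t_simps(3)[symmetric] t_sums ..
  moreover have "circ p g (\<lambda>xs. c *s f xs) xs = c *s circ p g f xs"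
    unfolding circ_def ins_def m t_simps(3)[symmetric] t_sums ..
  ultimately show "br p q (\<lambda>xs. c *s f xs) g xs = c *s br p q f g xs"
    by (simp add: br_def t_simps)
qed

lemma br_right:
  assumes g: "g \<in> C n"
  shows "br p q g (\<lambda>xs. f xs + f' xs) xs = br p q g f xs + br p q g f' xs"
    "br p q g (\<lambda>xs. c *s f xs) xs = c *s br p q g f xs"
  unfolding br_antisym[of p q g] br_left[OF g] by (simp_all add: sg_add t_simps)

lemma cls_br_left:
  assumes "f \<in> Z p" "f' \<in> Z p" "cls p f' = cls p f" and g: "g \<in> Z q"
  shows "cls (p + q - 1) (br (p - 1) (q - 1) f' g) = cls (p + q - 1) (br (p - 1) (q - 1) f g)"
proof -
  obtain h where h: "h \<in> C (p - 1)" "f' = (\<lambda>xs. f xs + hb (p - 1) h xs)"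
    using cls_eqE[OF assms(3,2,1)] by metis
  let ?k = "\<lambda>xs. circ (q - 1) h g xs + sg ((p - 1) * (q - 1) + q) (circ (p - 1 - 1) g h xs)"
  have "br (p - 1) (q - 1) (hb (p - 1) h) g xs = hb (p - 1 + q - 1) ?k xs" for xs
    using hb_br[OF CD(2,1)[OF h(1)] ZD(4,3,2)[OF g], of xs] by simp
  moreover have "?k \<in> C (p - 1 + q - 1)"
    using C_circ[OF h(1) ZD(1)[OF g]] C_circ[OF ZD(1)[OF g] h(1)]
    by (intro C_add C_sg) (simp_all add: add.commute)
  ultimately show ?thesis
    using Z_br[OF assms(1) g] Z_br[OF assms(2) g]
    by (intro cls_eqI) (auto simp: h(2) br_left(1)[OF ZD(1)[OF g]])
qed

lemma cls_sg_cong: "f \<in> Z n \<Longrightarrow> g \<in> Z n \<Longrightarrow> cls n f = cls n g \<Longrightarrow> cls n (\<lambda>xs. sg k (f xs)) = cls n (\<lambda>xs. sg k (g xs))"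
  using smult_powi_HH by metis

lemma bracket_HH:
  assumes f: "f \<in> Z p" and g: "g \<in> Z q"
  shows "HH_bracket scale p q (cls p f) (cls q g) = cls (p + q - 1) (br (p - 1) (q - 1) f g)"
proof -
  have "cls (p + q - 1) (bracket_cochain scale p q f' g') = cls (p + q - 1) (br (p - 1) (q - 1) f g)"
    if f': "f' \<in> Z p" "cls p f' = cls p f" and g': "g' \<in> Z q" "cls q g' = cls q g" for f' g'
  proof -
    \<comment> \<open>\<open>cls_br_left\<close> changes the left representative only; antisymmetry
      reduces the right one to it.\<close>
    have a: "br (p - 1) (q - 1) f k = (\<lambda>xs. sg (1 + (p - 1) * (q - 1)) (br (q - 1) (p - 1) k f xs))" for k
      unfolding fun_eq_iff by (subst br_antisym) (simp add: uminus_eq_sg)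
    have b: "cls (p + q - 1) (br (q - 1) (p - 1) g' f) = cls (p + q - 1) (br (q - 1) (p - 1) g f)"
      using cls_br_left[OF g g' f] by (simp add: add.commute)
    have "bracket_cochain scale p q f' g' = br (p - 1) (q - 1) f' g'"
      unfolding bracket_cochain_eq[OF ZD(1)[OF f'(1)] ZD(1)[OF g'(1)]] br_def ..
    then have "cls (p + q - 1) (bracket_cochain scale p q f' g') = cls (p + q - 1) (br (p - 1) (q - 1) f' g')"
      by simp
    also have "\<dots> = cls (p + q - 1) (br (p - 1) (q - 1) f g')"
      by (rule cls_br_left[OF f f' g'(1)])
    also have "\<dots> = cls (p + q - 1) (br (p - 1) (q - 1) f g)"
      unfolding a using Z_br[OF g'(1) f] Z_br[OF g f] b by (intro cls_sg_cong) (simp_all add: add.commute)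
    finally show ?thesis .
  qed
  then show ?thesis
    unfolding HH_bracket_def by (intro UN_cls f g) blast+
qed

section \<open>Linear structure on the cohomology and the Gerstenhaber axioms\<close>

lemma abelian_group_HH: "abelian_group (H n)"
proof (rule abelian_groupI)
  fix x y z assume "x \<in> carrier (H n)" "y \<in> carrier (H n)" "z \<in> carrier (H n)"
  then obtain f g h where "f \<in> Z n" "g \<in> Z n" "h \<in> Z n" "x = cls n f" "y = cls n g" "z = cls n h"
    by (meson carrierE)
  then show "x \<oplus>\<^bsub>H n\<^esub> y \<oplus>\<^bsub>H n\<^esub> z = x \<oplus>\<^bsub>H n\<^esub> (y \<oplus>\<^bsub>H n\<^esub> z)"
    by (simp add: add_HH Z_add add.assoc)
next
  fix x assume "x \<in> carrier (H n)"
  then obtain f where f: "f \<in> Z n" "x = cls n f" by (meson carrierE)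
  then show "\<exists>y\<in>carrier (H n). y \<oplus>\<^bsub>H n\<^esub> x = \<zero>\<^bsub>H n\<^esub>"
    by (intro bexI[of _ "cls n (\<lambda>xs. - f xs)"]) (simp_all add: add_HH Z_uminus zero_HH cls_in_carrier)
next
  show "\<zero>\<^bsub>H n\<^esub> \<in> carrier (H n)"
    unfolding zero_HH by (rule cls_in_carrier[OF Z_zero])
next
  fix x y assume "x \<in> carrier (H n)" "y \<in> carrier (H n)"
  then obtain f g where "f \<in> Z n" "g \<in> Z n" "x = cls n f" "y = cls n g"
    by (meson carrierE)
  then show "x \<oplus>\<^bsub>H n\<^esub> y \<in> carrier (H n)" "x \<oplus>\<^bsub>H n\<^esub> y = y \<oplus>\<^bsub>H n\<^esub> x"
    by (simp_all add: add_HH cls_in_carrier Z_add add.commute)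
next
  fix x assume "x \<in> carrier (H n)"
  then obtain f where "f \<in> Z n" "x = cls n f" by (meson carrierE)
  then show "\<zero>\<^bsub>H n\<^esub> \<oplus>\<^bsub>H n\<^esub> x = x"
    by (simp add: zero_HH add_HH Z_zero)
qed

lemma vectorspace_HH: "vectorspace class_ring (H n)"
proof -
  have "module class_ring (H n)"
  proof (rule moduleI)
    show "cring (class_ring :: 'k ring)" by (rule domain.axioms(1)[OF field.axioms(1)[OF class_field]])
  next
    fix c x assume "x \<in> carrier (H n)"
    then show "c \<odot>\<^bsub>H n\<^esub> x \<in> carrier (H n)"
      by (auto elim!: carrierE simp: smult_HH intro!: cls_in_carrier Z_scale)
  qed (auto simp: abelian_group_HH carrier_HH smult_HH add_HH Z_scale Z_add scale_left_distrib scale_right_distrib)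
  then show ?thesis
    unfolding vectorspace_def using class_field by blast
qed

lemma linear_map_HH:
  assumes "\<And>f. f \<in> Z n \<Longrightarrow> F f \<in> Z m \<and> T (cls n f) = cls m (F f)"
    and "\<And>f g. f \<in> Z n \<Longrightarrow> g \<in> Z n \<Longrightarrow> F (\<lambda>xs. f xs + g xs) = (\<lambda>xs. F f xs + F g xs)"
    and "\<And>c f. f \<in> Z n \<Longrightarrow> F (\<lambda>xs. c *s f xs) = (\<lambda>xs. c *s F f xs)"
  shows "linear_map class_ring (H n) (H m) T"
proof -
  have "T \<in> LinearCombinations.module_hom class_ring (H n) (H m)"
    unfolding LinearCombinations.module_hom_def using assms
    by (auto elim!: carrierE simp: add_HH smult_HH Z_add Z_scale intro!: cls_in_carrier)
  then show ?thesis
    unfolding linear_map_def mod_hom_def mod_hom_axioms_def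
    using vectorspace_HH vectorspace.axioms(1) by blast
qed

lemma a_inv_HH: "f \<in> Z n \<Longrightarrow> \<ominus>\<^bsub>H n\<^esub> cls n f = cls n (\<lambda>xs. - f xs)"
  by (rule abelian_group.minus_equality[OF abelian_group_HH])
    (simp_all add: add_HH Z_uminus zero_HH cls_in_carrier)

lemma a_minus_HH: "f \<in> Z n \<Longrightarrow> g \<in> Z n \<Longrightarrow> cls n f \<ominus>\<^bsub>H n\<^esub> cls n g = cls n (\<lambda>xs. f xs - g xs)"
  by (simp add: a_minus_def a_inv_HH add_HH Z_uminus)

lemma Z_one: "one_cochain \<in> Z 0"
proof -
  have "contr one_cochain xs = adj2 (\<lambda>x a b z. 0) xs" for xs :: "'a list"
    unfolding contr_def by (rule adj2_cong) (simp add: one_cochain_def)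
  then have "hb 0 one_cochain xs = 0" for xs :: "'a list"
    by (cases xs) (auto simp: hb_def one_cochain_def on_last_def sg_def)
  moreover have "one_cochain \<in> C 0"
    by (auto simp: cochains_iff homog_def nml_def nlin_def one_cochain_def)
  ultimately show ?thesis by (simp add: cocycles_iff fun_eq_iff)
qed

lemma conv_one: "conv one_cochain f = f" "conv f one_cochain = f"
proof -
  have "conv one_cochain f xs = split2 (\<lambda>u v. if u = [] then f v else 0) xs"
    "conv f one_cochain xs = split2 (\<lambda>u v. if v = [] then f u else 0) xs" for xs
    unfolding conv_def one_cochain_def by (intro split2_cong, simp)+
  then show "conv one_cochain f = f" "conv f one_cochain = f"
    unfolding split2_unit_left split2_unit_right by blast+
qed

text \<open>Of the two terms of the bracket, insertion of the product into \<open>f\<close> is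
  treated by \<open>hb_brace\<close>, and insertion of \<open>f\<close> into the product by
  \<open>conv_circ\<close>. The primitive is the one supplied by the brace.\<close>

lemma poisson_cocycles:
  assumes f: "f \<in> Z p" and g: "g \<in> Z q" and h: "h \<in> Z r"
  shows "br (p - 1) (q + r - 1) f (\<lambda>xs. sg (q * r) (conv g h xs)) xs
    - (sg ((p + q - 1) * r) (conv (br (p - 1) (q - 1) f g) h xs)
      + sg ((p - 1) * q) (sg (q * (p + r - 1)) (conv g (br (p - 1) (r - 1) f h) xs)))
    = hb (p + q + r - 2) (\<lambda>xs. sg (q * r + r + p) (brace (q - 1) (r - 1) f g h xs)) xs"
proof -
  have 1: "circ (q + r - 1) f (conv g h) xs = conv g (circ (r - 1) f h) xs + sg (r * (p + 1)) (conv (circ (q - 1) f g) h xs)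
     - sg (q - 1 + (p + q + r)) (hb (p + q + r - 2) (brace (q - 1) (r - 1) f g h) xs)"
    unfolding hb_brace[OF ZD(4,3,2)[OF f] ZD(3,2)[OF g] ZD(3,2)[OF h]]
    by (cases "even p"; cases "even q"; cases "even r"; simp add: sg_def)
  show ?thesis
    unfolding hb_sg br_def circ_left circ_right[OF ZD(4)[OF f]] 1 conv_circ[OF ZD(3)[OF g]] conv_linear
    by (cases "even p"; cases "even q"; cases "even r"; simp add: sg_def)
qed

theorem gerstenhaber_HH: "gerstenhaber_algebra H (HH_cup scale) (HH_one scale) (HH_bracket scale)"
proof (rule gerstenhaber_algebra.intro)
  fix n show "vectorspace class_ring (H n)" by (rule vectorspace_HH)
next
  fix y p q assume "y \<in> carrier (H q)"
  then obtain g where g: "g \<in> Z q" "y = cls q g" by (rule carrierE)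
  show "linear_map class_ring (H p) (H (p + q)) (\<lambda>x. HH_cup scale p q x y)"
    by (rule linear_map_HH[of p "\<lambda>f xs. sg (p * q) (conv f g xs)"])
      (auto simp: g cup_HH Z_sg Z_conv conv_add_left sg_add conv_scale t_simps)
  show "linear_map class_ring (H p) (H (p + q - 1)) (\<lambda>x. HH_bracket scale p q x y)"
    by (rule linear_map_HH[of p "\<lambda>f. br (p - 1) (q - 1) f g"])
      (auto simp: g bracket_HH Z_br br_left[OF ZD(1)[OF g(1)]])
next
  fix x p q assume "x \<in> carrier (H p)"
  then obtain f where f: "f \<in> Z p" "x = cls p f" by (rule carrierE)
  show "linear_map class_ring (H q) (H (p + q)) (HH_cup scale p q x)"
    by (rule linear_map_HH[of q "\<lambda>g xs. sg (p * q) (conv f g xs)"])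
      (auto simp: f cup_HH Z_sg Z_conv conv_add_right sg_add conv_scale t_simps)
  show "linear_map class_ring (H q) (H (p + q - 1)) (HH_bracket scale p q x)"
    by (rule linear_map_HH[of q "\<lambda>g. br (p - 1) (q - 1) f g"])
      (auto simp: f bracket_HH Z_br br_right[OF ZD(1)[OF f(1)]])
next
  show "HH_one scale \<in> carrier (H 0)"
    unfolding HH_one_def by (rule cls_in_carrier[OF Z_one])
next
  fix x p assume "x \<in> carrier (H p)"
  then obtain f where f: "f \<in> Z p" "x = cls p f" by (rule carrierE)
  show "HH_cup scale 0 p (HH_one scale) x = x" "HH_cup scale p 0 x (HH_one scale) = x"
    unfolding HH_one_def f(2) cup_HH[OF Z_one f(1)] cup_HH[OF f(1) Z_one] by (simp_all add: conv_one)
next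
  fix x y p q assume "x \<in> carrier (H p)" "y \<in> carrier (H q)"
  then obtain f g where f: "f \<in> Z p" "x = cls p f" and g: "g \<in> Z q" "y = cls q g" by (meson carrierE)
  \<comment> \<open>Insertion of \<open>g\<close> into \<open>f\<close> is the homotopy for
    commutativity, by \<open>hb_circ_cocycles\<close>.\<close>
  have "cls (p + q) (\<lambda>xs. sg (p * q) (conv f g xs)) = cls (p + q) (\<lambda>xs. sg (p * q) (sg (q * p) (conv g f xs)))"
  proof (rule cls_eqI)
    show "(\<lambda>xs. sg (p + 1) (circ (q - 1) f g xs)) \<in> C (p + q - 1)"
      by (intro C_sg C_circ ZD(1) f g)
    fix xs show "sg (p * q) (conv f g xs) - sg (p * q) (sg (q * p) (conv g f xs)) = hb (p + q - 1) (\<lambda>xs. sg (p + 1) (circ (q - 1) f g xs)) xs"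
      unfolding hb_sg hb_circ_cocycles[OF f(1) g(1)] by (cases "even p"; cases "even q"; simp add: sg_def)
  qed (use Z_conv[OF f(1) g(1)] Z_conv[OF g(1) f(1)] in \<open>auto intro!: Z_sg simp: add.commute\<close>)
  then show "HH_cup scale p q x y = (-1) powi (p * q) \<odot>\<^bsub>H (p + q)\<^esub> HH_cup scale q p y x"
    using Z_sg[OF Z_conv[OF g(1) f(1)]]
    unfolding f(2) g(2) cup_HH[OF f(1) g(1)] cup_HH[OF g(1) f(1)] by (simp add: smult_powi_HH add.commute)
  show "HH_bracket scale p q x y = \<ominus>\<^bsub>H (p + q - 1)\<^esub>
        ((-1) powi ((p - 1) * (q - 1)) \<odot>\<^bsub>H (p + q - 1)\<^esub> HH_bracket scale q p y x)"
  proof -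
    have z: "br (q - 1) (p - 1) g f \<in> Z (p + q - 1)" using Z_br[OF g(1) f(1)] by (simp add: add.commute)
    have "br (p - 1) (q - 1) f g = (\<lambda>xs. - sg ((p - 1) * (q - 1)) (br (q - 1) (p - 1) g f xs))"
      by (intro ext br_antisym)
    then show ?thesis
      using z Z_sg[OF z]
      unfolding f(2) g(2) bracket_HH[OF f(1) g(1)] bracket_HH[OF g(1) f(1)] by (simp add: smult_powi_HH a_inv_HH add.commute)
  qed
next
  fix x y z p q r assume "x \<in> carrier (H p)" "y \<in> carrier (H q)" "z \<in> carrier (H r)"
  then obtain f g h where f: "f \<in> Z p" "x = cls p f" and g: "g \<in> Z q" "y = cls q g" and h: "h \<in> Z r" "z = cls r h"
    by (meson carrierE)
  have "(\<lambda>xs. sg ((p + q) * r) (conv (\<lambda>xs. sg (p * q) (conv f g xs)) h xs)) = (\<lambda>xs. sg (p * (q + r)) (conv f (\<lambda>xs. sg (q * r) (conv g h xs)) xs))"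
    unfolding conv_linear conv_assoc sg_sg by (intro ext sg_cong) (auto simp: algebra_simps)
  then show "HH_cup scale (p + q) r (HH_cup scale p q x y) z = HH_cup scale p (q + r) x (HH_cup scale q r y z)"
    unfolding f(2) g(2) h(2) cup_HH[OF f(1) g(1)] cup_HH[OF g(1) h(1)]
      cup_HH[OF Z_sg[OF Z_conv[OF f(1) g(1)]] h(1)] cup_HH[OF f(1) Z_sg[OF Z_conv[OF g(1) h(1)]]]
    by (simp add: add.assoc)
  note fg = Z_br[OF f(1) g(1)] and gh = Z_br[OF g(1) h(1)] and fh = Z_br[OF f(1) h(1)]
  have e: "p + (q + r - 1) - 1 = p + q + r - 2" "p + q - 1 + r - 1 = p + q + r - 2" "q + (p + r - 1) - 1 = p + q + r - 2"
    by simp_all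
  have e': "p + (q + r) - 1 = p + q + r - 1" "p + q - 1 + r = p + q + r - 1" "q + (p + r - 1) = p + q + r - 1"
    by simp_all
  note d = Z_br[OF f(1) gh, unfolded e] Z_br[OF fg h(1), unfolded e] Z_br[OF g(1) fh, unfolded e]
  \<comment> \<open>The Jacobi identity already holds for the representatives, so that no primitive
    has to be exhibited.\<close>
  have J: "br (p - 1) (q + r - 1 - 1) f (br (q - 1) (r - 1) g h) = (\<lambda>xs. br (p + q - 1 - 1) (r - 1) (br (p - 1) (q - 1) f g) h xs
      + sg ((p - 1) * (q - 1)) (br (q - 1) (p + r - 1 - 1) g (br (p - 1) (r - 1) f h) xs))"
  proof
    fix xs
    have "homog (p - 1 + 1) f" "homog (q - 1 + 1) g" "homog (r - 1 + 1) h"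
      using ZD(3)[OF f(1)] ZD(3)[OF g(1)] ZD(3)[OF h(1)] by simp_all
    from br_jacobi[OF ZD(4)[OF f(1)] this(1) ZD(4)[OF g(1)] this(2) ZD(4)[OF h(1)] this(3), of xs]
    show "br (p - 1) (q + r - 1 - 1) f (br (q - 1) (r - 1) g h) xs = br (p + q - 1 - 1) (r - 1) (br (p - 1) (q - 1) f g) h xs
      + sg ((p - 1) * (q - 1)) (br (q - 1) (p + r - 1 - 1) g (br (p - 1) (r - 1) f h) xs)"
      by (simp add: algebra_simps)
  qed
  show "HH_bracket scale p (q + r - 1) x (HH_bracket scale q r y z) =
        HH_bracket scale (p + q - 1) r (HH_bracket scale p q x y) z \<oplus>\<^bsub>H (p + q + r - 2)\<^esub>
        (-1) powi ((p - 1) * (q - 1)) \<odot>\<^bsub>H (p + q + r - 2)\<^esub>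
          HH_bracket scale q (p + r - 1) y (HH_bracket scale p r x z)"
    unfolding f(2) g(2) h(2) bracket_HH[OF f(1) g(1)] bracket_HH[OF g(1) h(1)] bracket_HH[OF f(1) h(1)]
      bracket_HH[OF f(1) gh] bracket_HH[OF fg h(1)] bracket_HH[OF g(1) fh] e
      smult_powi_HH[OF d(3)] add_HH[OF d(2) Z_sg[OF d(3)]] J ..
  note gh' = Z_sg[OF Z_conv[OF g(1) h(1)]]
  note d' = Z_br[OF f(1) gh', unfolded e'] Z_sg[OF Z_conv[OF fg h(1), unfolded e']] Z_sg[OF Z_conv[OF g(1) fh, unfolded e']]
  have "cls (p + q + r - 1) (br (p - 1) (q + r - 1) f (\<lambda>xs. sg (q * r) (conv g h xs)))
     = cls (p + q + r - 1) (\<lambda>xs. sg ((p + q - 1) * r) (conv (br (p - 1) (q - 1) f g) h xs)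
      + sg ((p - 1) * q) (sg (q * (p + r - 1)) (conv g (br (p - 1) (r - 1) f h) xs)))"
    by (rule cls_eqI[OF d'(1) Z_add[OF d'(2) Z_sg[OF d'(3)]] C_sg[OF C_brace[OF ZD(1)[OF f(1)] ZD(1)[OF g(1)] ZD(1)[OF h(1)]]]
          _ poisson_cocycles[OF f(1) g(1) h(1)]]) simp
  then show "HH_bracket scale p (q + r) x (HH_cup scale q r y z) =
        HH_cup scale (p + q - 1) r (HH_bracket scale p q x y) z \<oplus>\<^bsub>H (p + q + r - 1)\<^esub>
        (-1) powi ((p - 1) * q) \<odot>\<^bsub>H (p + q + r - 1)\<^esub>
          HH_cup scale q (p + r - 1) y (HH_bracket scale p r x z)"
    unfolding f(2) g(2) h(2) bracket_HH[OF f(1) g(1)] cup_HH[OF g(1) h(1)] bracket_HH[OF f(1) h(1)]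
      bracket_HH[OF f(1) gh'] cup_HH[OF fg h(1)] cup_HH[OF g(1) fh] e'
      smult_powi_HH[OF d'(3)] add_HH[OF d'(2) Z_sg[OF d'(3)]] .
qed

end

section \<open>The Batalin-Vilkovisky operator\<close>

context frobenius_algebra
begin

lemma Delta_add:
  assumes "f \<in> C n" "g \<in> C n"
  shows "Delta (\<lambda>xs. f xs + g xs) xs = Delta f xs + Delta g xs"
  by (rule form_left_eqI)
    (simp add: form_left form_Delta[OF C_mlin[OF C_add[OF assms]]] form_Delta[OF C_mlin[OF assms(1)]] form_Delta[OF C_mlin[OF assms(2)]] rot_add)

lemma Delta_diff:
  assumes "f \<in> C n" "g \<in> C n"
  shows "Delta (\<lambda>xs. f xs - g xs) xs = Delta f xs - Delta g xs"
  by (rule form_left_eqI)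
    (simp add: form_left form_Delta[OF C_mlin[OF C_diff[OF assms]]] form_Delta[OF C_mlin[OF assms(1)]] form_Delta[OF C_mlin[OF assms(2)]] rot_diff)

lemma Delta_scale:
  assumes "f \<in> C n"
  shows "Delta (\<lambda>xs. c *s f xs) xs = c *s Delta f xs"
  by (rule form_left_eqI)
    (simp add: form_scale_left form_Delta[OF C_mlin[OF C_scale[OF assms]]] form_Delta[OF C_mlin[OF assms]] rot_def form_scale.t_sums flip: form_scale.t_simps)

lemma Delta_sg:
  assumes "f \<in> C n"
  shows "Delta (\<lambda>xs. sg k (f xs)) xs = sg k (Delta f xs)"
  by (rule form_left_eqI)
    (simp add: form_left form_Delta[OF C_mlin[OF C_sg[OF assms]]] form_Delta[OF C_mlin[OF assms]] rot_sg)

lemma Delta_zero: "Delta (\<lambda>_. 0) xs = 0"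
  unfolding Delta_def by (rule repr_eqI) (simp add: form_left rot_def)

text \<open>The outer operator depends only on the numbers \<open>form (Delta f l) 1\<close>. In
  these, 1 stands in the block and hence among the arguments of \<open>f\<close>, which is
  normalized.\<close>

lemma Delta_Delta:
  assumes f: "f \<in> C n"
  shows "Delta (Delta f) xs = 0"
proof (rule form_left_eqI)
  fix z
  have n1: "f (us @ 1 # ws) = 0" for us ws
    using f by (simp add: cochains_iff nml_def nlin_def)
  have "form (Delta f l) 1 = 0" for l
    unfolding form_Delta[OF C_mlin[OF f]] rot_def by (simp add: n1 form_left)
  then show "form (Delta (Delta f) xs) z = form 0 z"
    unfolding form_Delta[OF C_mlin[OF C_Delta[OF f]]] by (simp add: rot_def form_left)
qed

lemma Delta_invariant:
  assumes f: "f \<in> C n" "twist f = f"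
  shows "twist (Delta f) = Delta f"
proof
  fix xs
  have N: "f (map N xs) = N (f xs)" for xs using f(2) twist_eq_iff by blast
  have "form (f (map N l)) 1 = form (f l) 1" for l
    using form_N[of "f l" 1] by (simp add: N N_one)
  moreover have "v @ N z # map N (map N u) = map N (v' @ z # map N u)" if "v = map N v'" for u v v' z
    using that by simp
  ultimately have "rot N (\<lambda>l. form (f l) 1) (map N xs) (N z) [] = rot N (\<lambda>l. form (f l) 1) xs z []" for z
    unfolding rot_def split2_map by (intro split2_cong sg_cong) (simp_all flip: map_append list.map(2))
  then have "form (twist (Delta f) xs) z = form (Delta f xs) z" for z
    unfolding form_twist form_Delta[OF C_mlin[OF f(1)]] .
  then show "twist (Delta f) xs = Delta f xs" by (rule form_left_eqI)
qed

definition Delta_HH :: "int \<Rightarrow> ('a list \<Rightarrow> 'a) set \<Rightarrow> ('a list \<Rightarrow> 'a) set" where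
  "Delta_HH n U = (\<Union>f\<in>{f \<in> U. twist f = f}. cls (n - 1) (\<lambda>xs. - Delta f xs))"

lemma Z_Delta:
  assumes f: "f \<in> Z n" "twist f = f"
  shows "(\<lambda>xs. - Delta f xs) \<in> Z (n - 1)"
proof -
  have "hb (n - 1) (Delta f) xs = 0" for xs
    using Delta_hb[OF C_mlin[OF ZD(1)[OF f(1)]] ZD(3)[OF f(1)], of xs] f(2) ZD(2)[OF f(1)] by (simp add: Delta_zero)
  then show ?thesis
    using C_Delta[OF ZD(1)[OF f(1)]] by (intro Z_uminus) (simp add: cocycles_iff fun_eq_iff)
qed

text \<open>Two invariant representatives differ by the differential of an invariant
  \<open>v\<close>. For such \<open>v\<close> the twist terms in \<open>Delta_hb\<close> cancel, so
  that \<open>Delta\<close> of this difference is again a coboundary.\<close>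

lemma Delta_HH_cls:
  assumes ss: "semisimple_endo scale N" and f: "f \<in> Z n" "twist f = f"
  shows "Delta_HH n (cls n f) = cls (n - 1) (\<lambda>xs. - Delta f xs)"
proof -
  have "cls (n - 1) (\<lambda>xs. - Delta f' xs) = cls (n - 1) (\<lambda>xs. - Delta f xs)"
    if f': "f' \<in> Z n" "cls n f' = cls n f" "twist f' = f'" for f'
  proof -
    obtain h where h: "h \<in> C (n - 1)" "f' = (\<lambda>xs. f xs + hb (n - 1) h xs)"
      using cls_eqE[OF f'(2,1) f(1)] by metis
    have hb_h: "hb (n - 1) h = (\<lambda>xs. f' xs - f xs)" by (simp add: h(2))
    have "twist (hb (n - 1) h) = hb (n - 1) h"
      unfolding hb_h fun_eq_iff twist_diff f(2) f'(3) by simp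
    then obtain v where v: "v \<in> C (n - 1)" "twist v = v" "hb (n - 1) v = hb (n - 1) h"
      using invariant_primitive[OF ss h(1)] by blast
    have "Delta f' xs - Delta f xs = - hb (n - 1 - 1) (Delta v) xs" for xs
      using Delta_hb[OF C_mlin[OF v(1)] CD(1)[OF v(1)], of xs] v(2)
      unfolding v(3) hb_h Delta_diff[OF ZD(1)[OF f'(1)] ZD(1)[OF f(1)]] by simp
    then have "- Delta f' xs - - Delta f xs = hb (n - 1 - 1) (Delta v) xs" for xs
      by (simp only: minus_diff_minus minus_minus)
    then show ?thesis
      by (intro cls_eqI[OF Z_Delta[OF f'(1,3)] Z_Delta[OF f] C_Delta[OF v(1)]]) simp_all
  qed
  moreover have "f \<in> {f' \<in> cls n f. twist f' = f'}" using f by (simp add: mem_cls)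
  ultimately show ?thesis
    unfolding Delta_HH_def by (intro SUP_eq_const) (auto simp only: mem_cls)
qed

lemma invariant_carrierE:
  assumes "semisimple_endo scale N" "x \<in> carrier (H n)"
  obtains f where "f \<in> Z n" "twist f = f" "x = cls n f"
proof -
  obtain f where f: "f \<in> Z n" "x = cls n f" using assms(2) by (rule carrierE)
  obtain u h where u: "u \<in> C n" "h \<in> C (n - 1)" "hb n u = (\<lambda>_. 0)" "twist u = u" "\<And>xs. f xs - u xs = hb (n - 1) h xs"
    using invariant_representative[OF assms(1) ZD(1,2)[OF f(1)]] by metis
  have "u \<in> Z n" using u by (simp add: cocycles_iff)
  moreover have "cls n f = cls n u"
    by (rule cls_eqI[OF f(1) \<open>u \<in> Z n\<close> u(2)]) (simp_all add: u(5))
  ultimately show ?thesis using that u(4) f(2) by blast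
qed

lemma twist_conv: "twist f = f \<Longrightarrow> twist g = g \<Longrightarrow> twist (conv f g) = conv f g"
  unfolding twist_eq_iff by (simp add: conv_def split2_map N_sums nakayama_mult)

lemma twist_sg: "twist f = f \<Longrightarrow> twist (\<lambda>xs. sg k (f xs)) = (\<lambda>xs. sg k (f xs))"
  unfolding twist_eq_iff by (simp add: N_sums)

lemma linear_map_Delta_HH:
  assumes ss: "semisimple_endo scale N"
  shows "linear_map class_ring (H n) (H (n - 1)) (Delta_HH n)"
proof -
  have "Delta_HH n x \<in> carrier (H (n - 1))" if "x \<in> carrier (H n)" for x
    using ss that by (rule invariant_carrierE) (simp add: Delta_HH_cls[OF ss] cls_in_carrier Z_Delta)
  moreover have "Delta_HH n (x \<oplus>\<^bsub>H n\<^esub> y) = Delta_HH n x \<oplus>\<^bsub>H (n - 1)\<^esub> Delta_HH n y"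
    if x: "x \<in> carrier (H n)" and y: "y \<in> carrier (H n)" for x y
  proof -
    obtain f where f: "f \<in> Z n" "twist f = f" "x = cls n f" using ss x by (rule invariant_carrierE)
    obtain g where g: "g \<in> Z n" "twist g = g" "y = cls n g" using ss y by (rule invariant_carrierE)
    have "twist (\<lambda>xs. f xs + g xs) = (\<lambda>xs. f xs + g xs)" by (simp add: fun_eq_iff twist_add f g)
    then show ?thesis
      by (simp add: f g add_HH Delta_HH_cls[OF ss] Z_add Z_Delta Delta_add[OF ZD(1)[OF f(1)] ZD(1)[OF g(1)]])
  qed
  moreover have "Delta_HH n (c \<odot>\<^bsub>H n\<^esub> x) = c \<odot>\<^bsub>H (n - 1)\<^esub> Delta_HH n x"
    if x: "x \<in> carrier (H n)" for c x
  proof -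
    obtain f where f: "f \<in> Z n" "twist f = f" "x = cls n f" using ss x by (rule invariant_carrierE)
    have "twist (\<lambda>xs. c *s f xs) = (\<lambda>xs. c *s f xs)" by (simp add: fun_eq_iff twist_scale f)
    then show ?thesis
      by (simp add: f smult_HH Delta_HH_cls[OF ss] Z_scale Z_Delta Delta_scale[OF ZD(1)[OF f(1)]])
  qed
  ultimately have "Delta_HH n \<in> LinearCombinations.module_hom class_ring (H n) (H (n - 1))"
    unfolding LinearCombinations.module_hom_def by auto
  then show ?thesis
    unfolding linear_map_def mod_hom_def mod_hom_axioms_def
    using vectorspace_HH vectorspace.axioms(1) by blast
qed

text \<open>\<open>Delta_conv\<close> expresses \<open>Delta\<close> of the product by both
  insertions, up to the differentials of the two \<open>cartan\<close> terms. It yields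
  \<open>conv (Delta g) f\<close> with the factors in the wrong order for the BV formula; the third
  summand of the primitive, \<open>circ (p - 1) (Delta g) f\<close>, is the commutativity homotopy
  that exchanges them.\<close>

lemma bracket_cohomologous:
  assumes f: "f \<in> Z p" "twist f = f" and g: "g \<in> Z q" "twist g = g"
  shows "br (p - 1) (q - 1) f g xs -
    sg (p + 1) (- Delta (\<lambda>xs. sg (p * q) (conv f g xs)) xs
      - sg ((p - 1) * q) (conv (\<lambda>xs. - Delta f xs) g xs)
      - sg p (sg (p * (q - 1)) (conv f (\<lambda>xs. - Delta g xs) xs)))
    = hb (p + q - 2) (\<lambda>xs. cartan (q - 1) f g xs + sg (p * q + p + q) (cartan (p - 1) g f xs)
      + sg ((p - 1) * (q - 1)) (circ (p - 1) (Delta g) f xs)) xs"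
proof -
  have "Delta g \<in> Z (q - 1)" using Z_uminus[OF Z_Delta[OF g]] by simp
  from hb_circ_cocycles[OF this f(1), of xs]
  have 1: "hb (p + q - 2) (circ (p - 1) (Delta g) f) xs = sg (q - 1) (conv f (Delta g) xs) - sg ((p - 1) * (q - 1)) (conv (Delta g) f xs)"
    by (simp add: algebra_simps)
  have inv: "\<And>xs. f (map N xs) = N (f xs)" "\<And>xs. g (map N xs) = N (g xs)"
    using f(2) g(2) unfolding twist_eq_iff by blast+
  note D = Delta_conv[OF C_mlin[OF ZD(1)[OF f(1)]] ZD(3,2)[OF f(1)] inv(1) C_mlin[OF ZD(1)[OF g(1)]] ZD(3,2)[OF g(1)] inv(2)]
  have m: "(\<lambda>xs. - F xs) = (\<lambda>xs. sg 1 (F xs))" for F :: "'a list \<Rightarrow> 'a"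
    by (simp add: uminus_eq_sg)
  show ?thesis
    unfolding hb_add hb_sg 1 br_def m conv_linear Delta_sg[OF C_conv[OF ZD(1)[OF f(1)] ZD(1)[OF g(1)]]] D
    by (cases "even p"; cases "even q"; simp add: sg_def algebra_simps)
qed

theorem bv_operator_HH:
  assumes ss: "semisimple_endo scale N"
  shows "bv_operator H (HH_cup scale) (HH_one scale) (HH_bracket scale) Delta_HH"
proof (rule bv_operator.intro[OF gerstenhaber_HH bv_operator_axioms.intro])
  fix n show "linear_map class_ring (H n) (H (n - 1)) (Delta_HH n)"
    by (rule linear_map_Delta_HH[OF ss])
next
  fix x n assume "x \<in> carrier (H n)"
  with ss obtain f where f: "f \<in> Z n" "twist f = f" "x = cls n f" by (rule invariant_carrierE)
  have m: "(\<lambda>xs. - Delta f xs) = (\<lambda>xs. sg 1 (Delta f xs))" by (simp add: uminus_eq_sg)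
  have "twist (\<lambda>xs. - Delta f xs) = (\<lambda>xs. - Delta f xs)"
    unfolding m by (rule twist_sg[OF Delta_invariant[OF ZD(1)[OF f(1)] f(2)]])
  moreover have "(\<lambda>xs. - Delta (\<lambda>xs. - Delta f xs) xs) = (\<lambda>_. 0)"
    unfolding m Delta_sg[OF C_Delta[OF ZD(1)[OF f(1)]]] Delta_Delta[OF ZD(1)[OF f(1)]] by simp
  ultimately show "Delta_HH (n - 1) (Delta_HH n x) = \<zero>\<^bsub>H (n - 2)\<^esub>"
    using Delta_HH_cls[OF ss Z_Delta[OF f(1,2)]] by (simp add: f(3) Delta_HH_cls[OF ss f(1,2)] zero_HH)
next
  have "twist one_cochain = one_cochain"
    unfolding twist_eq_iff by (simp add: one_cochain_def N_one N_zero)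
  \<comment> \<open>\<open>Delta one_cochain\<close> has degree \<open>-1\<close>, and a cochain of
    negative degree is zero.\<close>
  moreover have "(\<lambda>xs. - Delta one_cochain xs) = (\<lambda>_. 0)"
    using CD(1)[OF C_Delta[OF ZD(1)[OF Z_one]]] by (auto simp: homog_def fun_eq_iff)
  ultimately show "Delta_HH 0 (HH_one scale) = \<zero>\<^bsub>H (-1)\<^esub>"
    unfolding HH_one_def using Delta_HH_cls[OF ss Z_one] by (simp add: zero_HH)
next
  fix x y p q assume x: "x \<in> carrier (H p)" and y: "y \<in> carrier (H q)"
  from ss x obtain f where f: "f \<in> Z p" "twist f = f" "x = cls p f" by (rule invariant_carrierE)
  from ss y obtain g where g: "g \<in> Z q" "twist g = g" "y = cls q g" by (rule invariant_carrierE)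
  note c = Z_sg[OF Z_conv[OF f(1) g(1)]] twist_sg[OF twist_conv[OF f(2) g(2)]]
  have e: "p - 1 + q = p + q - 1" "p + (q - 1) = p + q - 1" by simp_all
  note df = Z_Delta[OF f(1,2)] and dg = Z_Delta[OF g(1,2)]
  note z = Z_Delta[OF c] Z_sg[OF Z_conv[OF df g(1), unfolded e]] Z_sg[OF Z_conv[OF f(1) dg, unfolded e]]
  have zd: "(\<lambda>xs. a xs - b xs) \<in> Z n" if "a \<in> Z n" "b \<in> Z n" for a b n
    using Z_add[OF that(1) Z_uminus[OF that(2)]] by simp
  let ?h = "\<lambda>xs. cartan (q - 1) f g xs + sg (p * q + p + q) (cartan (p - 1) g f xs) + sg ((p - 1) * (q - 1)) (circ (p - 1) (Delta g) f xs)"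
  have "?h \<in> C (p + q - 2)"
    using C_cartan[OF ZD(1)[OF f(1)] ZD(1)[OF g(1)]] C_cartan[OF ZD(1)[OF g(1)] ZD(1)[OF f(1)]]
      C_circ[OF C_Delta[OF ZD(1)[OF g(1)]] ZD(1)[OF f(1)]]
    by (intro C_add C_sg) (simp_all add: add.commute algebra_simps)
  then show "HH_bracket scale p q x y = (-1) powi (p + 1) \<odot>\<^bsub>H (p + q - 1)\<^esub>
        (Delta_HH (p + q) (HH_cup scale p q x y)
          \<ominus>\<^bsub>H (p + q - 1)\<^esub> HH_cup scale (p - 1) q (Delta_HH p x) y
          \<ominus>\<^bsub>H (p + q - 1)\<^esub> (-1) powi p \<odot>\<^bsub>H (p + q - 1)\<^esub> HH_cup scale p (q - 1) x (Delta_HH q y))"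
    unfolding f(3) g(3) bracket_HH[OF f(1) g(1)] cup_HH[OF f(1) g(1)] Delta_HH_cls[OF ss c]
      Delta_HH_cls[OF ss f(1,2)] Delta_HH_cls[OF ss g(1,2)] cup_HH[OF df g(1)] cup_HH[OF f(1) dg] e
      smult_powi_HH[OF z(3)] a_minus_HH[OF z(1,2)] a_minus_HH[OF zd[OF z(1,2)] Z_sg[OF z(3)]]
      smult_powi_HH[OF zd[OF zd[OF z(1,2)] Z_sg[OF z(3)]]]
    by (intro cls_eqI[OF Z_br[OF f(1) g(1)] Z_sg[OF zd[OF zd[OF z(1,2)] Z_sg[OF z(3)]]] _ _ bracket_cohomologous[OF f(1,2) g(1,2)]]) simp_all
qed

end

theorem theorem0p1:
  fixes scale :: "'k::field \<Rightarrow> 'a::{ring, monoid_mult} \<Rightarrow> 'a"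
    and form :: "'a \<Rightarrow> 'a \<Rightarrow> 'k"
  assumes "frobenius_algebra scale form"
    and "semisimple_endo scale (nakayama form)"
  shows "bv_algebra (HH scale) (HH_cup scale) (HH_one scale) (HH_bracket scale)"
  unfolding bv_algebra_def using frobenius_algebra.bv_operator_HH[OF assms] by blast

end
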